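(* Let $n\ge 3$. The variety $Z_n\subset\mathbb P\big((\mathbb C^2)^{\otimes n}\big)$ of principal minors of symmetric $n\times n$ matrices is cut out set-theoretically by the hyperdeterminantal module $HD$, that is, $Z_n$ is equal (as a set) to the common zero set $\mathcal V(HD)$ of all polynomials in $HD$. Here $HD$ is the irreducible $\left(\mathrm{SL}(2)^{\times n}\right)\ltimes\mathfrak S_n$-module of degree $4$ polynomials $$HD=S_{(2,2)}S_{(2,2)}S_{(2,2)}S_{(4)}\cdots S_{(4)}$$ (with $n-3$ factors $S_{(4)}$).
   Context: All vector spaces are over $\mathbb C$. Let $V_1,\dots,V_n$ be copies of $\mathbb C^2$, $V_i$ having basis $x_i^0,x_i^1$. For a binary multi-index $I=[i_1,\dots,i_n]$, $i_k\in\{0,1\}$, put $|I|=\sum_k i_k$ and $X^I=x_1^{i_1}\otimes\cdots\otimes x_n^{i_n}$; these form a basis of $V_1\otimes\cdots\otimes V_n=(\mathbb C^2)^{\otimes n}$, and a tensor is written $z=\sum_I z_IX^I$. For a symmetric matrix $A\in S^2\mathbb C^n$, $\Delta_I(A)$ is the principal minor of $A$ on the rows and columns $k$ with $i_k=1$ (with $\Delta_{[0,\dots,0]}(A)=1$). $Z_n$ is the projective variety given by (the Zariski closure of the image of) the rational map $\varphi:\mathbb P(S^2\mathbb C^n\oplus\mathbb C)\dashrightarrow\mathbb P((\mathbb C^2)^{\otimes n})$, $[A,t]\mapsto\big[\sum_I t^{n-|I|}\Delta_I(A)X^I\big]$, defined where $t\ne0$. The group $\left(\mathrm{SL}(2)^{\times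 n}\right)\ltimes\mathfrak S_n$ acts on $(\mathbb C^2)^{\otimes n}$, $\mathrm{SL}(2)^{\times n}$ acting factor by factor and $\mathfrak S_n$ permuting the factors; it acts on polynomials by $(g.f)(z)=f(g^{-1}.z)$. The hyperdeterminantal module $HD\subset S^4(V_1^*\otimes\cdots\otimes V_n^* )$ is the linear span of the $\left(\mathrm{SL}(2)^{\times n}\right)\ltimes\mathfrak S_n$-orbit of Cayley's $2\times2\times2$ hyperdeterminant in the variables $w_{ijk}:=z_{[i,j,k,0,\dots,0]}$, namely $$w_{000}^2w_{111}^2+w_{100}^2w_{011}^2+w_{010}^2w_{101}^2+w_{001}^2w_{110}^2-2w_{000}w_{100}w_{011}w_{111}-2w_{000}w_{010}w_{101}w_{111}-2w_{000}w_{001}w_{110}w_{111}-2w_{100}w_{010}w_{011}w_{101}-2w_{100}w_{001}w_{011}w_{110}-2w_{010}w_{001}w_{101}w_{110}+4w_{000}w_{011}w_{101}w_{110}+4w_{001}w_{010}w_{100}w_{111}.$$ Notation: $S_\pi$ denotes the Schur functor of a partition $\pi$, and $S_{\pi_1}\cdots S_{\pi_n}$ denotes the sum, over all permutations giving distinct modules, of $S_{\pi_{\sigma(1)}}V_1^*\otimes\cdots\otimes S_{\pi_{\sigma(n)}}V_n^*$. Thus, as an $\mathrm{SL}(2)^{\times n}$-module, $HD\cong\bigoplus_{K}\bigotimes_{k\in K}S_{(2,2)}V_k^*\otimes\bigotimes_{j\notin K}S_{(4)}V_j^*$, the sum being over $3$-element subsets $K\subset\{1,\dots,n\}$. *)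

theory Defs
  imports
    "HOL-Algebra.Product_Groups"
    "HOL-Library.Function_Algebras"
    "HOL-Combinatorics.Permutations"
    "Jordan_Normal_Form.Determinant"
    "Jordan_Normal_Form.DL_Submatrix"
begin

text \<open>
  All vector spaces below are spaces of complex-valued functions \<^term>\<open>f :: 'x \<Rightarrow> complex\<close> with the
  pointwise operations.
\<close>

definition fscale :: "complex \<Rightarrow> ('x \<Rightarrow> complex) \<Rightarrow> 'x \<Rightarrow> complex" where
  "fscale c f = (\<lambda>x. c * f x)"

interpretation cfun: vector_space "fscale :: complex \<Rightarrow> ('x \<Rightarrow> complex) \<Rightarrow> _"
  by unfold_locales (auto simp: fscale_def fun_eq_iff algebra_simps)


section \<open>Tensors\<close>

text \<open>
  Let \<^term>\<open>P\<close> be a finite set of tensor positions. A binary multi-index \<open>I = (i\<^sub>p)\<close>, \<open>p \<in> P\<close>, is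
  encoded as the set of positions with \<open>i\<^sub>p = 1\<close>, so \<open>|I|\<close> is the cardinality of that set, and a
  tensor \<open>z = \<Sum>\<^sub>I z\<^sub>I X\<^sup>I\<close> in the product over \<^term>\<open>P\<close> of copies of \<open>\<complex>\<^sup>2\<close> is encoded by its
  coordinates \<open>z\<^sub>I\<close>, extended by zero to the sets not contained in \<^term>\<open>P\<close>. The factors
  \<open>V\<^sub>1, \<dots>, V\<^sub>n\<close> are numbered by \<^term>\<open>{..<n}\<close>, i.e. starting with 0.
\<close>

definition tensors :: "'p set \<Rightarrow> ('p set \<Rightarrow> complex) set" where
  "tensors P = {z. \<forall>I. \<not> I \<subseteq> P \<longrightarrow> z I = 0}"

text \<open>
  In \<open>mat_act\<close> the matrix \<^term>\<open>g p\<close> acts on the factor at position \<^term>\<open>p\<close>; columns are images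
  of basis vectors.
\<close>

definition mat_act :: "'p set \<Rightarrow> ('p \<Rightarrow> complex mat) \<Rightarrow> ('p set \<Rightarrow> complex) \<Rightarrow> 'p set \<Rightarrow> complex" where
  "mat_act P g z = (\<lambda>I. if I \<subseteq> P
     then \<Sum>J\<in>Pow P. (\<Prod>p\<in>P. g p $$ (of_bool (p \<in> I), of_bool (p \<in> J))) * z J
     else 0)"

text \<open>
  \<open>perm_act s\<close> moves the factor at position \<open>p\<close> to position \<open>s p\<close>, i.e. it sends \<open>X\<^sup>I\<close> to the
  basis tensor indexed by the image of \<open>I\<close> under \<open>s\<close>.
\<close>

definition perm_act :: "('p \<Rightarrow> 'p) \<Rightarrow> ('p set \<Rightarrow> complex) \<Rightarrow> 'p set \<Rightarrow> complex" where
  "perm_act s z = (\<lambda>I. z (s -` I))"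


section \<open>The groups\<close>

definition SL2 :: "complex mat monoid" where
  "SL2 = \<lparr>carrier = {g \<in> carrier_mat 2 2. det g = 1}, monoid.mult = (*), one = 1\<^sub>m 2\<rparr>"

lemma group_SL2: "group SL2"
proof (rule groupI)
  fix g assume "g \<in> carrier SL2"
  then have g: "g \<in> carrier_mat 2 2" "det g = 1" by (auto simp: SL2_def)
  from adj_mat[OF g(1)] g
  have a: "adj_mat g \<in> carrier_mat 2 2" "adj_mat g * g = 1\<^sub>m 2" by auto
  from det_mult[OF a(1) g(1)] a g have "det (adj_mat g) = 1" by simp
  with a show "\<exists>h\<in>carrier SL2. h \<otimes>\<^bsub>SL2\<^esub> g = \<one>\<^bsub>SL2\<^esub>" by (auto simp: SL2_def)
qed (auto simp: SL2_def det_mult)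

definition SL2_pow :: "nat \<Rightarrow> (nat \<Rightarrow> complex mat) monoid" where
  "SL2_pow n = product_group {..<n} (\<lambda>_. SL2)"

text \<open>
  The pair \<open>(g, s)\<close> stands for ``first permute by \<open>s\<close>, then apply \<open>g\<close>''.
\<close>

definition SL2_sym :: "nat \<Rightarrow> ((nat \<Rightarrow> complex mat) \<times> (nat \<Rightarrow> nat)) monoid" where
  "SL2_sym n = \<lparr>carrier = carrier (SL2_pow n) \<times> {s. s permutes {..<n}},
     monoid.mult = (\<lambda>(g, s) (h, t).
       (g \<otimes>\<^bsub>SL2_pow n\<^esub> (\<lambda>k\<in>{..<n}. h (Hilbert_Choice.inv s k)), s \<circ> t)),
     one = (\<one>\<^bsub>SL2_pow n\<^esub>, id)\<rparr>"

lemma group_SL2_sym: "group (SL2_sym n)"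
proof -
  interpret S: group SL2 by (rule group_SL2)
  have pm: "Hilbert_Choice.inv s k \<in> {..<n}" if "s permutes {..<n}" "k \<in> {..<n}" for s k
    using that by (metis permutes_in_image permutes_inv)
  have pm2: "s k \<in> {..<n}" if "s permutes {..<n}" "k \<in> {..<n}" for s k
    using that by (metis permutes_in_image)
  show ?thesis
  proof (rule groupI)
    fix x y assume "x \<in> carrier (SL2_sym n)" "y \<in> carrier (SL2_sym n)"
    then show "x \<otimes>\<^bsub>SL2_sym n\<^esub> y \<in> carrier (SL2_sym n)"
      by (auto simp: SL2_sym_def SL2_pow_def permutes_compose PiE_iff dest: pm)
  next
    show "\<one>\<^bsub>SL2_sym n\<^esub> \<in> carrier (SL2_sym n)"
      by (auto simp: SL2_sym_def SL2_pow_def permutes_id)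
  next
    fix x y z assume "x \<in> carrier (SL2_sym n)" "y \<in> carrier (SL2_sym n)" "z \<in> carrier (SL2_sym n)"
    then obtain g s h t k u where *: "x = (g, s)" "y = (h, t)" "z = (k, u)"
      "s permutes {..<n}" "t permutes {..<n}" "u permutes {..<n}"
      "\<And>i. i < n \<Longrightarrow> g i \<in> carrier SL2" "\<And>i. i < n \<Longrightarrow> h i \<in> carrier SL2" "\<And>i. i < n \<Longrightarrow> k i \<in> carrier SL2"
      by (auto simp: SL2_sym_def SL2_pow_def PiE_iff)
    have "Hilbert_Choice.inv (s \<circ> t) = Hilbert_Choice.inv t \<circ> Hilbert_Choice.inv s"
      using * by (simp add: o_inv_distrib permutes_bij)
    then show "x \<otimes>\<^bsub>SL2_sym n\<^esub> y \<otimes>\<^bsub>SL2_sym n\<^esub> z = x \<otimes>\<^bsub>SL2_sym n\<^esub> (y \<otimes>\<^bsub>SL2_sym n\<^esub> z)"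
      using pm[OF *(4)] pm[OF *(5)] * by (auto simp: SL2_sym_def SL2_pow_def fun_eq_iff S.m_assoc o_assoc restrict_def)
  next
    fix x assume "x \<in> carrier (SL2_sym n)"
    then obtain g s where *: "x = (g, s)" "s permutes {..<n}" "g \<in> {..<n} \<rightarrow>\<^sub>E carrier SL2"
      by (auto simp: SL2_sym_def SL2_pow_def)
    show "\<one>\<^bsub>SL2_sym n\<^esub> \<otimes>\<^bsub>SL2_sym n\<^esub> x = x"
      using * by (auto simp: SL2_sym_def SL2_pow_def fun_eq_iff PiE_iff extensional_def)
    let ?y = "((\<lambda>i\<in>{..<n}. inv\<^bsub>SL2\<^esub> (g (s i))), Hilbert_Choice.inv s)"
    have "?y \<in> carrier (SL2_sym n)"
      using * pm2[OF *(2)] by (auto simp: SL2_sym_def SL2_pow_def permutes_inv PiE_iff)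
    moreover have "?y \<otimes>\<^bsub>SL2_sym n\<^esub> x = \<one>\<^bsub>SL2_sym n\<^esub>"
      using * pm2[OF *(2)] by (auto simp: SL2_sym_def SL2_pow_def fun_eq_iff PiE_iff permutes_inv_o permutes_inv_inv permutes_inverses)
    ultimately show "\<exists>y\<in>carrier (SL2_sym n). y \<otimes>\<^bsub>SL2_sym n\<^esub> x = \<one>\<^bsub>SL2_sym n\<^esub>" by blast
  qed
qed

definition tensor_act ::
    "nat \<Rightarrow> (nat \<Rightarrow> complex mat) \<times> (nat \<Rightarrow> nat) \<Rightarrow> (nat set \<Rightarrow> complex) \<Rightarrow> nat set \<Rightarrow> complex" where
  "tensor_act n = (\<lambda>(g, s) z. mat_act {..<n} g (perm_act s z))"

definition poly_act ::
    "nat \<Rightarrow> (nat \<Rightarrow> complex mat) \<times> (nat \<Rightarrow> nat) \<Rightarrow>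
     ((nat set \<Rightarrow> complex) \<Rightarrow> complex) \<Rightarrow> (nat set \<Rightarrow> complex) \<Rightarrow> complex" where
  "poly_act n h f = (\<lambda>z. f (tensor_act n (inv\<^bsub>SL2_sym n\<^esub> h) z))"


section \<open>Representations\<close>

definition submodule ::
    "('g, 'm) monoid_scheme \<Rightarrow> ('g \<Rightarrow> ('x \<Rightarrow> complex) \<Rightarrow> 'x \<Rightarrow> complex) \<Rightarrow> ('x \<Rightarrow> complex) set \<Rightarrow> bool" where
  "submodule G act M \<longleftrightarrow> cfun.subspace M \<and> (\<forall>g\<in>carrier G. \<forall>x\<in>M. act g x \<in> M)"

definition irreducible_module ::
    "('g, 'm) monoid_scheme \<Rightarrow> ('g \<Rightarrow> ('x \<Rightarrow> complex) \<Rightarrow> 'x \<Rightarrow> complex) \<Rightarrow> ('x \<Rightarrow> complex) set \<Rightarrow> bool" where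
  "irreducible_module G act M \<longleftrightarrow>
     submodule G act M \<and> M \<noteq> {0} \<and>
     (\<forall>U. U \<subseteq> M \<longrightarrow> submodule G act U \<longrightarrow> U = {0} \<or> U = M)"

definition isomorphic_modules ::
    "('g, 'm) monoid_scheme \<Rightarrow> ('g \<Rightarrow> ('x \<Rightarrow> complex) \<Rightarrow> 'x \<Rightarrow> complex) \<Rightarrow> ('x \<Rightarrow> complex) set \<Rightarrow>
     ('g \<Rightarrow> ('y \<Rightarrow> complex) \<Rightarrow> 'y \<Rightarrow> complex) \<Rightarrow> ('y \<Rightarrow> complex) set \<Rightarrow> bool" where
  "isomorphic_modules G act M act' M' \<longleftrightarrow>
     submodule G act M \<and> submodule G act' M' \<and>
     (\<exists>F. bij_betw F M M' \<and>
        (\<forall>x\<in>M. \<forall>y\<in>M. F (x + y) = F x + F y) \<and>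
        (\<forall>c. \<forall>x\<in>M. F (fscale c x) = fscale c (F x)) \<and>
        (\<forall>g\<in>carrier G. \<forall>x\<in>M. F (act g x) = act' g (F x)))"


section \<open>Polynomials and projective varieties\<close>

text \<open>
  \<open>sym_power n d\<close> is \<open>S\<^sup>d(V\<^sub>1\<^sup>* \<otimes> \<cdots> \<otimes> V\<^sub>n\<^sup>*)\<close>: the homogeneous polynomials of degree \<open>d\<close> in the
  coordinates \<open>z\<^sub>I\<close>, as polynomial functions (\<open>\<complex>\<close> is infinite).
\<close>

definition sym_power :: "nat \<Rightarrow> nat \<Rightarrow> ((nat set \<Rightarrow> complex) \<Rightarrow> complex) set" where
  "sym_power n d = cfun.span
     {\<lambda>z. prod_list (map z Is) | Is. length Is = d \<and> set Is \<subseteq> Pow {..<n}}"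

definition proj_point :: "(nat set \<Rightarrow> complex) \<Rightarrow> (nat set \<Rightarrow> complex) set" where
  "proj_point z = {fscale c z | c. c \<noteq> 0}"

definition proj_space :: "nat \<Rightarrow> (nat set \<Rightarrow> complex) set set" where
  "proj_space n = proj_point ` (tensors {..<n} - {0})"

definition zero_locus ::
    "nat \<Rightarrow> ((nat set \<Rightarrow> complex) \<Rightarrow> complex) set \<Rightarrow> (nat set \<Rightarrow> complex) set set" where
  "zero_locus n F = {p \<in> proj_space n. \<forall>f\<in>F. \<forall>z\<in>p. f z = 0}"

definition zariski_closed :: "nat \<Rightarrow> (nat set \<Rightarrow> complex) set set \<Rightarrow> bool" where
  "zariski_closed n X \<longleftrightarrow> (\<exists>F \<subseteq> (\<Union>d. sym_power n d). X = zero_locus n F)"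

definition zariski_closure ::
    "nat \<Rightarrow> (nat set \<Rightarrow> complex) set set \<Rightarrow> (nat set \<Rightarrow> complex) set set" where
  "zariski_closure n S = \<Inter>{X. zariski_closed n X \<and> S \<subseteq> X}"


section \<open>Principal minors of symmetric matrices\<close>

definition principal_minor :: "nat set \<Rightarrow> complex mat \<Rightarrow> complex" where
  "principal_minor I A = det (submatrix A I I)"

definition minors_tensor :: "nat \<Rightarrow> complex mat \<Rightarrow> complex \<Rightarrow> nat set \<Rightarrow> complex" where
  "minors_tensor n A t = (\<lambda>I. if I \<subseteq> {..<n} then t ^ (n - card I) * principal_minor I A else 0)"

definition Z_variety :: "nat \<Rightarrow> (nat set \<Rightarrow> complex) set set" where
  "Z_variety n = zariski_closure n
     {proj_point (minors_tensor n A t) | A t.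
        A \<in> carrier_mat n n \<and> transpose_mat A = A \<and> t \<noteq> 0}"


section \<open>The hyperdeterminantal module\<close>

definition hyperdet :: "(nat set \<Rightarrow> complex) \<Rightarrow> complex" where
  "hyperdet z =
     (let w000 = z {}; w100 = z {0}; w010 = z {1}; w001 = z {2};
          w110 = z {0,1}; w101 = z {0,2}; w011 = z {1,2}; w111 = z {0,1,2}
      in w000^2 * w111^2 + w100^2 * w011^2 + w010^2 * w101^2 + w001^2 * w110^2
         - 2 * w000 * w100 * w011 * w111 - 2 * w000 * w010 * w101 * w111
         - 2 * w000 * w001 * w110 * w111 - 2 * w100 * w010 * w011 * w101
         - 2 * w100 * w001 * w011 * w110 - 2 * w010 * w001 * w101 * w110
         + 4 * w000 * w011 * w101 * w110 + 4 * w001 * w010 * w100 * w111)"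

definition HD :: "nat \<Rightarrow> ((nat set \<Rightarrow> complex) \<Rightarrow> complex) set" where
  "HD n = cfun.span {poly_act n h hyperdet | h. h \<in> carrier (SL2_sym n)}"


section \<open>Schur functors\<close>

text \<open>
  A partition \<open>\<pi>\<close> of \<open>d\<close> is a weakly decreasing list with sum \<open>d\<close>. The boxes of its diagram are
  numbered \<open>0, \<dots>, d - 1\<close> row by row.
\<close>

definition box_row :: "nat list \<Rightarrow> nat \<Rightarrow> nat" where
  "box_row \<pi> j = (LEAST r. j < sum_list (take (Suc r) \<pi>))"

definition box_col :: "nat list \<Rightarrow> nat \<Rightarrow> nat" where
  "box_col \<pi> j = j - sum_list (take (box_row \<pi> j) \<pi>)"

definition young_symmetrizer :: "nat list \<Rightarrow> (nat set \<Rightarrow> complex) \<Rightarrow> nat set \<Rightarrow> complex" where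
  "young_symmetrizer \<pi> z =
     (let B = {..<sum_list \<pi>};
          R = {p. p permutes B \<and> (\<forall>j\<in>B. box_row \<pi> (p j) = box_row \<pi> j)};
          C = {q. q permutes B \<and> (\<forall>j\<in>B. box_col \<pi> (q j) = box_col \<pi> j)}
      in \<Sum>p\<in>R. \<Sum>q\<in>C. fscale (of_int (sign q)) (perm_act p (perm_act q z)))"

text \<open>
  \<open>schur \<pi>\<close> is \<open>S\<^sub>\<pi> V\<^sup>*\<close> for \<open>V = \<complex>\<^sup>2\<close>, the image of the Young symmetrizer on the \<open>d\<close>-th tensor power
  of \<open>V\<^sup>*\<close>, in coordinates with respect to the basis dual to \<open>x\<^sup>0, x\<^sup>1\<close>.
\<close>

definition schur :: "nat list \<Rightarrow> (nat set \<Rightarrow> complex) set" where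
  "schur \<pi> = young_symmetrizer \<pi> ` tensors {..<sum_list \<pi>}"

text \<open>
  For \<open>ps = [\<pi>\<^sub>1, \<dots>, \<pi>\<^sub>n]\<close>, \<open>schur_tensor ps\<close> is \<open>S\<^bsub>\<pi>\<^sub>1\<^esub> V\<^sub>1\<^sup>* \<otimes> \<cdots> \<otimes> S\<^bsub>\<pi>\<^sub>n\<^esub> V\<^sub>n\<^sup>*\<close>, the span of the
  decomposable tensors \<open>u\<^sub>1 \<otimes> \<cdots> \<otimes> u\<^sub>n\<close>. Position \<open>(k, j)\<close> is the \<open>j\<close>-th factor of the tensor power
  of \<open>V\<^sub>k\<^sup>*\<close>.
\<close>

definition schur_tensor :: "nat list list \<Rightarrow> ((nat \<times> nat) set \<Rightarrow> complex) set" where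
  "schur_tensor ps = cfun.span
     {\<lambda>J. if J \<subseteq> {..<length ps} \<times> UNIV then \<Prod>k<length ps. u k (J `` {k}) else 0 | u.
        \<forall>k<length ps. u k \<in> schur (ps ! k)}"

text \<open>
  \<open>schur_sum ps\<close> is the module denoted \<open>S\<^bsub>\<pi>\<^sub>1\<^esub> \<cdots> S\<^bsub>\<pi>\<^sub>n\<^esub>\<close>: the direct sum of \<^term>\<open>schur_tensor qs\<close>
  over the distinct rearrangements \<^term>\<open>qs\<close> of \<^term>\<open>ps\<close>. The element with components \<open>F\<^sub>q\<^sub>s\<close> is the
  function \<open>(qs, J) \<mapsto> F\<^sub>q\<^sub>s J\<close>.
\<close>

definition schur_sum :: "nat list list \<Rightarrow> (nat list list \<times> (nat \<times> nat) set \<Rightarrow> complex) set" where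
  "schur_sum ps = {F. \<forall>qs. (\<lambda>J. F (qs, J)) \<in> (if mset qs = mset ps then schur_tensor qs else {0})}"

text \<open>
  A matrix \<open>g\<close> acts on \<open>V\<^sup>*\<close> by \<open>\<xi> \<mapsto> \<xi> \<circ> g\<^sup>-\<^sup>1\<close>, i.e. by the transpose of its inverse in dual
  coordinates.
\<close>

definition schur_act ::
    "(nat \<Rightarrow> complex mat) \<Rightarrow> (nat list list \<times> (nat \<times> nat) set \<Rightarrow> complex) \<Rightarrow>
     nat list list \<times> (nat \<times> nat) set \<Rightarrow> complex" where
  "schur_act g F = (\<lambda>(qs, J).
     mat_act (SIGMA k:{..<length qs}. {..<sum_list (qs ! k)})
       (\<lambda>(k, j). transpose_mat (inv\<^bsub>SL2\<^esub> (g k))) (\<lambda>L. F (qs, L)) J)"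

end

theory Submission
  imports Defs
begin

text \<open>
  A tensor is studied through its contractions with covectors in all positions but two or three. Both
  the \<open>2 \<times> 2\<close> determinants and the hyperdeterminants of these contractions are permuted, up to scalars,
  by the group, and \<open>HD\<close> is spanned by the hyperdeterminants.

  Zero locus. Contracting one position of the tensor of principal minors of \<open>A\<close> gives, up to a scalar, the
  tensor of principal minors of a Schur complement, so \<open>HD\<close> vanishes on \<open>Z\<^sub>n\<close> because it does for
  \<open>3 \<times> 3\<close> matrices. Conversely, move a zero \<open>z\<close> of \<open>HD\<close> by generic unipotent elements, so that
  \<open>z\<^sub>\<emptyset> = 1\<close> and \<open>\<beta>\<^sub>i\<^sub>j = z\<^sub>i z\<^sub>j - z\<^sub>i\<^sub>j\<close> is zero only if it is zero on all contractions.
  Then \<open>\<beta>\<^sub>i\<^sub>j \<noteq> 0\<close> is an equivalence relation. Wherever \<open>w\<^sub>\<emptyset> = 1\<close> the hyperdeterminant is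
  \<open>\<kappa>\<^sup>2 - 4 \<beta>\<^sub>i\<^sub>j \<beta>\<^sub>i\<^sub>k \<beta>\<^sub>j\<^sub>k\<close> with the third cumulant \<open>\<kappa>\<close>; applied to contractions along a line in a
  fourth position it forces consistent choices of the signs of \<open>a\<^sub>i\<^sub>j = \<surd>\<beta>\<^sub>i\<^sub>j\<close>, and applied along a line in
  all remaining positions it determines every further coordinate.

  Module structure. A tensor in \<open>\<Otimes>\<^sub>k (V\<^sub>k\<^sup>*)\<^sup>\<otimes>\<^sup>4\<close> is a quartic form on \<open>\<Otimes>\<^sub>k V\<^sub>k\<close>; restricted to the
  sum of Schur modules this equivariant map is injective, because evaluation at tensors
  \<open>w \<otimes> \<Otimes>\<^sub>p v\<^sub>p\<close>, where \<open>w\<close> occupies the three positions in \<open>K\<close>, kills the summands other than \<open>K\<close>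
  and recovers the summand \<open>K\<close> by interpolation. For irreducibility, fourth differences along
  transvections in the positions outside \<open>K\<close> turn an element \<open>f\<close> of \<open>HD\<close> into a multiple, with factor
  proportional to \<open>f (w \<otimes> \<Otimes>\<^sub>p v\<^sub>p)\<close>, of a single hyperdeterminant.
\<close>

section \<open>Principal minors\<close>

text \<open>Hyperdeterminants see only squares: with \<open>w {} = 1\<close> they give each
  \<open>\<tau> i j k\<close> up to sign. The roots \<open>A i j\<close> of
  \<open>\<beta> i j\<close> must be chosen so that
  \<open>2 * A i j * A i k * A j k = \<tau> i j k\<close> for all triangles at once. Roots on the
  edges from one representative of a class are free, and they fix all other entries; that triangles
  avoiding the representative come out right is the four-index relation \<open>\<tau>_four\<close>.
  Each decision about a sign is a cancellation in the domain of polynomials in one variable: two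
  polynomials with equal squares and the same nonzero value at 0 coincide. Restriction to a line
  also replaces every density argument in several variables.

  The generic translation has to be undone at the end. On minors of \<open>A\<close> it acts, up to
  a scalar, as A -> (A^-1 + D)^-1 with D diagonal, which is not defined for all \<open>A\<close>. So
  it is shown only that a polynomial vanishing on all tensors of minors also vanishes on the
  translated ones.

  The factor 12 between \<open>quartic\<close> and the hyperdeterminant is the sum 8 + 8 - 4 of the
  cubes of the six nonzero values of \<open>u22\<close>.\<close>

definition pminor :: "nat set \<Rightarrow> (nat \<Rightarrow> nat \<Rightarrow> complex) \<Rightarrow> complex" where
  "pminor I A = (\<Sum>p | p permutes I. of_int (sign p) * (\<Prod>i\<in>I. A i (p i)))"

lemma pminor_empty [simp]: "pminor {} A = 1"
  by (simp add: pminor_def)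

lemma pminor_cong:
  assumes "\<And>i j. i \<in> I \<Longrightarrow> j \<in> I \<Longrightarrow> A i j = B i j"
  shows "pminor I A = pminor I B"
proof -
  have "(\<Prod>i\<in>I. A i (p i)) = (\<Prod>i\<in>I. B i (p i))" if "p permutes I" for p
    by (rule prod.cong) (use that assms in \<open>simp_all add: permutes_in_image\<close>)
  then show ?thesis by (simp add: pminor_def)
qed

lemma pminor_scale_rows: "pminor I (\<lambda>i j. x i * A i j) = (\<Prod>i\<in>I. x i) * pminor I A"
  by (simp add: pminor_def prod.distrib sum_distrib_left mult_ac)

text \<open>A relabelling of the index set conjugates the permutations and preserves their signs, so
  a minor depends on no ordering of its rows. Minors can thus be indexed by the same sets that index
  tensor coordinates.\<close>

lemma pminor_image:
  assumes f: "inj_on f I" and fin: "finite I"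
  shows "pminor (f ` I) A = pminor I (\<lambda>i j. A (f i) (f j))"
proof -
  have bij: "bij_betw f I (f ` I)"
    using f by (simp add: bij_betw_def)
  let ?g = "inv_into I f"
  have "pminor I (\<lambda>i j. A (f i) (f j)) = (\<Sum>p | p permutes I. of_int (sign (map_permutation I f p)) *
      (\<Prod>i\<in>f ` I. A i (map_permutation I f p i)))"
    unfolding pminor_def
  proof (intro sum.cong refl)
    fix p assume "p \<in> {p. p permutes I}"
    then have p: "p permutes I" by simp
    show "of_int (sign p) * (\<Prod>i\<in>I. A (f i) (f (p i))) = of_int (sign (map_permutation I f p)) *
        (\<Prod>i\<in>f ` I. A i (map_permutation I f p i))"
      using p f fin by (simp add: sign_map_permutation prod.reindex map_permutation_apply)
  qed
  also have "\<dots> = pminor (f ` I) A"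
    unfolding pminor_def
  proof (rule sum.reindex_bij_witness[where i = "map_permutation (f ` I) ?g" and j = "map_permutation I f"])
    fix p assume "p \<in> {p. p permutes I}"
    then show "map_permutation I f p \<in> {p. p permutes f ` I}"
      using map_permutation_permutes[OF bij] by auto
    show "map_permutation (f ` I) ?g (map_permutation I f p) = p"
      using map_permutation_compose_inv[OF bij, of p ?g] \<open>p \<in> _\<close> f by simp
  next
    fix q assume "q \<in> {p. p permutes f ` I}"
    then show "map_permutation (f ` I) ?g q \<in> {p. p permutes I}"
      using map_permutation_permutes[OF bij_betw_inv_into[OF bij]] by auto
    show "map_permutation I f (map_permutation (f ` I) ?g q) = q"
      using map_permutation_compose_inv[OF bij_betw_inv_into[OF bij], of q f] \<open>q \<in> _\<close>
      by (simp add: f_inv_into_f)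
  qed simp
  finally show ?thesis by simp
qed

lemma det_eq_pminor: "det (mat n n (\<lambda>(i, j). A i j)) = pminor {0..<n} A"
proof -
  have "(\<Prod>i = 0..<n. mat n n (\<lambda>(i, j). A i j) $$ (i, p i)) = (\<Prod>i = 0..<n. A i (p i))"
    if "p permutes {0..<n}" for p
    by (rule prod.cong) (use permutes_in_image[OF that] in auto)
  then show ?thesis by (simp add: det_def'[of _ n] pminor_def)
qed

text \<open>\<open>submatrix\<close> lists its rows through \<open>pick I\<close>; all that matters
  is that this is a bijection from \<open>{0..<card I}\<close> onto \<open>I\<close>.\<close>

lemma principal_minor_eq_pminor:
  assumes "A \<in> carrier_mat n n" "I \<subseteq> {..<n}"
  shows "principal_minor I A = pminor I (\<lambda>i j. A $$ (i, j))"
proof -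
  have fin: "finite I" using assms(2) finite_subset by blast
  have eq: "{i. i < n \<and> i \<in> I} = I" using assms(2) by auto
  have im: "pick I ` {0..<card I} = I"
  proof
    show "pick I ` {0..<card I} \<subseteq> I" using pick_in_set_le by auto
    show "I \<subseteq> pick I ` {0..<card I}"
    proof
      fix i assume i: "i \<in> I"
      have "card {a\<in>I. a < i} < card I"
        by (rule psubset_card_mono[OF fin]) (use i in auto)
      then show "i \<in> pick I ` {0..<card I}"
        by (intro image_eqI[where x = "card {a\<in>I. a < i}"]) (simp_all add: pick_card_in_set[OF i])
    qed
  qed
  have "inj_on (pick I) {0..<card I}"
    by (rule eq_card_imp_inj_on) (simp_all add: im)
  from pminor_image[OF this] have "pminor I (\<lambda>i j. A $$ (i, j)) = pminor {0..<card I} (\<lambda>i j. A $$ (pick I i, pick I j))"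
    by (simp add: im)
  with assms show ?thesis
    by (simp add: principal_minor_def submatrix_def eq det_eq_pminor)
qed

text \<open>One step of Gaussian elimination: the unipotent matrix \<open>?L\<close> clears the last
  column above the pivot 1, which leaves a block lower triangular matrix with corner
  \<open>?N\<close>.\<close>

lemma pminor_pivot_top:
  assumes "A k k = 1"
  shows "pminor {0..<Suc k} A = pminor {0..<k} (\<lambda>i j. A i j - A i k * A k j)"
proof -
  let ?M = "mat (Suc k) (Suc k) (\<lambda>(i, j). A i j)"
  let ?L = "mat (Suc k) (Suc k) (\<lambda>(i, j). if i = j then 1 else if j = k then - A i k else 0)"
  let ?N = "mat k k (\<lambda>(i, j). A i j - A i k * A k j)"
  let ?B = "four_block_mat ?N (0\<^sub>m k 1) (mat 1 k (\<lambda>(i, j). A k j)) (1\<^sub>m 1)"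
  have "det ?L = prod_list (diag_mat ?L)"
    by (rule det_upper_triangular[of _ "Suc k"]) (auto simp: upper_triangular_def)
  also have "diag_mat ?L = replicate (Suc k) 1"
    by (rule nth_equalityI) (auto simp: diag_mat_def simp del: upt_Suc replicate_Suc)
  also have "prod_list \<dots> = 1"
    by (simp del: replicate_Suc)
  finally have L: "det ?L = 1" .
  have "?L * ?M = ?B"
  proof (rule eq_matI)
    fix i j assume "i < dim_row ?B" "j < dim_col ?B"
    then have ij: "i < Suc k" "j < Suc k" by auto
    have "(?L * ?M) $$ (i, j) = (\<Sum>l\<in>{0..<Suc k}. (if i = l then 1 else if l = k then - A i k else 0) * A l j)"
      using ij by (simp add: scalar_prod_def del: sum.op_ivl_Suc)
    also have "\<dots> = (\<Sum>l\<in>{0..<Suc k}. (if i = l then A l j else 0) + (if l = k then if i = k then 0 else - A i k * A l j else 0))"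
      by (rule sum.cong) auto
    also have "\<dots> = A i j + (if i = k then 0 else - A i k * A k j)"
      using ij unfolding sum.distrib by (simp add: sum.delta sum.delta' del: sum.op_ivl_Suc)
    also have "\<dots> = ?B $$ (i, j)"
      using ij assms by (auto simp: less_Suc_eq)
    finally show "(?L * ?M) $$ (i, j) = ?B $$ (i, j)" .
  qed simp_all
  then have "det ?L * det ?M = det ?B"
    by (subst det_mult[symmetric, of _ "Suc k"]) auto
  moreover have "det ?B = det ?N * det (1\<^sub>m 1 :: complex mat)"
    by (rule det_four_block_mat_upper_right_zero) auto
  ultimately show ?thesis
    using L by (simp add: det_eq_pminor)
qed

lemma pminor_pivot_one:
  assumes "finite I" "m \<notin> I" "A m m = 1"
  shows "pminor (insert m I) A = pminor I (\<lambda>i j. A i j - A i m * A m j)"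
proof -
  let ?k = "card I"
  obtain h where h: "bij_betw h {0..<?k} I"
    using ex_bij_betw_nat_finite assms(1) by blast
  define f where "f i = (if i = ?k then m else h i)" for i
  have eq: "f i = h i" if "i \<in> {0..<?k}" for i
    using that by (simp add: f_def)
  have fk: "f ?k = m"
    by (simp add: f_def)
  have "f ` {0..<?k} = h ` {0..<?k}"
    by (rule image_cong[OF refl eq])
  moreover have "inj_on f {0..<?k} \<longleftrightarrow> inj_on h {0..<?k}"
    by (rule inj_on_cong[OF eq])
  ultimately have fI: "f ` {0..<?k} = I" "inj_on f {0..<?k}"
    using h by (simp_all add: bij_betw_def)
  have fm: "f ` {0..<Suc ?k} = insert m I"
    by (simp add: atLeast0_lessThan_Suc fI fk)
  have inj: "inj_on f {0..<Suc ?k}"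
    using fI assms(2) by (simp add: atLeast0_lessThan_Suc fk)
  have "pminor (insert m I) A = pminor {0..<Suc ?k} (\<lambda>i j. A (f i) (f j))"
    using pminor_image[OF inj, of A] by (simp add: fm)
  also have "\<dots> = pminor {0..<?k} (\<lambda>i j. A (f i) (f j) - A (f i) m * A m (f j))"
    using pminor_pivot_top[of "\<lambda>i j. A (f i) (f j)" ?k] assms(3) by (simp add: fk)
  also have "\<dots> = pminor I (\<lambda>i j. A i j - A i m * A m j)"
    using pminor_image[OF fI(2), of "\<lambda>i j. A i j - A i m * A m j"] by (simp add: fI)
  finally show ?thesis .
qed

text \<open>A determinant is affine in a single diagonal entry, and the permutations fixing
  \<open>m\<close> carry its coefficient.\<close>

lemma pminor_add_diag:
  assumes "finite I" "m \<notin> I"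
  shows "pminor (insert m I) (\<lambda>i j. if i = m \<and> j = m then A i j + s else A i j)
    = pminor (insert m I) A + s * pminor I A"
proof -
  let ?P = "{p. p permutes insert m I}"
  have fin: "finite ?P" using assms by (simp add: finite_permutations)
  have pr: "(\<Prod>i\<in>I. if i = m \<and> q i = m then A i (q i) + s else A i (q i)) = (\<Prod>i\<in>I. A i (q i))" for q
    using assms by (intro prod.cong) auto
  have "pminor (insert m I) (\<lambda>i j. if i = m \<and> j = m then A i j + s else A i j)
      = (\<Sum>p\<in>?P. of_int (sign p) * (\<Prod>i\<in>insert m I. A i (p i)) +
          (if p m = m then s * (of_int (sign p) * (\<Prod>i\<in>I. A i (p i))) else 0))"
    unfolding pminor_def using assms
    by (intro sum.cong) (auto simp: pr algebra_simps)
  also have "\<dots> = pminor (insert m I) A + (\<Sum>p\<in>{p\<in>?P. p m = m}. s * (of_int (sign p) * (\<Prod>i\<in>I. A i (p i))))"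
    unfolding sum.distrib pminor_def sum.inter_filter[OF fin] ..
  also have "{p\<in>?P. p m = m} = {p. p permutes I}"
  proof (intro Set.set_eqI iffI)
    fix p assume "p \<in> {p\<in>?P. p m = m}"
    then show "p \<in> {p. p permutes I}"
      using permutes_superset[of p "insert m I" I] by auto
  next
    fix p assume "p \<in> {p. p permutes I}"
    then show "p \<in> {p\<in>?P. p m = m}"
      using permutes_subset[of p I "insert m I"] assms(2) by (auto simp: permutes_not_in)
  qed
  finally show ?thesis by (simp add: pminor_def sum_distrib_left)
qed

text \<open>A recursion for minors without division: the diagonal entry at \<open>m\<close> is moved
  to 1, where the pivot step applies, and the change is accounted for by
  \<open>pminor_add_diag\<close>. It serves inductions that would otherwise need nonzero
  pivots.\<close>

lemma pminor_insert:
  assumes "finite I" "m \<notin> I"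
  shows "pminor (insert m I) A = pminor I (\<lambda>i j. A i j - A i m * A m j) + (A m m - 1) * pminor I A"
proof -
  let ?B = "\<lambda>i j. if i = m \<and> j = m then A i j + (1 - A m m) else A i j"
  have "pminor (insert m I) ?B = pminor I (\<lambda>i j. ?B i j - ?B i m * ?B m j)"
    by (rule pminor_pivot_one) (use assms in auto)
  also have "\<dots> = pminor I (\<lambda>i j. A i j - A i m * A m j)"
    using assms by (intro pminor_cong) auto
  finally show ?thesis
    using pminor_add_diag[OF assms, of A "1 - A m m"] by (simp add: algebra_simps)
qed

text \<open>The Schur complement; dividing row \<open>m\<close> by the pivot reduces to a pivot
  equal to 1.\<close>

lemma pminor_pivot:
  assumes "finite I" "m \<notin> I" "A m m \<noteq> 0"
  shows "pminor (insert m I) A = A m m * pminor I (\<lambda>i j. A i j - A i m * A m j / A m m)"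
proof -
  let ?x = "\<lambda>i. if i = m then A m m else 1"
  let ?B = "\<lambda>i j. if i = m then A m j / A m m else A i j"
  have "pminor (insert m I) A = pminor (insert m I) (\<lambda>i j. ?x i * ?B i j)"
    using assms by (intro pminor_cong) auto
  also have "\<dots> = (\<Prod>i\<in>insert m I. ?x i) * pminor (insert m I) ?B"
    by (rule pminor_scale_rows)
  also have "(\<Prod>i\<in>insert m I. ?x i) = A m m * (\<Prod>i\<in>I. 1)"
    using assms by (subst prod.insert) (auto intro!: prod.cong)
  also have "pminor (insert m I) ?B = pminor I (\<lambda>i j. ?B i j - ?B i m * ?B m j)"
    using assms by (intro pminor_pivot_one) auto
  also have "\<dots> = pminor I (\<lambda>i j. A i j - A i m * A m j / A m m)"
    using assms by (intro pminor_cong) auto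
  finally show ?thesis by simp
qed

text \<open>In \<open>pminor_insert\<close> the rank one correction for an \<open>m\<close> in one
  block leaves the other block alone and creates no entries between the blocks, so the induction
  hypothesis applies to the corrected matrix as well.\<close>

lemma pminor_mult_blocks:
  assumes "finite I" "\<And>i j. i \<in> B \<Longrightarrow> j \<notin> B \<Longrightarrow> A i j = 0 \<and> A j i = 0"
  shows "pminor I A = pminor (I \<inter> B) A * pminor (I - B) A"
  using assms
proof (induction I arbitrary: A rule: finite_induct)
  case (insert m I)
  let ?A = "\<lambda>i j. A i j - A i m * A m j"
  have IH: "pminor I A = pminor (I \<inter> B) A * pminor (I - B) A"
    by (rule insert.IH) (use insert.prems in auto)
  have IH': "pminor I ?A = pminor (I \<inter> B) ?A * pminor (I - B) ?A"
    by (rule insert.IH) (use insert.prems in \<open>cases "m \<in> B"; auto\<close>)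
  note IH = IH IH'
  show ?case
  proof (cases "m \<in> B")
    case True
    then have "pminor (I - B) ?A = pminor (I - B) A"
      using insert.prems by (intro pminor_cong) auto
    with True insert.hyps IH show ?thesis
      by (simp add: pminor_insert Int_insert_left insert_Diff_if algebra_simps)
  next
    case False
    then have "pminor (I \<inter> B) ?A = pminor (I \<inter> B) A"
      using insert.prems by (intro pminor_cong) auto
    with False insert.hyps IH show ?thesis
      by (simp add: pminor_insert Int_insert_left insert_Diff_if algebra_simps)
  qed
qed simp

lemma pminor_1: "pminor {i} A = A i i"
  using pminor_insert[of "{}" i A] by simp

lemma pminor_2:
  assumes "i \<noteq> j"
  shows "pminor {i, j} A = A i i * A j j - A i j * A j i"
  using pminor_insert[of "{j}" i A] assms by (simp add: pminor_1 algebra_simps)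

lemma pminor_3:
  assumes "i \<noteq> j" "i \<noteq> k" "j \<noteq> k"
  shows "pminor {i, j, k} A = A i i * A j j * A k k
    + A i j * A j k * A k i + A i k * A j i * A k j
    - A i j * A j i * A k k - A i k * A k i * A j j - A j k * A k j * A i i"
  using pminor_insert[of "{j, k}" i A] assms unfolding pminor_2[OF assms(3)]
  by (simp add: algebra_simps)

section \<open>Polynomial functions on a line\<close>

text \<open>Closure under the operations below makes polynomiality in one parameter a matter of
  applying rules; the polynomials themselves never have to be written down.\<close>

definition polyfun :: "(complex \<Rightarrow> complex) \<Rightarrow> bool" where
  "polyfun f \<longleftrightarrow> (\<exists>p. f = poly p)"

lemma polyfun_const: "polyfun (\<lambda>s. c)"
  unfolding polyfun_def by (intro exI[of _ "[:c:]"]) auto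

lemma polyfun_id: "polyfun (\<lambda>s. s)"
  unfolding polyfun_def by (intro exI[of _ "[:0, 1:]"]) auto

lemma polyfun_add:
  assumes "polyfun f" "polyfun g"
  shows "polyfun (\<lambda>s. f s + g s)"
proof -
  from assms obtain p q where "f = poly p" "g = poly q" by (auto simp: polyfun_def)
  then show ?thesis unfolding polyfun_def by (intro exI[of _ "p + q"]) auto
qed

lemma polyfun_mult:
  assumes "polyfun f" "polyfun g"
  shows "polyfun (\<lambda>s. f s * g s)"
proof -
  from assms obtain p q where "f = poly p" "g = poly q" by (auto simp: polyfun_def)
  then show ?thesis unfolding polyfun_def by (intro exI[of _ "p * q"]) auto
qed

lemma polyfun_diff:
  assumes "polyfun f" "polyfun g"
  shows "polyfun (\<lambda>s. f s - g s)"
proof -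
  from assms obtain p q where "f = poly p" "g = poly q" by (auto simp: polyfun_def)
  then show ?thesis unfolding polyfun_def by (intro exI[of _ "p - q"]) auto
qed

lemma polyfun_power:
  assumes "polyfun f"
  shows "polyfun (\<lambda>s. f s ^ k)"
proof -
  from assms obtain p where "f = poly p" by (auto simp: polyfun_def)
  then show ?thesis unfolding polyfun_def by (intro exI[of _ "p ^ k"]) auto
qed

lemma polyfun_sum:
  assumes "\<And>i. i \<in> S \<Longrightarrow> polyfun (f i)"
  shows "polyfun (\<lambda>s. \<Sum>i\<in>S. f i s)"
proof -
  from assms obtain p where "f i = poly (p i)" if "i \<in> S" for i
    unfolding polyfun_def by metis
  then show ?thesis unfolding polyfun_def
    by (intro exI[of _ "\<Sum>i\<in>S. p i"]) (auto simp: poly_sum fun_eq_iff intro!: sum.cong)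
qed

lemma polyfun_prod:
  assumes "\<And>i. i \<in> S \<Longrightarrow> polyfun (f i)"
  shows "polyfun (\<lambda>s. \<Prod>i\<in>S. f i s)"
proof -
  from assms obtain p where "f i = poly (p i)" if "i \<in> S" for i
    unfolding polyfun_def by metis
  then show ?thesis unfolding polyfun_def
    by (intro exI[of _ "\<Prod>i\<in>S. p i"]) (auto simp: poly_prod fun_eq_iff intro!: prod.cong)
qed

lemmas polyfun_intros = polyfun_const polyfun_id polyfun_add polyfun_diff polyfun_mult polyfun_power
  polyfun_sum polyfun_prod

lemma polyfun_finite_zeros:
  assumes "polyfun f" "f a \<noteq> 0"
  shows "finite {s. f s = 0}"
proof -
  from assms obtain p where "f = poly p" by (auto simp: polyfun_def)
  with assms show ?thesis by (auto intro: poly_roots_finite)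
qed

lemma polyfun_eq_zero:
  assumes "polyfun f" "finite S" "\<And>s. s \<notin> S \<Longrightarrow> f s = 0"
  shows "f a = 0"
proof (rule ccontr)
  assume "f a \<noteq> 0"
  from polyfun_finite_zeros[OF assms(1) this] have "finite ({s. f s = 0} \<union> S)"
    using assms(2) by simp
  moreover have "{s. f s = 0} \<union> S = UNIV" using assms(3) by auto
  ultimately show False using infinite_UNIV_char_0[where 'a = complex] by simp
qed

text \<open>The form in which signs are decided: with \<open>f\<close> the difference and
  \<open>g\<close> the sum of two functions with equal squares, one point where the sum is nonzero
  makes the difference vanish everywhere.\<close>

lemma polyfun_no_zero_divisors:
  assumes "polyfun f" "polyfun g" "\<And>s. f s * g s = 0" "g b \<noteq> 0"
  shows "f a = 0"
  by (rule polyfun_eq_zero[OF assms(1) polyfun_finite_zeros[OF assms(2,4)]]) (use assms(3) in auto)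

text \<open>The set \<open>I\<close> records which summand is taken in each factor. The same
  expansion serves matrix actions, sums of two product tensors and fourth powers.\<close>

lemma prod_Pow_bool:
  fixes f :: "'a \<Rightarrow> bool \<Rightarrow> 'b :: comm_ring_1"
  assumes "finite Q"
  shows "(\<Prod>p\<in>Q. f p False + f p True) = (\<Sum>I\<in>Pow Q. \<Prod>p\<in>Q. f p (p \<in> I))"
  using assms
proof (induction Q rule: finite_induct)
  case (insert m Q)
  have "(\<Sum>I\<in>Pow (insert m Q). \<Prod>p\<in>insert m Q. f p (p \<in> I))
      = (\<Sum>I\<in>Pow Q. \<Prod>p\<in>insert m Q. f p (p \<in> I)) + (\<Sum>I\<in>insert m ` Pow Q. \<Prod>p\<in>insert m Q. f p (p \<in> I))"
    unfolding Pow_insert using insert.hyps by (intro sum.union_disjoint) auto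
  also have "(\<Sum>I\<in>insert m ` Pow Q. \<Prod>p\<in>insert m Q. f p (p \<in> I))
      = (\<Sum>I\<in>Pow Q. \<Prod>p\<in>insert m Q. f p (p \<in> insert m I))"
    using insert.hyps by (intro sum.reindex_cong[where l = "insert m"]) (auto simp: inj_on_def)
  also have "\<dots> = (\<Sum>I\<in>Pow Q. f m True * (\<Prod>p\<in>Q. f p (p \<in> I)))"
  proof (rule sum.cong[OF refl])
    fix I assume "I \<in> Pow Q"
    have "p \<in> insert m I \<longleftrightarrow> p \<in> I" if "p \<in> Q" for p
      using that insert.hyps by auto
    then have "(\<Prod>p\<in>Q. f p (p \<in> insert m I)) = (\<Prod>p\<in>Q. f p (p \<in> I))"
      by (simp cong: prod.cong)
    then show "(\<Prod>p\<in>insert m Q. f p (p \<in> insert m I)) = f m True * (\<Prod>p\<in>Q. f p (p \<in> I))"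
      using insert.hyps by simp
  qed
  also have "(\<Sum>I\<in>Pow Q. \<Prod>p\<in>insert m Q. f p (p \<in> I)) = (\<Sum>I\<in>Pow Q. f m False * (\<Prod>p\<in>Q. f p (p \<in> I)))"
  proof (rule sum.cong[OF refl])
    fix I assume "I \<in> Pow Q"
    then have "m \<notin> I" using insert.hyps by auto
    then show "(\<Prod>p\<in>insert m Q. f p (p \<in> I)) = f m False * (\<Prod>p\<in>Q. f p (p \<in> I))"
      using insert.hyps by simp
  qed
  finally show ?case
    using insert by (simp add: sum_distrib_left[symmetric] algebra_simps)
qed simp

section \<open>Contractions\<close>

text \<open>
  A covector in position \<open>p\<close> is given by its two values \<open>r p False\<close>, \<open>r p True\<close> on the basis \<open>x\<^sub>p\<^sup>0, x\<^sub>p\<^sup>1\<close>.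
  In \<open>contract Q z r L\<close> the positions in \<open>Q\<close> are contracted with \<open>r\<close>, and the remaining index is \<open>L\<close>.
\<close>
definition contract :: "nat set \<Rightarrow> (nat set \<Rightarrow> complex) \<Rightarrow> (nat \<Rightarrow> bool \<Rightarrow> complex) \<Rightarrow> nat set \<Rightarrow> complex" where
  "contract Q z r L = (\<Sum>J\<in>Pow Q. (\<Prod>p\<in>Q. r p (p \<in> J)) * z (J \<union> L))"

lemma contract_empty [simp]: "contract {} z r L = z L"
  by (simp add: contract_def)

lemma contract_cong:
  assumes "\<And>p. p \<in> Q \<Longrightarrow> r p = r' p" "\<And>J. J \<subseteq> Q \<Longrightarrow> z (J \<union> L) = z' (J \<union> L')"
  shows "contract Q z r L = contract Q z' r' L'"
  unfolding contract_def using assms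
  by (intro sum.cong arg_cong2[of _ _ _ _ "(*)"] prod.cong) auto

lemma contract_insert:
  assumes "finite Q" "m \<notin> Q"
  shows "contract (insert m Q) z r L = r m False * contract Q z r L + r m True * contract Q z r (insert m L)"
proof -
  let ?f = "\<lambda>J. (\<Prod>p\<in>insert m Q. r p (p \<in> J)) * z (J \<union> L)"
  have "contract (insert m Q) z r L = (\<Sum>J\<in>Pow Q. ?f J) + (\<Sum>J\<in>insert m ` Pow Q. ?f J)"
    unfolding contract_def Pow_insert using assms by (intro sum.union_disjoint) auto
  also have "(\<Sum>J\<in>insert m ` Pow Q. ?f J) = (\<Sum>J\<in>Pow Q. ?f (insert m J))"
    using assms by (intro sum.reindex_cong[where l = "insert m"]) (auto simp: inj_on_def)
  also have "\<dots> = r m True * contract Q z r (insert m L)"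
    unfolding contract_def sum_distrib_left
  proof (rule sum.cong[OF refl])
    fix J assume "J \<in> Pow Q"
    have "p \<in> insert m J \<longleftrightarrow> p \<in> J" if "p \<in> Q" for p
      using that assms by auto
    then have "(\<Prod>p\<in>Q. r p (p \<in> insert m J)) = (\<Prod>p\<in>Q. r p (p \<in> J))"
      by (simp cong: prod.cong)
    then show "?f (insert m J) = r m True * ((\<Prod>p\<in>Q. r p (p \<in> J)) * z (J \<union> insert m L))"
      using assms by simp
  qed
  also have "(\<Sum>J\<in>Pow Q. ?f J) = r m False * contract Q z r L"
    unfolding contract_def sum_distrib_left
  proof (rule sum.cong[OF refl])
    fix J assume "J \<in> Pow Q"
    then have "m \<notin> J" using assms by auto
    then show "?f J = r m False * ((\<Prod>p\<in>Q. r p (p \<in> J)) * z (J \<union> L))"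
      using assms by simp
  qed
  finally show ?thesis .
qed

abbreviation bvec :: "bool \<Rightarrow> bool \<Rightarrow> complex" where
  "bvec a \<equiv> \<lambda>b. of_bool (a = b)"

lemma contract_unit:
  assumes "finite Q" "m \<in> Q"
  shows "contract Q z (r(m := bvec a)) L = contract (Q - {m}) z r (if a then insert m L else L)"
proof -
  have Q: "Q = insert m (Q - {m})" using assms by auto
  show ?thesis
    by (subst Q, subst contract_insert) (use assms in \<open>auto intro!: contract_cong\<close>)
qed

lemma contract_linear_at:
  assumes "finite Q" "m \<in> Q"
  shows "contract Q z (r(m := v)) L = v False * contract Q z (r(m := bvec False)) L + v True * contract Q z (r(m := bvec True)) L"
proof -
  have Q: "Q = insert m (Q - {m})" using assms by auto
  have *: "contract (Q - {m}) z (r(m := v)) L' = contract (Q - {m}) z r L'" for v L'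
    by (rule contract_cong) auto
  show ?thesis
    by (subst (1 2 3) Q, subst (1 2 3) contract_insert) (use assms in \<open>auto simp: *\<close>)
qed

text \<open>The covector \<open>bvec False\<close> selects index 0, and a position with index 0 is
  one absent from the set, so contracting it changes nothing in this encoding.\<close>

lemma contract_restrict:
  assumes "finite Q" "Q' \<subseteq> Q" "\<And>p. p \<in> Q - Q' \<Longrightarrow> r p = bvec False"
  shows "contract Q z r L = contract Q' z r L"
proof -
  have *: "contract (D \<union> Q') z r L = contract Q' z r L"
    if "finite D" "D \<inter> Q' = {}" "\<forall>p\<in>D. r p = bvec False" for D
    using that
  proof (induction D rule: finite_induct)
    case (insert m D)
    have "finite (D \<union> Q')" "m \<notin> D \<union> Q'"
      using insert assms finite_subset by auto
    then have "contract (insert m D \<union> Q') z r L = contract (D \<union> Q') z r L"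
      using insert.prems by (simp add: contract_insert)
    with insert show ?case by auto
  qed simp
  have "contract ((Q - Q') \<union> Q') z r L = contract Q' z r L"
    by (rule *) (use assms in auto)
  moreover have "(Q - Q') \<union> Q' = Q" using assms(2) by blast
  ultimately show ?thesis by simp
qed

lemma contract_unit_vectors:
  assumes "finite Q" "I \<subseteq> Q"
  shows "contract Q z (\<lambda>p. bvec (p \<in> I)) {} = z I"
proof -
  have *: "(\<Prod>p\<in>Q. (of_bool ((p \<in> I) = (p \<in> J)) :: complex)) = of_bool (J = I)" if "J \<subseteq> Q" for J
    using that assms by (cases "J = I") (auto intro!: prod_zero)
  have "contract Q z (\<lambda>p. bvec (p \<in> I)) {} = (\<Sum>J\<in>Pow Q. if J = I then z J else 0)"
    unfolding contract_def by (rule sum.cong) (auto simp: *)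
  then show ?thesis
    using assms by simp
qed

abbreviation contract_all :: "nat \<Rightarrow> (nat set \<Rightarrow> complex) \<Rightarrow> (nat \<Rightarrow> bool \<Rightarrow> complex) \<Rightarrow> complex" where
  "contract_all n z r \<equiv> contract {..<n} z r {}"

text \<open>The transposed action, row vector \<open>r p\<close> times \<open>g p\<close>. Through
  it a contraction of a moved tensor becomes a contraction of the original one.\<close>

definition vec_act :: "(nat \<Rightarrow> bool \<Rightarrow> complex) \<Rightarrow> (nat \<Rightarrow> complex mat) \<Rightarrow> nat \<Rightarrow> bool \<Rightarrow> complex" where
  "vec_act r g p b = r p False * g p $$ (0, of_bool b) + r p True * g p $$ (1, of_bool b)"

lemma contract_all_mat_act: "contract_all n (mat_act {..<n} g z) r = contract_all n z (vec_act r g)"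
proof -
  let ?G = "\<lambda>I J. \<Prod>p<n. g p $$ (of_bool (p \<in> I), of_bool (p \<in> J))"
  have "contract_all n (mat_act {..<n} g z) r
      = (\<Sum>I\<in>Pow {..<n}. \<Sum>J\<in>Pow {..<n}. (\<Prod>p<n. r p (p \<in> I)) * (?G I J * z J))"
    by (simp add: contract_def mat_act_def sum_distrib_left)
  also have "\<dots> = (\<Sum>J\<in>Pow {..<n}. (\<Sum>I\<in>Pow {..<n}. \<Prod>p<n. r p (p \<in> I) * g p $$ (of_bool (p \<in> I), of_bool (p \<in> J))) * z J)"
    by (subst sum.swap) (simp add: prod.distrib sum_distrib_right mult.assoc)
  also have "\<dots> = contract_all n z (vec_act r g)"
    unfolding contract_def vec_act_def
    by (intro sum.cong refl arg_cong2[of _ _ _ _ "(*)"])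
      (simp_all add: prod_Pow_bool[of "{..<n}" "\<lambda>p b. r p b * g p $$ (of_bool b, c p)" for c, simplified, symmetric])
  finally show ?thesis .
qed

lemma contract_all_perm_act:
  assumes "s permutes {..<n}"
  shows "contract_all n (perm_act s z) r = contract_all n z (r \<circ> s)"
proof -
  have "contract_all n z (r \<circ> s) = (\<Sum>J\<in>Pow {..<n}. (\<Prod>p<n. r p (p \<in> J)) * z (s -` J))"
    unfolding contract_def
  proof (rule sum.reindex_bij_witness[where i = "(-`) s" and j = "(`) s"])
    fix J assume J: "J \<in> Pow {..<n}"
    show "s -` s ` J = J" using permutes_inj[OF assms] by (simp add: inj_vimage_image_eq)
    show "s ` J \<in> Pow {..<n}" using J permutes_image[OF assms] by auto
    have "(\<Prod>p<n. r p (p \<in> s ` J)) = (\<Prod>p<n. r (s p) (s p \<in> s ` J))"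
      using prod.permute[OF assms, of "\<lambda>p. r p (p \<in> s ` J)"] by (simp add: o_def)
    then show "(\<Prod>p<n. r p (p \<in> s ` J)) * z (s -` s ` J) = (\<Prod>p<n. (r \<circ> s) p (p \<in> J)) * z (J \<union> {})"
      using permutes_inj[OF assms] by (simp add: inj_vimage_image_eq inj_image_mem_iff)
  next
    fix J assume J: "J \<in> Pow {..<n}"
    show "s ` (s -` J) = J" using permutes_surj[OF assms] by (simp add: surj_image_vimage_eq)
    show "s -` J \<in> Pow {..<n}" using J permutes_in_image[OF assms] by auto
  qed
  then show ?thesis by (simp add: contract_def perm_act_def)
qed

lemma contract_all_tensor_act:
  assumes "s permutes {..<n}"
  shows "contract_all n (tensor_act n (g, s) z) r = contract_all n z (vec_act r g \<circ> s)"
  using assms by (simp add: tensor_act_def contract_all_mat_act contract_all_perm_act)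

section \<open>Determinants and hyperdeterminants of contractions\<close>

definition det2 :: "(bool \<Rightarrow> bool \<Rightarrow> complex) \<Rightarrow> complex" where
  "det2 W = W False False * W True True - W False True * W True False"

definition cayley :: "(bool \<Rightarrow> bool \<Rightarrow> bool \<Rightarrow> complex) \<Rightarrow> complex" where
  "cayley W = (let w000 = W False False False; w100 = W True False False;
      w010 = W False True False; w001 = W False False True;
      w110 = W True True False; w101 = W True False True; w011 = W False True True; w111 = W True True True
      in w000^2 * w111^2 + w100^2 * w011^2 + w010^2 * w101^2 + w001^2 * w110^2
         - 2 * w000 * w100 * w011 * w111 - 2 * w000 * w010 * w101 * w111
         - 2 * w000 * w001 * w110 * w111 - 2 * w100 * w010 * w011 * w101
         - 2 * w100 * w001 * w011 * w110 - 2 * w010 * w001 * w101 * w110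
         + 4 * w000 * w011 * w101 * w110 + 4 * w001 * w010 * w100 * w111)"

lemma det2_act_1: "det2 (\<lambda>a b. X a False * W False b + X a True * W True b) = det2 X * det2 W"
  by (simp add: det2_def algebra_simps)

lemma det2_act_2: "det2 (\<lambda>a b. X b False * W a False + X b True * W a True) = det2 X * det2 W"
  by (simp add: det2_def algebra_simps)

text \<open>The bilinear form polarizing \<open>det2\<close>, normalized without a factor 1/2:
  \<open>polar_det2 U U = 2 * det2 U\<close>.\<close>

definition polar_det2 :: "(bool \<Rightarrow> bool \<Rightarrow> complex) \<Rightarrow> (bool \<Rightarrow> bool \<Rightarrow> complex) \<Rightarrow> complex" where
  "polar_det2 U V = U False False * V True True + U True True * V False False
     - U False True * V True False - U True False * V False True"

text \<open>Schlaefli's description: the hyperdeterminant is the discriminant of the binary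
  quadratic form det(x U + y V) in the two slices U, V of the array.\<close>

lemma cayley_discriminant: "cayley W = polar_det2 (W False) (W True) ^ 2 - 4 * det2 (W False) * det2 (W True)"
  by (simp add: cayley_def Let_def det2_def polar_det2_def power2_eq_square algebra_simps)

lemma det2_pencil: "det2 (\<lambda>b c. x * U b c + y * V b c) = x ^ 2 * det2 U + x * y * polar_det2 U V + y ^ 2 * det2 V"
  by (simp add: det2_def polar_det2_def power2_eq_square algebra_simps)

lemma polar_det2_pencil: "polar_det2 (\<lambda>b c. x * U b c + y * V b c) (\<lambda>b c. x' * U b c + y' * V b c)
    = 2 * x * x' * det2 U + (x * y' + x' * y) * polar_det2 U V + 2 * y * y' * det2 V"
  by (simp add: det2_def polar_det2_def algebra_simps)

lemma polar_det2_act_1: "polar_det2 (\<lambda>a b. X a False * U False b + X a True * U True b)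
    (\<lambda>a b. X a False * V False b + X a True * V True b) = det2 X * polar_det2 U V"
  by (simp add: det2_def polar_det2_def algebra_simps)

lemma polar_det2_act_2: "polar_det2 (\<lambda>a b. X b False * U a False + X b True * U a True)
    (\<lambda>a b. X b False * V a False + X b True * V a True) = det2 X * polar_det2 U V"
  by (simp add: det2_def polar_det2_def algebra_simps)

text \<open>A base change in the first factor is a substitution in the binary quadratic form; in the
  other two factors, treated next, it multiplies the form by \<open>det2 X\<close>. Either way the
  discriminant gains \<open>det2 X ^ 2\<close>.\<close>

lemma cayley_act_1: "cayley (\<lambda>a b c. X a False * W False b c + X a True * W True b c) = det2 X ^ 2 * cayley W"
  unfolding cayley_discriminant det2_pencil polar_det2_pencil by (simp add: det2_def[of X] power2_eq_square algebra_simps)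

lemma cayley_act_2: "cayley (\<lambda>a b c. X b False * W a False c + X b True * W a True c) = det2 X ^ 2 * cayley W"
  unfolding cayley_discriminant det2_act_1 polar_det2_act_1 by (simp add: power2_eq_square algebra_simps)

lemma cayley_act_3: "cayley (\<lambda>a b c. X c False * W a b False + X c True * W a b True) = det2 X ^ 2 * cayley W"
  unfolding cayley_discriminant det2_act_2 polar_det2_act_2 by (simp add: power2_eq_square algebra_simps)

text \<open>Arbitrary pairs of covectors \<open>X\<close>, \<open>Y\<close>, \<open>Z\<close>
  replace the standard pair of \<open>slice_hyperdet\<close>, because a group element turns the
  standard pair into the rows of its matrices.\<close>

definition slice_hyperdet_rows :: "nat \<Rightarrow> nat \<Rightarrow> nat \<Rightarrow> nat \<Rightarrow> (bool \<Rightarrow> bool \<Rightarrow> complex) \<Rightarrow> (bool \<Rightarrow> bool \<Rightarrow> complex) \<Rightarrow>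
    (bool \<Rightarrow> bool \<Rightarrow> complex) \<Rightarrow> (nat \<Rightarrow> bool \<Rightarrow> complex) \<Rightarrow> (nat set \<Rightarrow> complex) \<Rightarrow> complex" where
  "slice_hyperdet_rows n i j k X Y Z r z = cayley (\<lambda>a b c. contract_all n z (r(i := X a, j := Y b, k := Z c)))"

definition slice_hyperdet :: "nat \<Rightarrow> nat \<Rightarrow> nat \<Rightarrow> nat \<Rightarrow> (nat \<Rightarrow> bool \<Rightarrow> complex) \<Rightarrow> (nat set \<Rightarrow> complex) \<Rightarrow> complex" where
  "slice_hyperdet n i j k r z = cayley (\<lambda>a b c. contract_all n z (r(i := bvec a, j := bvec b, k := bvec c)))"

lemma slice_hyperdet_rows_eq:
  assumes "i < n" "j < n" "k < n" "i \<noteq> j" "i \<noteq> k" "j \<noteq> k"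
  shows "slice_hyperdet_rows n i j k X Y Z r z = (det2 X * det2 Y * det2 Z) ^ 2 * slice_hyperdet n i j k r z"
proof -
  have 1: "contract_all n z (r(i := x, j := y, k := w)) =
      x False * contract_all n z (r(i := bvec False, j := y, k := w)) + x True * contract_all n z (r(i := bvec True, j := y, k := w))" for x y w
    using contract_linear_at[of "{..<n}" i z "r(j := y, k := w)" x "{}"] assms by (simp add: fun_upd_twist)
  have 2: "contract_all n z (r(i := x, j := y, k := w)) =
      y False * contract_all n z (r(i := x, j := bvec False, k := w)) + y True * contract_all n z (r(i := x, j := bvec True, k := w))" for x y w
    using contract_linear_at[of "{..<n}" j z "r(i := x, k := w)" y "{}"] assms
      fun_upd_twist[of j k] by (simp add: fun_upd_twist)
  have 3: "contract_all n z (r(i := x, j := y, k := w)) =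
      w False * contract_all n z (r(i := x, j := y, k := bvec False)) + w True * contract_all n z (r(i := x, j := y, k := bvec True))" for x y w
    using contract_linear_at[of "{..<n}" k z "r(i := x, j := y)" w "{}"] assms by simp
  have "slice_hyperdet_rows n i j k X Y Z r z = det2 X ^ 2 * cayley (\<lambda>a b c. contract_all n z (r(i := bvec a, j := Y b, k := Z c)))"
    unfolding slice_hyperdet_rows_def by (subst cayley_act_1[symmetric]) (rule arg_cong[where f = cayley], intro ext, rule 1)
  also have "cayley (\<lambda>a b c. contract_all n z (r(i := bvec a, j := Y b, k := Z c))) =
      det2 Y ^ 2 * cayley (\<lambda>a b c. contract_all n z (r(i := bvec a, j := bvec b, k := Z c)))"
    by (subst cayley_act_2[symmetric]) (rule arg_cong[where f = cayley], intro ext, rule 2)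
  also have "cayley (\<lambda>a b c. contract_all n z (r(i := bvec a, j := bvec b, k := Z c))) = det2 Z ^ 2 * slice_hyperdet n i j k r z"
    unfolding slice_hyperdet_def by (subst cayley_act_3[symmetric]) (rule arg_cong[where f = cayley], intro ext, rule 3)
  finally show ?thesis by (simp add: power_mult_distrib)
qed

definition slice_det_rows :: "nat \<Rightarrow> nat \<Rightarrow> nat \<Rightarrow> (bool \<Rightarrow> bool \<Rightarrow> complex) \<Rightarrow> (bool \<Rightarrow> bool \<Rightarrow> complex) \<Rightarrow>
    (nat \<Rightarrow> bool \<Rightarrow> complex) \<Rightarrow> (nat set \<Rightarrow> complex) \<Rightarrow> complex" where
  "slice_det_rows n i j X Y r z = det2 (\<lambda>a b. contract_all n z (r(i := X a, j := Y b)))"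

definition slice_det :: "nat \<Rightarrow> nat \<Rightarrow> nat \<Rightarrow> (nat \<Rightarrow> bool \<Rightarrow> complex) \<Rightarrow> (nat set \<Rightarrow> complex) \<Rightarrow> complex" where
  "slice_det n i j r z = det2 (\<lambda>a b. contract_all n z (r(i := bvec a, j := bvec b)))"

lemma slice_det_rows_eq:
  assumes "i < n" "j < n" "i \<noteq> j"
  shows "slice_det_rows n i j X Y r z = det2 X * det2 Y * slice_det n i j r z"
proof -
  have 1: "contract_all n z (r(i := x, j := y)) =
      x False * contract_all n z (r(i := bvec False, j := y)) + x True * contract_all n z (r(i := bvec True, j := y))" for x y
    using contract_linear_at[of "{..<n}" i z "r(j := y)" x "{}"] assms by (simp add: fun_upd_twist)
  have 2: "contract_all n z (r(i := x, j := y)) =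
      y False * contract_all n z (r(i := x, j := bvec False)) + y True * contract_all n z (r(i := x, j := bvec True))" for x y
    using contract_linear_at[of "{..<n}" j z "r(i := x)" y "{}"] assms by simp
  have "slice_det_rows n i j X Y r z = det2 X * det2 (\<lambda>a b. contract_all n z (r(i := bvec a, j := Y b)))"
    unfolding slice_det_rows_def by (subst det2_act_1[symmetric]) (rule arg_cong[where f = det2], intro ext, rule 1)
  also have "det2 (\<lambda>a b. contract_all n z (r(i := bvec a, j := Y b))) = det2 Y * slice_det n i j r z"
    unfolding slice_det_def by (subst det2_act_2[symmetric]) (rule arg_cong[where f = det2], intro ext, rule 2)
  finally show ?thesis by simp
qed

lemma carrier_SL2_sym:
  "(g, s) \<in> carrier (SL2_sym n) \<longleftrightarrow>
     g \<in> extensional {..<n} \<and> (\<forall>i<n. g i \<in> carrier_mat 2 2 \<and> det (g i) = 1) \<and> s permutes {..<n}"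
  by (auto simp: SL2_sym_def SL2_pow_def SL2_def PiE_iff)

lemma det_mat_2x2:
  assumes "(A :: complex mat) \<in> carrier_mat 2 2"
  shows "det A = A $$ (0, 0) * A $$ (1, 1) - A $$ (0, 1) * A $$ (1, 0)"
proof -
  have "A = mat 2 2 (\<lambda>(i, j). A $$ (i, j))" using assms by auto
  then have "det A = pminor {0, 1} (\<lambda>i j. A $$ (i, j))"
    using det_eq_pminor[of 2 "\<lambda>i j. A $$ (i, j)"] by (simp add: numeral_2_eq_2 atLeast0_lessThan_Suc insert_commute)
  then show ?thesis by (simp add: pminor_2)
qed

lemma det2_det:
  assumes "(A :: complex mat) \<in> carrier_mat 2 2"
  shows "det2 (\<lambda>a b. A $$ (of_bool a, of_bool b)) = det A"
  using assms by (subst det_mat_2x2) (auto simp: det2_def)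

text \<open>The rows of the matrices in the positions \<open>i\<close>, \<open>j\<close>,
  \<open>k\<close> contribute squares of determinants, which are 1; the remaining positions see the
  matrices through \<open>vec_act\<close>.\<close>

lemma slice_hyperdet_tensor_act:
  assumes "(g, s) \<in> carrier (SL2_sym n)" "i < n" "j < n" "k < n" "i \<noteq> j" "i \<noteq> k" "j \<noteq> k"
  defines "s' \<equiv> Hilbert_Choice.inv s"
  shows "slice_hyperdet n i j k r (tensor_act n (g, s) z) = slice_hyperdet n (s' i) (s' j) (s' k) (vec_act r g \<circ> s) z"
proof -
  have s: "s permutes {..<n}" and g: "\<And>i. i < n \<Longrightarrow> g i \<in> carrier_mat 2 2 \<and> det (g i) = 1"
    using assms(1) by (auto simp: carrier_SL2_sym)
  have s's: "s' (s x) = x" "s (s' x) = x" for x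
    using permutes_inverses[OF s] by (auto simp: s'_def)
  have "inj s'" using permutes_inj[OF permutes_inv[OF s]] by (simp add: s'_def)
  then have ne: "s' i \<noteq> s' j" "s' i \<noteq> s' k" "s' j \<noteq> s' k"
    using assms(5-7) by (simp_all add: inj_eq)
  have lt: "s' i < n" "s' j < n" "s' k < n"
    using assms(2-4) permutes_in_image[OF permutes_inv[OF s]] by (simp_all add: s'_def flip: lessThan_iff)
  have upd: "vec_act (r(i := bvec a, j := bvec b, k := bvec c)) g \<circ> s =
      (vec_act r g \<circ> s)(s' i := (\<lambda>x. g i $$ (of_bool a, of_bool x)), s' j := (\<lambda>x. g j $$ (of_bool b, of_bool x)),
        s' k := (\<lambda>x. g k $$ (of_bool c, of_bool x)))" for a b c
  proof
    fix q
    have "s q = i \<longleftrightarrow> q = s' i" "s q = j \<longleftrightarrow> q = s' j" "s q = k \<longleftrightarrow> q = s' k"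
      using s's by metis+
    then show "(vec_act (r(i := bvec a, j := bvec b, k := bvec c)) g \<circ> s) q = ((vec_act r g \<circ> s)(s' i := (\<lambda>x. g i $$ (of_bool a, of_bool x)), s' j := (\<lambda>x. g j $$ (of_bool b, of_bool x)),
        s' k := (\<lambda>x. g k $$ (of_bool c, of_bool x)))) q"
      using assms(5-7) ne s's by (auto simp: vec_act_def fun_eq_iff)
  qed
  have "slice_hyperdet n i j k r (tensor_act n (g, s) z) =
     slice_hyperdet_rows n (s' i) (s' j) (s' k) (\<lambda>a x. g i $$ (of_bool a, of_bool x)) (\<lambda>a x. g j $$ (of_bool a, of_bool x))
       (\<lambda>a x. g k $$ (of_bool a, of_bool x)) (vec_act r g \<circ> s) z"
    unfolding slice_hyperdet_def slice_hyperdet_rows_def by (simp only: contract_all_tensor_act[OF s] upd)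
  also have "\<dots> = slice_hyperdet n (s' i) (s' j) (s' k) (vec_act r g \<circ> s) z"
    using g assms(2-4) by (subst slice_hyperdet_rows_eq[OF lt ne]) (simp add: det2_det)
  finally show ?thesis .
qed

lemma hyperdet_eq_slice_hyperdet:
  assumes "n \<ge> 3"
  shows "hyperdet z = slice_hyperdet n 0 1 2 (\<lambda>_. bvec False) z"
proof -
  have *: "contract_all n z ((\<lambda>_. bvec False)(0 := bvec a, 1 := bvec b, 2 := bvec c)) =
      z ((if a then {0} else {}) \<union> (if b then {1} else {}) \<union> (if c then {2} else {}))" (is "_ = z ?I") for a b c
  proof -
    have "(\<lambda>_. bvec False)(0 := bvec a, 1 := bvec b, 2 := bvec c) = (\<lambda>p. bvec (p \<in> ?I))"
      by (auto simp: fun_eq_iff)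
    then show ?thesis
      using contract_unit_vectors[of "{..<n}" ?I z] assms by simp
  qed
  show ?thesis
    unfolding slice_hyperdet_def * by (simp add: cayley_def hyperdet_def insert_commute)
qed

section \<open>The module spanned by hyperdeterminants\<close>

text \<open>SL(2) is transitive on nonzero vectors: \<open>v\<close> and \<open>w\<close> are
  completed to bases of determinant 1 by \<open>(x, y)\<close> and \<open>(x', y')\<close>, and
  \<open>A\<close> is the base change between them.\<close>

lemma ex_SL2_transport:
  assumes "v \<noteq> 0" "w \<noteq> (0 :: bool \<Rightarrow> complex)"
  obtains A where "A \<in> carrier_mat 2 2" "det A = 1"
    "\<And>b. v False * A $$ (0, of_bool b) + v True * A $$ (1, of_bool b) = w b"
proof -
  have ex: "\<exists>x y. v False * y - v True * x = 1" if "v \<noteq> 0" for v :: "bool \<Rightarrow> complex"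
  proof (cases "v False = 0")
    case True
    with that have "v True \<noteq> 0" by (auto simp: fun_eq_iff) (metis (full_types))
    then show ?thesis by (intro exI[of _ "- 1 / v True"] exI[of _ 0]) simp
  next
    case False
    then show ?thesis by (intro exI[of _ 0] exI[of _ "1 / v False"]) simp
  qed
  obtain x y where xy: "v False * y - v True * x = 1" using ex[OF assms(1)] by blast
  obtain x' y' where xy': "w False * y' - w True * x' = 1" using ex[OF assms(2)] by blast
  define A where "A = mat 2 2 (\<lambda>(i, j).
    if i = 0 then y * w (j = 1) - v True * (if j = 0 then x' else y')
    else - x * w (j = 1) + v False * (if j = 0 then x' else y'))"
  have A: "A \<in> carrier_mat 2 2" by (simp add: A_def)
  show ?thesis
  proof (rule that[OF A])
    have "det A = (v False * y - v True * x) * (w False * y' - w True * x')"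
      unfolding det_mat_2x2[OF A] by (simp add: A_def algebra_simps)
    then show "det A = 1" by (simp add: xy xy')
    fix b
    have "v False * A $$ (0, of_bool b) + v True * A $$ (1, of_bool b) = (v False * y - v True * x) * w b"
      by (cases b) (simp_all add: A_def algebra_simps)
    then show "v False * A $$ (0, of_bool b) + v True * A $$ (1, of_bool b) = w b"
      by (simp add: xy)
  qed
qed

lemma ex_permutes_3:
  fixes i j k i' j' k' n :: nat
  assumes "i < n" "j < n" "k < n" "i \<noteq> j" "i \<noteq> k" "j \<noteq> k"
    and "i' < n" "j' < n" "k' < n" "i' \<noteq> j'" "i' \<noteq> k'" "j' \<noteq> k'"
  obtains s where "s permutes {..<n}" "s i' = i" "s j' = j" "s k' = k"
proof -
  let ?A = "{..<n} - {i', j', k'}" and ?B = "{..<n} - {i, j, k}"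
  have "card ?A = card ?B" using assms by (simp add: card_Diff_subset)
  then obtain f where f: "bij_betw f ?A ?B"
    using finite_same_card_bij[of ?A ?B] by auto
  define g where "g x = (if x = i' then i else if x = j' then j else k)" for x
  have g: "bij_betw g {i', j', k'} {i, j, k}"
    using assms by (auto simp: bij_betw_def inj_on_def g_def)
  define s where "s x = (if x \<in> {i', j', k'} then g x else if x < n then f x else x)" for x
  have "bij_betw s ({i', j', k'} \<union> ?A) ({i, j, k} \<union> ?B)"
    unfolding s_def
  proof (rule bij_betw_combine)
    show "bij_betw (\<lambda>x. if x \<in> {i', j', k'} then g x else if x < n then f x else x) {i', j', k'} {i, j, k}"
      using g by (rule bij_betw_cong[THEN iffD1, rotated]) auto
    show "bij_betw (\<lambda>x. if x \<in> {i', j', k'} then g x else if x < n then f x else x) ?A ?B"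
      using f by (rule bij_betw_cong[THEN iffD1, rotated]) auto
  qed auto
  moreover have "{i', j', k'} \<union> ?A = {..<n}" "{i, j, k} \<union> ?B = {..<n}" using assms by auto
  ultimately have "s permutes {..<n}"
    using assms by (intro bij_imp_permutes) (auto simp: s_def)
  then show ?thesis
    by (rule that) (use assms in \<open>auto simp: s_def g_def\<close>)
qed

text \<open>Combines the transitivity of permutations on ordered triples with that of SL(2) in each
  position. It serves twice: to describe the span of the orbit, and to come back to
  \<open>hyperdet\<close> inside a submodule.\<close>

lemma slice_hyperdet_transitive:
  assumes "i < n" "j < n" "k < n" "i \<noteq> j" "i \<noteq> k" "j \<noteq> k"
    and "i' < n" "j' < n" "k' < n" "i' \<noteq> j'" "i' \<noteq> k'" "j' \<noteq> k'"
    and "\<And>p. p < n \<Longrightarrow> r p \<noteq> 0" "\<And>p. p < n \<Longrightarrow> r' p \<noteq> 0"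
  obtains h where "h \<in> carrier (SL2_sym n)" "\<And>z. slice_hyperdet n i j k r (tensor_act n h z) = slice_hyperdet n i' j' k' r' z"
proof -
  obtain s where s: "s permutes {..<n}" "s i' = i" "s j' = j" "s k' = k"
    using ex_permutes_3[OF assms(1-12)] by blast
  let ?s = "Hilbert_Choice.inv s"
  have s': "?s i = i'" "?s j = j'" "?s k = k'" "?s (s q) = q" for q
    using permutes_inverses[OF s(1)] s(2-4) by metis+
  have "\<exists>A. A \<in> carrier_mat 2 2 \<and> det A = 1 \<and>
      (\<forall>b. r p False * A $$ (0, of_bool b) + r p True * A $$ (1, of_bool b) = r' (?s p) b)" if "p < n" for p
  proof -
    have "?s p < n" using that permutes_in_image[OF permutes_inv[OF s(1)]] by (simp flip: lessThan_iff)
    from ex_SL2_transport[OF assms(13)[OF that] assms(14)[OF this]] show ?thesis by metis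
  qed
  then obtain G where G: "\<And>p. p < n \<Longrightarrow> G p \<in> carrier_mat 2 2" "\<And>p. p < n \<Longrightarrow> det (G p) = 1"
    "\<And>p b. p < n \<Longrightarrow> r p False * G p $$ (0, of_bool b) + r p True * G p $$ (1, of_bool b) = r' (?s p) b"
    by metis
  let ?g = "restrict G {..<n}"
  have h: "(?g, s) \<in> carrier (SL2_sym n)"
    using G(1,2) s(1) by (simp add: carrier_SL2_sym)
  show ?thesis
  proof (rule that[OF h])
    fix z
    have "(vec_act r ?g \<circ> s) q = r' q" if "q < n" for q
    proof -
      have "s q < n" using that permutes_in_image[OF s(1)] by (simp flip: lessThan_iff)
      from G(3)[OF this] show ?thesis using \<open>s q < n\<close> by (auto simp: vec_act_def s' fun_eq_iff)
    qed
    then have "contract_all n z ((vec_act r ?g \<circ> s)(i' := x, j' := y, k' := w)) = contract_all n z (r'(i' := x, j' := y, k' := w))" for x y w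
      by (intro contract_cong) auto
    then show "slice_hyperdet n i j k r (tensor_act n (?g, s) z) = slice_hyperdet n i' j' k' r' z"
      unfolding slice_hyperdet_tensor_act[OF h assms(1-6)] s' by (simp add: slice_hyperdet_def)
  qed
qed

definition distinct3 :: "nat \<Rightarrow> nat \<Rightarrow> nat \<Rightarrow> nat \<Rightarrow> bool" where
  "distinct3 n i j k \<longleftrightarrow> i < n \<and> j < n \<and> k < n \<and> i \<noteq> j \<and> i \<noteq> k \<and> j \<noteq> k"

lemma slice_hyperdet_cong:
  assumes "\<And>p. p < n \<Longrightarrow> p \<notin> {i, j, k} \<Longrightarrow> r p = r' p"
  shows "slice_hyperdet n i j k r z = slice_hyperdet n i j k r' z"
proof -
  have "contract_all n z (r(i := x, j := y, k := w)) = contract_all n z (r'(i := x, j := y, k := w))" for x y w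
    by (intro contract_cong) (use assms in auto)
  then show ?thesis by (simp add: slice_hyperdet_def)
qed

lemma slice_hyperdet_eq_0:
  assumes "p < n" "p \<notin> {i, j, k}" "r p = 0"
  shows "slice_hyperdet n i j k r z = 0"
proof -
  have "contract_all n z (r(i := x, j := y, k := w)) = 0" for x y w
    unfolding contract_def
    by (intro sum.neutral ballI) (use assms in \<open>auto intro!: prod_zero bexI[of _ p]\<close>)
  then show ?thesis by (simp add: slice_hyperdet_def cayley_def)
qed

lemma poly_act_slice_hyperdet:
  assumes "h \<in> carrier (SL2_sym n)" "distinct3 n i j k"
  obtains i' j' k' r' where "distinct3 n i' j' k'" "poly_act n h (slice_hyperdet n i j k r) = slice_hyperdet n i' j' k' r'"
proof -
  interpret G: group "SL2_sym n" by (rule group_SL2_sym)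
  obtain g s where gs: "inv\<^bsub>SL2_sym n\<^esub> h = (g, s)" by (cases "inv\<^bsub>SL2_sym n\<^esub> h")
  then have c: "(g, s) \<in> carrier (SL2_sym n)" using G.inv_closed[OF assms(1)] by simp
  then have s: "s permutes {..<n}" by (simp add: carrier_SL2_sym)
  let ?s = "Hilbert_Choice.inv s"
  have "inj ?s" using permutes_inj[OF permutes_inv[OF s]] .
  then have "distinct3 n (?s i) (?s j) (?s k)"
    using assms(2) permutes_in_image[OF permutes_inv[OF s]]
    by (simp add: distinct3_def inj_eq flip: lessThan_iff)
  then show ?thesis
    by (rule that) (use assms(2) in \<open>auto simp: poly_act_def gs distinct3_def slice_hyperdet_tensor_act[OF c]\<close>)
qed

definition slice_hyperdets :: "nat \<Rightarrow> ((nat set \<Rightarrow> complex) \<Rightarrow> complex) set" where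
  "slice_hyperdets n = {slice_hyperdet n i j k r | i j k r. distinct3 n i j k}"

lemma slice_hyperdet_in_orbit:
  assumes "n \<ge> 3" "distinct3 n i j k" "\<And>p. p < n \<Longrightarrow> p \<notin> {i, j, k} \<Longrightarrow> r p \<noteq> 0"
  obtains h where "h \<in> carrier (SL2_sym n)" "slice_hyperdet n i j k r = poly_act n h hyperdet"
proof -
  interpret G: group "SL2_sym n" by (rule group_SL2_sym)
  \<comment> \<open>The slice does not see \<open>r\<close> in the positions \<open>i\<close>,
    \<open>j\<close>, \<open>k\<close>, but transitivity moves every position; so nonzero covectors
    are put there.\<close>
  let ?r = "r(i := bvec False, j := bvec False, k := bvec False)"
  have e: "bvec False \<noteq> 0" by (auto simp: fun_eq_iff)
  obtain h where h: "h \<in> carrier (SL2_sym n)"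
    "\<And>z. slice_hyperdet n 0 1 2 (\<lambda>_. bvec False) (tensor_act n h z) = slice_hyperdet n i j k ?r z"
    by (rule slice_hyperdet_transitive[of 0 n 1 2 i j k "\<lambda>_. bvec False" ?r])
      (use assms e in \<open>auto simp: distinct3_def\<close>)
  have "slice_hyperdet n i j k r = poly_act n (inv\<^bsub>SL2_sym n\<^esub> h) hyperdet"
  proof
    fix z
    have "slice_hyperdet n i j k r z = slice_hyperdet n i j k ?r z" by (rule slice_hyperdet_cong) auto
    then show "slice_hyperdet n i j k r z = poly_act n (inv\<^bsub>SL2_sym n\<^esub> h) hyperdet z"
      using h by (simp add: poly_act_def hyperdet_eq_slice_hyperdet[OF assms(1)])
  qed
  with G.inv_closed[OF h(1)] show ?thesis by (rule that)
qed

lemma hyperdet_in_slice_hyperdets: "n \<ge> 3 \<Longrightarrow> hyperdet \<in> slice_hyperdets n"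
  unfolding slice_hyperdets_def
  by (rule CollectI, rule exI[of _ 0], rule exI[of _ 1], rule exI[of _ 2], rule exI[of _ "\<lambda>_. bvec False"])
    (auto simp: hyperdet_eq_slice_hyperdet distinct3_def)

text \<open>Allowing zero covectors outside the triple adds only the zero function to the orbit, so
  the span is unchanged and \<open>r\<close> needs no side condition.\<close>

lemma HD_eq:
  assumes "n \<ge> 3"
  shows "HD n = cfun.span (slice_hyperdets n)"
proof
  have hyp: "hyperdet = slice_hyperdet n 0 1 2 (\<lambda>_. bvec False)"
    using assms by (auto simp: hyperdet_eq_slice_hyperdet)
  have d: "distinct3 n 0 1 2" using assms by (simp add: distinct3_def)
  show "HD n \<subseteq> cfun.span (slice_hyperdets n)"
    unfolding HD_def
  proof (rule cfun.span_mono, safe)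
    fix h assume "h \<in> carrier (SL2_sym n)"
    from poly_act_slice_hyperdet[OF this d] show "poly_act n h hyperdet \<in> slice_hyperdets n"
      unfolding slice_hyperdets_def hyp by (metis (mono_tags, lifting) mem_Collect_eq)
  qed
  have "slice_hyperdets n \<subseteq> HD n"
  proof
    fix f assume "f \<in> slice_hyperdets n"
    then obtain i j k r where f: "f = slice_hyperdet n i j k r" "distinct3 n i j k" by (auto simp: slice_hyperdets_def)
    show "f \<in> HD n"
    proof (cases "\<exists>p<n. p \<notin> {i, j, k} \<and> r p = 0")
      case True
      then have "f = 0" by (auto simp: f fun_eq_iff intro!: slice_hyperdet_eq_0)
      then show ?thesis by (simp add: HD_def cfun.span_zero)
    next
      case False
      then obtain h where "h \<in> carrier (SL2_sym n)" "f = poly_act n h hyperdet"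
        using slice_hyperdet_in_orbit[OF assms f(2)] f(1) by metis
      then show ?thesis unfolding HD_def by (intro cfun.span_base CollectI exI[of _ h]) simp
    qed
  qed
  then show "cfun.span (slice_hyperdets n) \<subseteq> HD n"
    by (rule cfun.span_minimal) (simp add: HD_def cfun.subspace_span)
qed

lemma poly_act_add: "poly_act n h (f + g) = poly_act n h f + poly_act n h g"
  by (simp add: poly_act_def fun_eq_iff)

lemma poly_act_fscale: "poly_act n h (fscale c f) = fscale c (poly_act n h f)"
  by (simp add: poly_act_def fscale_def fun_eq_iff)

lemma submodule_HD:
  assumes "n \<ge> 3"
  shows "submodule (SL2_sym n) (poly_act n) (HD n)"
  unfolding submodule_def
proof (intro conjI ballI)
  show "cfun.subspace (HD n)" unfolding HD_def by (rule cfun.subspace_span)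
  fix h f assume h: "h \<in> carrier (SL2_sym n)" and "f \<in> HD n"
  then have "f \<in> cfun.span (slice_hyperdets n)" by (simp add: HD_eq[OF assms])
  then have "poly_act n h f \<in> cfun.span (slice_hyperdets n)"
  proof (induction rule: cfun.span_induct_alt)
    case base
    have "poly_act n h 0 = 0" by (simp add: poly_act_def fun_eq_iff)
    with cfun.span_zero[of "slice_hyperdets n"] show ?case by (simp only:)
  next
    case (step c x y)
    then obtain i j k r where "x = slice_hyperdet n i j k r" "distinct3 n i j k" by (auto simp: slice_hyperdets_def)
    with poly_act_slice_hyperdet[OF h this(2)] have "poly_act n h x \<in> slice_hyperdets n"
      unfolding slice_hyperdets_def by (metis (mono_tags, lifting) mem_Collect_eq)
    from cfun.span_add[OF cfun.span_scale[OF cfun.span_base[OF this]] step(2)] show ?case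
      unfolding poly_act_add poly_act_fscale .
  qed
  then show "poly_act n h f \<in> HD n" by (simp add: HD_eq[OF assms])
qed

section \<open>Homogeneous polynomials in the coordinates\<close>

lemma sym_power_add: "f \<in> sym_power n d \<Longrightarrow> g \<in> sym_power n d \<Longrightarrow> (\<lambda>z. f z + g z) \<in> sym_power n d"
  using cfun.span_add[of f _ g] by (simp add: sym_power_def plus_fun_def)

lemma sym_power_diff: "f \<in> sym_power n d \<Longrightarrow> g \<in> sym_power n d \<Longrightarrow> (\<lambda>z. f z - g z) \<in> sym_power n d"
  using cfun.span_diff[of f _ g] by (simp add: sym_power_def fun_diff_def)

lemma sym_power_scale: "f \<in> sym_power n d \<Longrightarrow> (\<lambda>z. c * f z) \<in> sym_power n d"
  using cfun.span_scale[of f _ c] by (simp add: sym_power_def fscale_def)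

lemma sym_power_sum:
  assumes "\<And>i. i \<in> S \<Longrightarrow> f i \<in> sym_power n d"
  shows "(\<lambda>z. \<Sum>i\<in>S. f i z) \<in> sym_power n d"
  using assms
proof (induction S rule: infinite_finite_induct)
  case (insert x F)
  then show ?case by (simp add: sym_power_add)
qed (use cfun.span_zero in \<open>auto simp: sym_power_def zero_fun_def\<close>)

lemma sym_power_mult:
  assumes "f \<in> sym_power n d" "g \<in> sym_power n d'"
  shows "(\<lambda>z. f z * g z) \<in> sym_power n (d + d')"
  using assms(1)[unfolded sym_power_def]
proof (induction rule: cfun.span_induct_alt)
  case base
  then show ?case using cfun.span_zero by (simp add: sym_power_def zero_fun_def)
next
  case (step c x y)
  then obtain Is where Is: "x = (\<lambda>z. prod_list (map z Is))" "length Is = d" "set Is \<subseteq> Pow {..<n}" by blast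
  have "(\<lambda>z. x z * g z) \<in> sym_power n (d + d')"
    using assms(2)[unfolded sym_power_def]
  proof (induction rule: cfun.span_induct_alt)
    case base
    then show ?case using cfun.span_zero by (simp add: sym_power_def zero_fun_def)
  next
    case (step c' x' y')
    then obtain Is' where Is': "x' = (\<lambda>z. prod_list (map z Is'))" "length Is' = d'" "set Is' \<subseteq> Pow {..<n}" by blast
    have "(\<lambda>z. prod_list (map z (Is @ Is'))) \<in> sym_power n (d + d')"
      unfolding sym_power_def by (intro cfun.span_base CollectI exI[of _ "Is @ Is'"]) (use Is Is' in auto)
    then have "(\<lambda>z. x z * x' z) \<in> sym_power n (d + d')" by (simp add: Is Is')
    from sym_power_add[OF sym_power_scale[OF this, of c'] step(2)]
    show ?case by (simp add: fscale_def algebra_simps)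
  qed
  from sym_power_add[OF sym_power_scale[OF this, of c] step(2)]
  show ?case by (simp add: fscale_def algebra_simps)
qed

lemma contract_all_in_sym_power: "(\<lambda>z. contract_all n z r) \<in> sym_power n 1"
  unfolding contract_def
proof (intro sym_power_sum sym_power_scale)
  fix J assume "J \<in> Pow {..<n}"
  then show "(\<lambda>z. z (J \<union> {})) \<in> sym_power n 1"
    unfolding sym_power_def by (intro cfun.span_base CollectI exI[of _ "[J]"]) auto
qed

lemma cayley_in_sym_power:
  assumes "\<And>a b c. (\<lambda>z. W z a b c) \<in> sym_power n 1"
  shows "(\<lambda>z. cayley (W z)) \<in> sym_power n 4"
proof -
  have 2: "(\<lambda>z. f z * g z) \<in> sym_power n 2" if "f \<in> sym_power n 1" "g \<in> sym_power n 1" for f g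
    using sym_power_mult[OF that] by (simp add: numeral_2_eq_2)
  have 4: "(\<lambda>z. f z * g z) \<in> sym_power n 4" if "f \<in> sym_power n 2" "g \<in> sym_power n 2" for f g
    using sym_power_mult[OF that] by simp
  have W: "polar_det2 (W z a) (W z b) = W z a False False * W z b True True + W z a True True * W z b False False
     - W z a False True * W z b True False - W z a True False * W z b False True"
   "det2 (W z a) = W z a False False * W z a True True - W z a False True * W z a True False" for z a b
    by (simp_all add: polar_det2_def det2_def)
  have p: "(\<lambda>z. polar_det2 (W z a) (W z b)) \<in> sym_power n 2" "(\<lambda>z. det2 (W z a)) \<in> sym_power n 2" for a b
    unfolding W by (intro sym_power_add sym_power_diff 2 assms)+
  show ?thesis
    unfolding cayley_discriminant power2_eq_square mult.assoc
    by (intro sym_power_diff sym_power_scale 4 p)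
qed

lemma HD_subset_sym_power:
  assumes "n \<ge> 3"
  shows "HD n \<subseteq> sym_power n 4"
proof -
  have "slice_hyperdet n i j k r \<in> sym_power n 4" for i j k r
    using cayley_in_sym_power[of "\<lambda>z a b c. contract_all n z (r(i := bvec a, j := bvec b, k := bvec c))" n]
    by (simp add: slice_hyperdet_def[abs_def] contract_all_in_sym_power[simplified])
  then have "slice_hyperdets n \<subseteq> sym_power n 4" by (auto simp: slice_hyperdets_def)
  then show ?thesis
    unfolding HD_eq[OF assms] by (rule cfun.span_minimal) (simp add: sym_power_def cfun.subspace_span)
qed

lemma sym_power_homogeneous:
  assumes "f \<in> sym_power n d"
  shows "f (fscale c z) = c ^ d * f z"
  using assms[unfolded sym_power_def]
proof (induction rule: cfun.span_induct_alt)
  case (step b x y)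
  then obtain Is where Is: "x = (\<lambda>z. prod_list (map z Is))" "length Is = d" by blast
  have "prod_list (map (fscale c z) Js) = c ^ length Js * prod_list (map z Js)" for Js
    by (induction Js) (simp_all add: fscale_def)
  with step Is show ?case by (simp add: fscale_def algebra_simps)
qed simp

lemma sym_power_polyfun:
  assumes "f \<in> sym_power n d" "\<And>I. I \<subseteq> {..<n} \<Longrightarrow> polyfun (\<lambda>s. Z s I)"
  shows "polyfun (\<lambda>s. f (Z s))"
  using assms(1)[unfolded sym_power_def]
proof (induction rule: cfun.span_induct_alt)
  case base
  show ?case by (simp add: polyfun_const)
next
  case (step b x y)
  then obtain Is where Is: "x = (\<lambda>z. prod_list (map z Is))" "set Is \<subseteq> Pow {..<n}" by blast
  have "set Js \<subseteq> Pow {..<n} \<Longrightarrow> polyfun (\<lambda>s. prod_list (map (Z s) Js))" for Js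
    by (induction Js) (auto intro!: polyfun_intros assms)
  with step Is show ?case by (auto simp: fscale_def intro!: polyfun_intros)
qed

section \<open>Vanishing on principal minors\<close>

definition select3 :: "nat \<Rightarrow> nat \<Rightarrow> nat \<Rightarrow> bool \<Rightarrow> bool \<Rightarrow> bool \<Rightarrow> nat set" where
  "select3 i j k a b c = (if a then {i} else {}) \<union> (if b then {j} else {}) \<union> (if c then {k} else {})"

lemma slice_hyperdet_eq_contract:
  assumes "distinct3 n i j k"
  shows "slice_hyperdet n i j k r z = cayley (\<lambda>a b c. contract ({..<n} - {i, j, k}) z r (select3 i j k a b c))"
proof -
  have "contract_all n z (r(i := bvec a, j := bvec b, k := bvec c)) = contract ({..<n} - {i, j, k}) z r (select3 i j k a b c)" for a b c
  proof -
    have "contract_all n z (r(i := bvec a, j := bvec b, k := bvec c)) = contract ({..<n} - {k}) z (r(i := bvec a, j := bvec b)) (if c then {k} else {})"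
      using assms by (subst contract_unit) (auto simp: distinct3_def)
    also have "\<dots> = contract ({..<n} - {k} - {j}) z (r(i := bvec a)) (if b then insert j (if c then {k} else {}) else (if c then {k} else {}))"
      using assms by (subst contract_unit) (auto simp: distinct3_def)
    also have "\<dots> = contract ({..<n} - {k} - {j} - {i}) z r (if a then insert i (if b then insert j (if c then {k} else {}) else (if c then {k} else {}))
        else (if b then insert j (if c then {k} else {}) else (if c then {k} else {})))"
      using assms by (subst contract_unit) (auto simp: distinct3_def)
    also have "{..<n} - {k} - {j} - {i} = {..<n} - {i, j, k}" by auto
    also have "(if a then insert i (if b then insert j (if c then {k} else {}) else (if c then {k} else {}))
        else (if b then insert j (if c then {k} else {}) else (if c then {k} else {}))) = select3 i j k a b c"
      by (auto simp: select3_def)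
    finally show ?thesis .
  qed
  then show ?thesis by (simp add: slice_hyperdet_def)
qed

lemma contract_lincomb: "contract Q (\<lambda>I. x * z I + y * z' I) r L = x * contract Q z r L + y * contract Q z' r L"
  by (simp add: contract_def algebra_simps sum.distrib sum_distrib_left)

lemma contract_scale: "contract Q (\<lambda>I. x * z I) r L = x * contract Q z r L"
  using contract_lincomb[of Q x z 0 z] by simp

lemma cayley_scale: "cayley (\<lambda>a b c. x * W a b c) = x ^ 4 * cayley W"
  by (simp add: cayley_def Let_def power4_eq_xxxx power2_eq_square algebra_simps)

lemma cayley_polyfun:
  assumes "\<And>a b c. polyfun (\<lambda>s. W s a b c)"
  shows "polyfun (\<lambda>s. cayley (W s))"
  unfolding cayley_def Let_def by (intro polyfun_intros assms)

lemma hyp_minors_3: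
  assumes "\<And>i j. A i j = A j i" "i \<noteq> j" "i \<noteq> k" "j \<noteq> k"
  shows "cayley (\<lambda>a b c. pminor (select3 i j k a b c) A) = 0"
proof -
  have "A j i = A i j" "A k i = A i k" "A k j = A j k" using assms(1) by auto
  with assms(2-) show ?thesis
    by (simp add: cayley_def Let_def select3_def pminor_1 pminor_2 pminor_3 power2_eq_square algebra_simps)
qed

text \<open>By \<open>pminor_add_diag\<close> the left side is \<open>\<beta>\<close> times a minor
  of the matrix whose diagonal entry at \<open>m\<close> is shifted by \<open>s / \<beta>\<close>;
  pivoting on that entry gives the Schur complement. The left side is the contraction of position
  \<open>m\<close> with the covector \<open>(s, \<beta>)\<close>.\<close>

lemma pminor_lincomb:
  assumes "finite I" "m \<notin> I" "\<beta> \<noteq> 0" "A m m + s / \<beta> \<noteq> 0"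
  shows "s * pminor I A + \<beta> * pminor (insert m I) A
    = \<beta> * (A m m + s / \<beta>) * pminor I (\<lambda>i j. A i j - A i m * A m j / (A m m + s / \<beta>))"
proof -
  let ?A = "\<lambda>i j. if i = m \<and> j = m then A i j + s / \<beta> else A i j"
  have "s * pminor I A + \<beta> * pminor (insert m I) A = \<beta> * pminor (insert m I) ?A"
    using pminor_add_diag[OF assms(1,2), of A "s / \<beta>"] assms(3) by (simp add: algebra_simps)
  also have "pminor (insert m I) ?A = ?A m m * pminor I (\<lambda>i j. ?A i j - ?A i m * ?A m j / ?A m m)"
    by (rule pminor_pivot) (use assms in auto)
  also have "pminor I (\<lambda>i j. ?A i j - ?A i m * ?A m j / ?A m m) = pminor I (\<lambda>i j. A i j - A i m * A m j / (A m m + s / \<beta>))"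
    by (rule pminor_cong) (use assms in auto)
  finally show ?thesis by simp
qed

text \<open>Induction on the contracted positions, each of which replaces \<open>A\<close> by a
  Schur complement that is again symmetric. A zero pivot occurs for one value of the first
  coordinate \<open>s\<close> of the covector only, and is covered by polynomiality in
  \<open>s\<close>; for \<open>\<beta> = 0\<close> position \<open>m\<close> drops out up to a
  scalar.\<close>

lemma hyp_minors:
  assumes "finite Q" "\<And>i j. A i j = A j i" "i \<noteq> j" "i \<noteq> k" "j \<noteq> k" "i \<notin> Q" "j \<notin> Q" "k \<notin> Q"
  shows "cayley (\<lambda>a b c. contract Q (\<lambda>I. pminor I A) r (select3 i j k a b c)) = 0"
  using assms(1,2,6-8)
proof (induction Q arbitrary: A rule: finite_induct)
  case empty
  then show ?case using hyp_minors_3 assms by simp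
next
  case (insert m Q)
  define \<beta> where "\<beta> = r m True"
  define X where "X a b c = contract Q (\<lambda>I. pminor I A) r (select3 i j k a b c)" for a b c
  define Y where "Y a b c = contract Q (\<lambda>I. pminor (insert m I) A) r (select3 i j k a b c)" for a b c
  define F where "F s = cayley (\<lambda>a b c. s * X a b c + \<beta> * Y a b c)" for s
  have Y: "contract Q (\<lambda>I. pminor I A) r (insert m (select3 i j k a b c)) = Y a b c" for a b c
    unfolding Y_def by (rule contract_cong) auto
  have F: "cayley (\<lambda>a b c. contract (insert m Q) (\<lambda>I. pminor I A) r (select3 i j k a b c)) = F (r m False)"
    unfolding F_def using insert.hyps by (simp add: contract_insert X_def Y \<beta>_def)
  have "F s = 0" if \<beta>: "\<beta> \<noteq> 0" and s: "s \<notin> {- \<beta> * A m m}" for s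
  proof -
    let ?d = "A m m + s / \<beta>"
    let ?B = "\<lambda>i j. A i j - A i m * A m j / ?d"
    have d: "?d \<noteq> 0" using \<beta> s by (auto simp: field_simps add_eq_0_iff)
    have "contract Q (\<lambda>I. s * pminor I A + \<beta> * pminor (insert m I) A) r (select3 i j k a b c)
        = contract Q (\<lambda>I. (\<beta> * ?d) * pminor I ?B) r (select3 i j k a b c)" for a b c
    proof (rule contract_cong[OF refl])
      fix J assume J: "J \<subseteq> Q"
      have "finite (J \<union> select3 i j k a b c)" "m \<notin> J \<union> select3 i j k a b c"
        using J insert.hyps insert.prems finite_subset by (auto simp: select3_def)
      from pminor_lincomb[where A = A and s = s, OF this \<beta> d]
      show "s * pminor (J \<union> select3 i j k a b c) A + \<beta> * pminor (insert m (J \<union> select3 i j k a b c)) A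
        = \<beta> * ?d * pminor (J \<union> select3 i j k a b c) ?B" by simp
    qed
    then have "s * X a b c + \<beta> * Y a b c = (\<beta> * ?d) * contract Q (\<lambda>I. pminor I ?B) r (select3 i j k a b c)" for a b c
      unfolding X_def Y_def contract_lincomb contract_scale .
    then have "F s = (\<beta> * ?d) ^ 4 * cayley (\<lambda>a b c. contract Q (\<lambda>I. pminor I ?B) r (select3 i j k a b c))"
      unfolding F_def by (simp only: cayley_scale)
    also have "cayley (\<lambda>a b c. contract Q (\<lambda>I. pminor I ?B) r (select3 i j k a b c)) = 0"
    proof (rule insert.IH)
      show "?B i j = ?B j i" for i j
        using insert.prems(1)[of i j] insert.prems(1)[of i m] insert.prems(1)[of m j] by simp
    qed (use insert.prems in auto)
    finally show ?thesis by simp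
  qed
  moreover have "polyfun F"
    unfolding F_def by (intro cayley_polyfun polyfun_intros)
  ultimately have "F (r m False) = 0" if "\<beta> \<noteq> 0"
    using polyfun_eq_zero[of F "{- \<beta> * A m m}"] that by blast
  moreover have "F (r m False) = 0" if "\<beta> = 0"
  proof -
    have "cayley X = 0" unfolding X_def by (rule insert.IH) (use insert.prems in auto)
    then show ?thesis unfolding F_def using that cayley_scale[of _ X] by simp
  qed
  ultimately show ?case using F by metis
qed

lemma pminor_scale: "finite I \<Longrightarrow> pminor I (\<lambda>i j. c * A i j) = c ^ card I * pminor I A"
  using pminor_scale_rows[of I "\<lambda>_. c"] by simp

text \<open>Minors of size \<open>card I\<close> scale by \<open>t ^ card I\<close>, so projectively
  the parameter \<open>t\<close> can be absorbed into the matrix.\<close>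

lemma minors_tensor_eq:
  assumes "A \<in> carrier_mat n n" "t \<noteq> 0" "I \<subseteq> {..<n}"
  shows "minors_tensor n A t I = t ^ n * pminor I (\<lambda>i j. A $$ (i, j) / t)"
proof -
  have fin: "finite I" using assms(3) finite_subset by blast
  have "card I \<le> n" using card_mono[OF _ assms(3)] by simp
  then have "t ^ (n - card I) = t ^ n * (1 / t) ^ card I"
    using assms(2) by (simp add: power_diff power_one_over)
  moreover have "pminor I (\<lambda>i j. A $$ (i, j) / t) = (1 / t) ^ card I * pminor I (\<lambda>i j. A $$ (i, j))"
    using pminor_scale[OF fin, of "1 / t"] by simp
  ultimately show ?thesis
    using assms by (simp add: minors_tensor_def principal_minor_eq_pminor)
qed

definition minor_points :: "nat \<Rightarrow> (nat set \<Rightarrow> complex) set set" where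
  "minor_points n = {proj_point (minors_tensor n A t) | A t.
        A \<in> carrier_mat n n \<and> transpose_mat A = A \<and> t \<noteq> 0}"

lemma slice_hyperdet_minors_tensor:
  assumes "A \<in> carrier_mat n n" "transpose_mat A = A" "t \<noteq> 0" "distinct3 n i j k"
  shows "slice_hyperdet n i j k r (fscale c (minors_tensor n A t)) = 0"
proof -
  \<comment> \<open>Set to zero outside the index range, where nothing is known of \<open>A\<close>,
    so that symmetry holds for all indices.\<close>
  let ?B = "\<lambda>i j. if i < n \<and> j < n then A $$ (i, j) / t else 0"
  have sym: "A $$ (i, j) = A $$ (j, i)" if "i < n" "j < n" for i j
    using assms(1,2) that by (metis carrier_matD index_transpose_mat(1))
  have "contract ({..<n} - {i, j, k}) (fscale c (minors_tensor n A t)) r (select3 i j k a b d)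
      = (c * t ^ n) * contract ({..<n} - {i, j, k}) (\<lambda>I. pminor I ?B) r (select3 i j k a b d)" for a b d
    unfolding contract_scale[symmetric]
  proof (rule contract_cong[OF refl])
    fix J assume "J \<subseteq> {..<n} - {i, j, k}"
    then have *: "J \<union> select3 i j k a b d \<subseteq> {..<n}"
      using assms(4) by (auto simp: select3_def distinct3_def)
    have "pminor (J \<union> select3 i j k a b d) (\<lambda>i j. A $$ (i, j) / t) = pminor (J \<union> select3 i j k a b d) ?B"
      by (rule pminor_cong) (use * in auto)
    then show "fscale c (minors_tensor n A t) (J \<union> select3 i j k a b d) = c * t ^ n * pminor (J \<union> select3 i j k a b d) ?B"
      using minors_tensor_eq[OF assms(1,3) *] by (simp add: fscale_def)
  qed
  moreover have "cayley (\<lambda>a b d. contract ({..<n} - {i, j, k}) (\<lambda>I. pminor I ?B) r (select3 i j k a b d)) = 0"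
    by (rule hyp_minors) (use sym assms(4) in \<open>auto simp: distinct3_def\<close>)
  ultimately show ?thesis
    by (simp add: slice_hyperdet_eq_contract[OF assms(4)] cayley_scale)
qed

lemma minor_points_subset_zero_locus:
  assumes "n \<ge> 3"
  shows "minor_points n \<subseteq> zero_locus n (HD n)"
proof
  fix p assume "p \<in> minor_points n"
  then obtain A t where A: "A \<in> carrier_mat n n" "transpose_mat A = A" "t \<noteq> 0"
    and p: "p = proj_point (minors_tensor n A t)"
    by (auto simp: minor_points_def)
  have "minors_tensor n A t {} \<noteq> 0"
    using A minors_tensor_eq[OF A(1,3), of "{}"] by simp
  then have "minors_tensor n A t \<noteq> 0" by (auto simp: fun_eq_iff)
  moreover have "minors_tensor n A t \<in> tensors {..<n}"
    by (simp add: tensors_def minors_tensor_def)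
  ultimately have "p \<in> proj_space n" by (auto simp: proj_space_def p)
  moreover have "f z = 0" if f: "f \<in> HD n" and z: "z \<in> p" for f z
    using f[unfolded HD_eq[OF assms]]
  proof (induction rule: cfun.span_induct_alt)
    case (step c x y)
    from z obtain b where "z = fscale b (minors_tensor n A t)" by (auto simp: p proj_point_def)
    with step slice_hyperdet_minors_tensor[OF A] show ?case by (auto simp: slice_hyperdets_def fscale_def)
  qed simp
  ultimately show "p \<in> zero_locus n (HD n)" by (simp add: zero_locus_def)
qed

lemma Z_variety_subset:
  assumes "n \<ge> 3"
  shows "Z_variety n \<subseteq> zero_locus n (HD n)"
  unfolding Z_variety_def zariski_closure_def minor_points_def[symmetric]
proof (rule Inter_lower, intro CollectI conjI minor_points_subset_zero_locus[OF assms])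
  show "zariski_closed n (zero_locus n (HD n))"
    unfolding zariski_closed_def using HD_subset_sym_power[OF assms] by blast
qed

section \<open>Normalized zeros of the module\<close>

definition affine_row :: "(nat \<Rightarrow> complex) \<Rightarrow> nat \<Rightarrow> bool \<Rightarrow> complex" where
  "affine_row x p b = (if b then x p else 1)"

lemma affine_row_simps [simp]: "affine_row x p False = 1" "affine_row x p True = x p"
  by (simp_all add: affine_row_def)

text \<open>A polynomial in \<open>s\<close> with value \<open>z L\<close> at 0 and top coefficient
  \<open>z (Q \<union> L)\<close>, for finite \<open>Q\<close>: it joins a known coordinate to the
  one that is to be determined.\<close>

definition line_contract :: "(nat set \<Rightarrow> complex) \<Rightarrow> nat set \<Rightarrow> complex \<Rightarrow> nat set \<Rightarrow> complex" where
  "line_contract z Q s L = contract Q z (affine_row (\<lambda>_. s)) L"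

lemma line_contract_empty [simp]: "line_contract z {} s L = z L"
  by (simp add: line_contract_def)

lemma line_contract_singleton: "line_contract z {l} s L = z L + s * z (insert l L)"
  by (simp add: line_contract_def contract_insert)

lemma line_contract_at_0:
  assumes "finite Q"
  shows "line_contract z Q 0 L = z L"
proof -
  have "affine_row (\<lambda>_. 0) p = bvec False" for p by (auto simp: affine_row_def fun_eq_iff)
  then have "contract Q z (affine_row (\<lambda>_. 0)) L = contract {} z (affine_row (\<lambda>_. 0)) L"
    using assms by (intro contract_restrict) auto
  then show ?thesis by (simp add: line_contract_def)
qed

lemma line_contract_polyfun: "polyfun (\<lambda>s. line_contract z Q s L)"
proof -
  have "polyfun (\<lambda>s. affine_row (\<lambda>_. s) p b)" for p b
    by (cases b) (simp_all add: polyfun_intros)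
  then show ?thesis unfolding line_contract_def contract_def by (intro polyfun_intros)
qed

text \<open>Only the term \<open>J = Q\<close> survives. This isolates the single coordinate not
  covered by an induction hypothesis on proper subsets.\<close>

lemma line_contract_diff:
  assumes "finite Q" "\<And>J. J \<subset> Q \<Longrightarrow> z (J \<union> L) = z' (J \<union> L)"
  shows "line_contract z Q s L - line_contract z' Q s L = s ^ card Q * (z (Q \<union> L) - z' (Q \<union> L))"
proof -
  have "line_contract z Q s L - line_contract z' Q s L = (\<Sum>J\<in>Pow Q. (\<Prod>p\<in>Q. affine_row (\<lambda>_. s) p (p \<in> J)) * (z (J \<union> L) - z' (J \<union> L)))"
    by (simp add: line_contract_def contract_def sum_subtractf algebra_simps)
  also have "\<dots> = (\<Sum>J\<in>{Q}. (\<Prod>p\<in>Q. affine_row (\<lambda>_. s) p (p \<in> J)) * (z (J \<union> L) - z' (J \<union> L)))"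
    using assms by (intro sum.mono_neutral_right) auto
  also have "\<dots> = s ^ card Q * (z (Q \<union> L) - z' (Q \<union> L))"
    by simp
  finally show ?thesis .
qed

lemma line_contract_cong:
  assumes "\<And>J. J \<subseteq> Q \<Longrightarrow> z (J \<union> L) = z' (J \<union> L)"
  shows "line_contract z Q s L = line_contract z' Q s L"
  unfolding line_contract_def by (rule contract_cong) (use assms in auto)

lemma contract_product:
  assumes "finite Q" "\<And>I. finite I \<Longrightarrow> z I = f (I \<inter> B) * g (I - B)" "finite L"
  shows "contract Q z r L = contract (Q \<inter> B) f r (L \<inter> B) * contract (Q - B) g r (L - B)"
  using assms
proof (induction Q arbitrary: L rule: finite_induct)
  case (insert m Q)
  show ?case
  proof (cases "m \<in> B")
    case True
    with insert show ?thesis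
      by (simp add: contract_insert Int_insert_left insert_Diff_if algebra_simps)
  next
    case False
    with insert show ?thesis
      by (simp add: contract_insert Int_insert_left insert_Diff_if algebra_simps)
  qed
qed simp

text \<open>The third cumulant made homogeneous of degree 3 by powers of
  \<open>W False False False\<close>, since along a line this entry does not stay 1.\<close>

definition cumulant :: "(bool \<Rightarrow> bool \<Rightarrow> bool \<Rightarrow> complex) \<Rightarrow> complex" where
  "cumulant W = W False False False ^ 2 * W True True True
     - W False False False * (W True False False * W False True True
         + W False True False * W True False True + W False False True * W True True False)
     + 2 * W True False False * W False True False * W False False True"

text \<open>Completing the square in the entry \<open>W True True True\<close>: the hyperdeterminant
  is quadratic in it with leading coefficient \<open>W False False False ^ 2\<close>, and the
  remainder is the product of the three faces through \<open>W False False False\<close>.\<close>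

lemma cayley_cumulant: "W False False False ^ 2 * cayley W = cumulant W ^ 2
    + 4 * det2 (\<lambda>a b. W a b False) * det2 (\<lambda>a c. W a False c) * det2 (\<lambda>b c. W False b c)"
proof -
  let ?p = "W False False False" and ?q = "W True False False" and ?T = "det2 (W True)" and ?c = "cumulant W"
  let ?k12 = "det2 (\<lambda>a b. W a b False)" and ?k13 = "det2 (\<lambda>a c. W a False c)" and ?k23 = "det2 (W False)"
  have 1: "?p * polar_det2 (W False) (W True) = ?c + 2 * ?q * ?k23"
    by (simp add: cumulant_def polar_det2_def det2_def power2_eq_square algebra_simps)
  have 2: "?k12 * ?k13 = ?q * ?c + ?q ^ 2 * ?k23 - ?p ^ 2 * ?T"
    by (simp add: cumulant_def det2_def power2_eq_square algebra_simps)
  have "?p ^ 2 * cayley W = (?p * polar_det2 (W False) (W True)) ^ 2 - 4 * ?p ^ 2 * ?k23 * ?T"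
    by (simp add: cayley_discriminant power2_eq_square algebra_simps)
  also have "\<dots> = ?c ^ 2 + 4 * (?k12 * ?k13) * ?k23"
    unfolding 1 2 by (simp add: power2_eq_square algebra_simps)
  finally show ?thesis by simp
qed

definition select2 :: "nat \<Rightarrow> nat \<Rightarrow> bool \<Rightarrow> bool \<Rightarrow> nat set" where
  "select2 i j a b = (if a then {i} else {}) \<union> (if b then {j} else {})"

lemma slice_det_eq_contract:
  assumes "i < n" "j < n" "i \<noteq> j"
  shows "slice_det n i j r z = det2 (\<lambda>a b. contract ({..<n} - {i, j}) z r (select2 i j a b))"
proof -
  have "contract_all n z (r(i := bvec a, j := bvec b)) = contract ({..<n} - {i, j}) z r (select2 i j a b)" for a b
  proof -
    have "contract_all n z (r(i := bvec a, j := bvec b)) = contract ({..<n} - {j}) z (r(i := bvec a)) (if b then {j} else {})"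
      using assms by (subst contract_unit) auto
    also have "\<dots> = contract ({..<n} - {j} - {i}) z r (if a then insert i (if b then {j} else {}) else (if b then {j} else {}))"
      using assms by (subst contract_unit) auto
    also have "{..<n} - {j} - {i} = {..<n} - {i, j}" by auto
    also have "(if a then insert i (if b then {j} else {}) else (if b then {j} else {})) = select2 i j a b"
      by (auto simp: select2_def)
    finally show ?thesis .
  qed
  then show ?thesis by (simp add: slice_det_def)
qed

text \<open>What the generic translation achieves. As
  \<open>slice_det n i j (\<lambda>_. bvec False) w\<close> is \<open>- \<beta> i j\<close>, the
  last assumption is the genericity condition on \<open>\<beta>\<close>, stated for covectors with
  first coordinate 1.\<close>

locale normalized =
  fixes n :: nat and w :: "nat set \<Rightarrow> complex"
  assumes w_empty: "w {} = 1"
    and slice_hyperdet_w: "\<And>i j k r. distinct3 n i j k \<Longrightarrow> slice_hyperdet n i j k r w = 0"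
    and slice_det_w: "\<And>i j x. i < n \<Longrightarrow> j < n \<Longrightarrow> i \<noteq> j \<Longrightarrow> slice_det n i j (\<lambda>_. bvec False) w = 0 \<Longrightarrow> slice_det n i j (affine_row x) w = 0"
begin

text \<open>Minus the second cumulant; for the tensor of minors of a symmetric matrix it is the
  square of the entry at \<open>i\<close>, \<open>j\<close>. The third cumulant
  \<open>\<tau>\<close> is then twice the product of the entries of a triangle.\<close>

definition \<beta> :: "nat \<Rightarrow> nat \<Rightarrow> complex" where
  "\<beta> i j = w {i} * w {j} - w {i, j}"

definition \<tau> :: "nat \<Rightarrow> nat \<Rightarrow> nat \<Rightarrow> complex" where
  "\<tau> i j k = w {i, j, k} - w {i} * w {j, k} - w {j} * w {i, k} - w {k} * w {i, j} + 2 * w {i} * w {j} * w {k}"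

lemma \<beta>_sym: "\<beta> i j = \<beta> j i"
  by (simp add: \<beta>_def insert_commute mult.commute)

lemma \<tau>_sym: "\<tau> i j k = \<tau> j i k" "\<tau> i j k = \<tau> i k j"
  by (simp_all add: \<tau>_def insert_commute algebra_simps)

text \<open>Covectors \<open>(1, 0)\<close> outside \<open>Q\<close> and \<open>(1, s)\<close> on
  \<open>Q\<close> turn the slice over all positions into one along a line.\<close>

lemma slice_hyperdet_line_contract:
  assumes "distinct3 n i j k" "Q \<subseteq> {..<n} - {i, j, k}"
  shows "cayley (\<lambda>a b c. line_contract w Q s (select3 i j k a b c)) = 0"
proof -
  let ?x = "\<lambda>p. if p \<in> Q then s else 0"
  have "contract ({..<n} - {i, j, k}) w (affine_row ?x) L = line_contract w Q s L" for L
  proof -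
    have "contract ({..<n} - {i, j, k}) w (affine_row ?x) L = contract Q w (affine_row ?x) L"
      using assms(2) by (intro contract_restrict) (auto simp: affine_row_def fun_eq_iff)
    also have "\<dots> = line_contract w Q s L"
      unfolding line_contract_def by (rule contract_cong) (auto simp: affine_row_def fun_eq_iff)
    finally show ?thesis .
  qed
  with slice_hyperdet_w[OF assms(1), of "affine_row ?x"] show ?thesis
    by (simp add: slice_hyperdet_eq_contract[OF assms(1)])
qed

lemma slice_det_line_contract:
  assumes ij: "i < n" "j < n" "i \<noteq> j" and "\<beta> i j = 0" "Q \<subseteq> {..<n} - {i, j}"
  shows "det2 (\<lambda>a b. line_contract w Q s (select2 i j a b)) = 0"
proof -
  have "contract ({..<n} - {i, j}) w (\<lambda>_. bvec False) L = w L" for L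
    using contract_restrict[of "{..<n} - {i, j}" "{}" "\<lambda>_. bvec False" w L] by simp
  then have "slice_det n i j (\<lambda>_. bvec False) w = - \<beta> i j"
    by (simp add: slice_det_eq_contract[OF ij] det2_def select2_def \<beta>_def w_empty insert_commute)
  then have K: "slice_det n i j (affine_row x) w = 0" for x
    using slice_det_w[OF ij, of x] assms by simp
  let ?x = "\<lambda>p. if p \<in> Q then s else 0"
  have "contract ({..<n} - {i, j}) w (affine_row ?x) L = line_contract w Q s L" for L
  proof -
    have "contract ({..<n} - {i, j}) w (affine_row ?x) L = contract Q w (affine_row ?x) L"
      using assms by (intro contract_restrict) (auto simp: affine_row_def fun_eq_iff)
    also have "\<dots> = line_contract w Q s L"
      unfolding line_contract_def by (rule contract_cong) (auto simp: affine_row_def fun_eq_iff)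
    finally show ?thesis .
  qed
  with K[of ?x] show ?thesis
    by (simp add: slice_det_eq_contract[OF ij])
qed

lemma \<tau>_squared:
  assumes "distinct3 n i j k"
  shows "\<tau> i j k ^ 2 = 4 * \<beta> i j * \<beta> i k * \<beta> j k"
proof -
  have "cumulant (\<lambda>a b c. w (select3 i j k a b c)) = \<tau> i j k"
    by (simp add: cumulant_def \<tau>_def select3_def w_empty insert_commute algebra_simps)
  moreover have "det2 (\<lambda>a b. w (select3 i j k a b False)) = - \<beta> i j"
    "det2 (\<lambda>a c. w (select3 i j k a False c)) = - \<beta> i k" "det2 (\<lambda>b c. w (select3 i j k False b c)) = - \<beta> j k"
    by (simp_all add: det2_def \<beta>_def select3_def w_empty insert_commute)
  moreover have "cayley (\<lambda>a b c. w (select3 i j k a b c)) = 0"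
    using slice_hyperdet_line_contract[OF assms, of "{}"] by simp
  ultimately show ?thesis
    using cayley_cumulant[of "\<lambda>a b c. w (select3 i j k a b c)"] by simp
qed

text \<open>Contracting position \<open>j\<close> gives a quadratic \<open>K\<close> in
  \<open>s\<close> that vanishes identically; its coefficients are read off from the values at 0, 1
  and - 1. The linear one determines \<open>w {i, j, k}\<close>, and then the quadratic one is the
  claimed product up to sign.\<close>

lemma \<beta>_trans:
  assumes "distinct3 n i j k" "\<beta> i k = 0"
  shows "\<beta> i j * \<beta> j k = 0"
proof -
  have d: "i < n" "k < n" "i \<noteq> k" "{j} \<subseteq> {..<n} - {i, k}"
    using assms by (auto simp: distinct3_def)
  define K where "K s = (1 + s * w {j}) * (w {i, k} + s * w {i, j, k}) - (w {i} + s * w {i, j}) * (w {k} + s * w {j, k})" for s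
  have K0: "K s = 0" for s
    unfolding K_def using slice_det_line_contract[OF d(1-3) assms(2) d(4), of s]
    by (simp add: det2_def line_contract_singleton select2_def w_empty insert_commute mult.commute)
  have 0: "w {i, k} = w {i} * w {k}"
    using K0[of 0] by (simp add: K_def)
  have "w {i, j, k} + w {j} * w {i, k} - w {i} * w {j, k} - w {i, j} * w {k} = (K 1 - K (- 1)) / 2"
    by (simp add: K_def field_simps)
  then have 1: "w {i, j, k} = w {i} * w {j, k} + w {i, j} * w {k} - w {j} * (w {i} * w {k})"
    by (simp add: K0 0 algebra_simps)
  have "w {j} * w {i, j, k} - w {i, j} * w {j, k} = (K 1 + K (- 1)) / 2 - K 0"
    by (simp add: K_def field_simps)
  then have "w {j} * w {i, j, k} - w {i, j} * w {j, k} = 0"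
    by (simp add: K0)
  then show ?thesis
    unfolding \<beta>_def 1 by (simp add: algebra_simps)
qed

text \<open>Both sides have the same square as polynomials in \<open>s\<close>, and the same nonzero value at \<open>s = 0\<close>.\<close>
lemma cumulant_poly_eq:
  assumes d: "distinct3 n i j k" "l < n" "l \<notin> {i, j, k}"
    and nz: "\<beta> i j \<noteq> 0" "\<beta> i k \<noteq> 0" "\<beta> j k \<noteq> 0"
  shows "\<tau> i j k * cumulant (\<lambda>x y z. line_contract w {l} s (select3 i j k x y z)) =
    4 * ((1 + s * w {l}) * \<beta> i j - s * \<tau> i j l / 2) * ((1 + s * w {l}) * \<beta> i k - s * \<tau> i k l / 2)
      * ((1 + s * w {l}) * \<beta> j k - s * \<tau> j k l / 2)"
proof -
  define W where "W s x y z = line_contract w {l} s (select3 i j k x y z)" for s x y z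
  define R where "R i j s = (1 + s * w {l}) * \<beta> i j - s * (\<tau> i j l / 2)" for i j s
  define C where "C s = \<tau> i j k * cumulant (W s)" for s
  define P where "P s = 4 * R i j s * R i k s * R j k s" for s
  have W: "W s x y z = w (select3 i j k x y z) + s * w (insert l (select3 i j k x y z))" for s x y z
    by (simp add: W_def line_contract_singleton)
  have \<tau>2: "\<tau> i j l ^ 2 = 4 * \<beta> i j * \<beta> i l * \<beta> j l" "\<tau> i k l ^ 2 = 4 * \<beta> i k * \<beta> i l * \<beta> k l"
    "\<tau> j k l ^ 2 = 4 * \<beta> j k * \<beta> j l * \<beta> k l" "\<tau> i j k ^ 2 = 4 * \<beta> i j * \<beta> i k * \<beta> j k"
    using d by (simp_all add: \<tau>_squared distinct3_def)
  \<comment> \<open>As a quadratic form in \<open>1 + s * w {l}\<close> and \<open>s\<close>, the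
    determinant along the line has discriminant zero by \<open>\<tau>_squared\<close>; so its
    product with \<open>\<beta> i j\<close> is minus the square of the linear form
    \<open>R i j s\<close>.\<close>
  have kap: "\<beta> i j * ((1 + s * w {l}) * (w {i, j} + s * w {i, j, l}) - (w {i} + s * w {i, l}) * (w {j} + s * w {j, l}))
      = - (R i j s ^ 2)" if "\<tau> i j l ^ 2 = 4 * \<beta> i j * \<beta> i l * \<beta> j l" for i j s
  proof -
    have "R i j s ^ 2 = (1 + s * w {l}) ^ 2 * \<beta> i j ^ 2 - (1 + s * w {l}) * \<beta> i j * s * \<tau> i j l + s ^ 2 * (\<tau> i j l ^ 2 / 4)"
      by (simp add: R_def power2_eq_square algebra_simps)
    also have "\<dots> = \<beta> i j * ((1 + s * w {l}) ^ 2 * \<beta> i j - (1 + s * w {l}) * s * \<tau> i j l + s ^ 2 * (\<beta> i l * \<beta> j l))"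
      unfolding that by (simp add: power2_eq_square algebra_simps)
    also have "(1 + s * w {l}) ^ 2 * \<beta> i j - (1 + s * w {l}) * s * \<tau> i j l + s ^ 2 * (\<beta> i l * \<beta> j l) =
        - ((1 + s * w {l}) * (w {i, j} + s * w {i, j, l}) - (w {i} + s * w {i, l}) * (w {j} + s * w {j, l}))"
      by (simp add: \<beta>_def \<tau>_def power2_eq_square algebra_simps)
    finally show ?thesis
      by (simp only: mult_minus_right minus_minus)
  qed
  have k1: "det2 (\<lambda>x y. W s x y False) = (1 + s * w {l}) * (w {i, j} + s * w {i, j, l}) - (w {i} + s * w {i, l}) * (w {j} + s * w {j, l})"
    "det2 (\<lambda>x y. W s x False y) = (1 + s * w {l}) * (w {i, k} + s * w {i, k, l}) - (w {i} + s * w {i, l}) * (w {k} + s * w {k, l})"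
    "det2 (\<lambda>x y. W s False x y) = (1 + s * w {l}) * (w {j, k} + s * w {j, k, l}) - (w {j} + s * w {j, l}) * (w {k} + s * w {k, l})" for s
    by (simp_all add: det2_def W select3_def w_empty insert_commute mult.commute)
  have "C s ^ 2 = P s ^ 2" for s
  proof -
    have "cayley (W s) = 0"
      unfolding W_def by (rule slice_hyperdet_line_contract) (use d in \<open>auto simp: distinct3_def\<close>)
    then have "cumulant (W s) ^ 2 = - 4 * det2 (\<lambda>x y. W s x y False) * det2 (\<lambda>x y. W s x False y) * det2 (\<lambda>x y. W s False x y)"
      using cayley_cumulant[of "W s"] by (simp add: add_eq_0_iff2)
    then have "C s ^ 2 = - 16 * (\<beta> i j * det2 (\<lambda>x y. W s x y False)) * (\<beta> i k * det2 (\<lambda>x y. W s x False y)) * (\<beta> j k * det2 (\<lambda>x y. W s False x y))"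
      unfolding C_def power_mult_distrib \<tau>2(4) by (simp add: algebra_simps)
    also have "\<dots> = P s ^ 2"
      unfolding k1 kap[OF \<tau>2(1)] kap[OF \<tau>2(2)] kap[OF \<tau>2(3)] P_def by (simp add: power_mult_distrib)
    finally show ?thesis .
  qed
  then have prod: "(C s - P s) * (C s + P s) = 0" for s
    by (simp add: power2_eq_square algebra_simps)
  have "cumulant (W 0) = \<tau> i j k"
    by (simp add: cumulant_def \<tau>_def W select3_def w_empty insert_commute algebra_simps)
  then have "C 0 + P 0 = 2 * \<tau> i j k ^ 2"
    unfolding C_def P_def R_def using \<tau>2(4) by (simp add: power2_eq_square)
  then have nz0: "C 0 + P 0 \<noteq> 0"
    using nz \<tau>2(4) by simp
  have poly: "polyfun C" "polyfun P"
    unfolding C_def P_def R_def cumulant_def W by (intro polyfun_intros)+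
  have "C s - P s = 0"
    by (rule polyfun_no_zero_divisors[OF polyfun_diff[OF poly] polyfun_add[OF poly] prod nz0])
  then show ?thesis
    by (simp add: C_def P_def R_def W_def[abs_def])
qed

text \<open>Evaluates \<open>cumulant_poly_eq\<close> at the root of \<open>1 + s * w {l}\<close>,
  where only one cubic term survives on each side. If \<open>w {l} = 0\<close> this root lies at
  infinity, and the coefficients of \<open>s ^ 3\<close> are compared instead.\<close>

lemma \<tau>_four:
  assumes d: "distinct3 n i j k" "l < n" "l \<notin> {i, j, k}"
    and nz: "\<beta> i j \<noteq> 0" "\<beta> i k \<noteq> 0" "\<beta> j k \<noteq> 0"
  shows "4 * \<tau> i j k * (\<beta> i l * \<beta> j l * \<beta> k l) = \<tau> i j l * \<tau> i k l * \<tau> j k l"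
proof -
  define K where "K s = cumulant (\<lambda>x y z. line_contract w {l} s (select3 i j k x y z))" for s
  have eq: "\<tau> i j k * K s =
    4 * ((1 + s * w {l}) * \<beta> i j - s * \<tau> i j l / 2) * ((1 + s * w {l}) * \<beta> i k - s * \<tau> i k l / 2)
      * ((1 + s * w {l}) * \<beta> j k - s * \<tau> j k l / 2)" for s
    unfolding K_def by (rule cumulant_poly_eq[OF assms])
  have K: "K s = (1 + s * w {l}) ^ 2 * (w {i, j, k} + s * w {i, j, k, l})
     - (1 + s * w {l}) * ((w {i} + s * w {i, l}) * (w {j, k} + s * w {j, k, l})
       + (w {j} + s * w {j, l}) * (w {i, k} + s * w {i, k, l}) + (w {k} + s * w {k, l}) * (w {i, j} + s * w {i, j, l}))
     + 2 * (w {i} + s * w {i, l}) * (w {j} + s * w {j, l}) * (w {k} + s * w {k, l})" for s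
    by (simp add: K_def cumulant_def line_contract_singleton select3_def w_empty insert_commute)
  show ?thesis
  proof (cases "w {l} = 0")
    case True
    \<comment> \<open>The third difference of a cubic is six times its leading coefficient.\<close>
    have 1: "6 * (2 * w {i, l} * w {j, l} * w {k, l}) + 6 * 0 = K 2 - 3 * K 1 + 3 * K 0 - K (-1)"
      unfolding K True by (simp add: algebra_simps)
    have "\<tau> i j k * (K 2 - 3 * K 1 + 3 * K 0 - K (-1)) =
       \<tau> i j k * K 2 - 3 * (\<tau> i j k * K 1) + 3 * (\<tau> i j k * K 0) - \<tau> i j k * K (-1)"
      by (simp add: algebra_simps)
    also have "\<dots> = - 3 * (\<tau> i j l * \<tau> i k l * \<tau> j k l)"
      unfolding eq True by (simp add: field_simps)
    finally have "\<tau> i j k * (6 * (2 * w {i, l} * w {j, l} * w {k, l})) = - 3 * (\<tau> i j l * \<tau> i k l * \<tau> j k l)"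
      unfolding 1[symmetric] by simp
    then show ?thesis
      unfolding \<beta>_def True by (simp add: algebra_simps)
  next
    case False
    define s where "s = - 1 / w {l}"
    have s: "1 + s * w {l} = 0" "s \<noteq> 0" using False by (simp_all add: s_def)
    have wb: "w {i} + s * w {i, l} = - s * \<beta> i l" for i
    proof -
      have "w {i} = - (s * w {l}) * w {i}" using s(1) by (simp add: add_eq_0_iff2)
      then show ?thesis by (simp add: \<beta>_def algebra_simps)
    qed
    have "K s = - 2 * s ^ 3 * (\<beta> i l * \<beta> j l * \<beta> k l)"
      unfolding K s wb by (simp add: power3_eq_cube)
    moreover have "\<tau> i j k * K s = - (s ^ 3 * (\<tau> i j l * \<tau> i k l * \<tau> j k l)) / 2"
      unfolding eq s by (simp add: power3_eq_cube)
    ultimately have "s ^ 3 * (4 * \<tau> i j k * (\<beta> i l * \<beta> j l * \<beta> k l)) = s ^ 3 * (\<tau> i j l * \<tau> i k l * \<tau> j k l)"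
      by (simp add: algebra_simps)
    then show ?thesis using s(2) by simp
  qed
qed

section \<open>The symmetric matrix and the choice of its signs\<close>

definition rep :: "nat \<Rightarrow> nat" where
  "rep j = (LEAST i. i < n \<and> (i = j \<or> \<beta> i j \<noteq> 0))"

text \<open>Either root would do: changing the sign of \<open>root_rep j\<close> changes the signs
  of row and column \<open>j\<close> of \<open>A\<close> off the diagonal, which leaves principal
  minors unchanged.\<close>

definition root_rep :: "nat \<Rightarrow> complex" where
  "root_rep j = csqrt (\<beta> (rep j) j)"

text \<open>Roots are fixed on the star of edges from the representative o of a class; the required
  triangle identity for o, \<open>i\<close>, \<open>j\<close> then forces the remaining entries of
  the class. Entries between different classes are 0.\<close>

definition A :: "nat \<Rightarrow> nat \<Rightarrow> complex" where
  "A i j = (if i \<ge> n \<or> j \<ge> n then 0 else if i = j then w {i} else if \<beta> i j = 0 then 0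
    else if rep i = i then root_rep j else if rep j = j then root_rep i
    else \<tau> (rep i) i j / 2 / (root_rep i * root_rep j))"

lemma \<beta>_equiv:
  assumes "i < n" "j < n" "k < n" "i \<noteq> j" "j \<noteq> k" "i \<noteq> k" "\<beta> i j \<noteq> 0" "\<beta> j k \<noteq> 0"
  shows "\<beta> i k \<noteq> 0"
  using \<beta>_trans[of i j k] assms by (auto simp: distinct3_def)

lemma rep: "j < n \<Longrightarrow> rep j < n \<and> (rep j = j \<or> \<beta> (rep j) j \<noteq> 0)"
  unfolding rep_def by (rule LeastI[of _ j]) simp

lemma rep_cong:
  assumes "i < n" "j < n" "i \<noteq> j" "\<beta> i j \<noteq> 0"
  shows "rep i = rep j"
proof -
  have "(l = i \<or> \<beta> l i \<noteq> 0) \<longleftrightarrow> (l = j \<or> \<beta> l j \<noteq> 0)" if "l < n" for l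
    using assms that \<beta>_equiv[of l i j] \<beta>_equiv[of l j i] \<beta>_sym[of i j] by metis
  then show ?thesis unfolding rep_def by (metis (no_types, lifting))
qed

lemma A_sym: "A i j = A j i"
proof (cases "i < n \<and> j < n \<and> i \<noteq> j \<and> \<beta> i j \<noteq> 0")
  case True
  then have r: "rep i = rep j" using rep_cong by blast
  then have "\<not> (rep i = i \<and> rep j = j)" using True by auto
  with True r show ?thesis
    using \<beta>_sym[of i j] \<tau>_sym(2)[of "rep i" i j] by (auto simp: A_def mult.commute)
qed (use \<beta>_sym[of i j] in \<open>auto simp: A_def\<close>)

lemma A_squared:
  assumes "i < n" "j < n" "i \<noteq> j"
  shows "A i j ^ 2 = \<beta> i j"
proof -
  consider "\<beta> i j = 0" | "\<beta> i j \<noteq> 0" "rep i = i" | "\<beta> i j \<noteq> 0" "rep i \<noteq> i" "rep j = j"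
    | "\<beta> i j \<noteq> 0" "rep i \<noteq> i" "rep j \<noteq> j" by blast
  then show ?thesis
  proof cases
    case 2
    then have "rep j = i" using rep_cong[OF assms] by simp
    with 2 assms show ?thesis by (simp add: A_def root_rep_def)
  next
    case 3
    then have "rep i = j" using rep_cong[OF assms] by simp
    with 3 assms show ?thesis by (simp add: A_def root_rep_def \<beta>_sym)
  next
    case 4
    define o' where "o' = rep i"
    have o: "rep i = o'" "rep j = o'" using rep_cong[OF assms 4(1)] by (simp_all add: o'_def)
    have on: "o' < n" "\<beta> o' i \<noteq> 0" "\<beta> o' j \<noteq> 0" using rep[OF assms(1)] rep[OF assms(2)] 4 o by auto
    have "distinct3 n o' i j" using assms 4 o on by (auto simp: distinct3_def)
    from \<tau>_squared[OF this] have "(\<tau> o' i j / 2 / (root_rep i * root_rep j)) ^ 2 = \<beta> i j"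
      using on by (simp add: root_rep_def o power_divide power_mult_distrib)
    with 4 assms show ?thesis by (simp add: A_def o)
  qed (use assms in \<open>simp add: A_def\<close>)
qed

lemma A_triangle_rep:
  assumes "distinct3 n i j k" "\<beta> i j \<noteq> 0" "\<beta> i k \<noteq> 0" "\<beta> j k \<noteq> 0" "rep i = i"
  shows "2 * A i j * A i k * A j k = \<tau> i j k"
proof -
  have lt: "i < n" "j < n" "k < n" "i \<noteq> j" "i \<noteq> k" "j \<noteq> k" using assms(1) by (auto simp: distinct3_def)
  have r: "rep j = i" "rep k = i" using rep_cong[of i j] rep_cong[of i k] lt assms by auto
  have "A i j = root_rep j" "A i k = root_rep k" "A j k = \<tau> i j k / 2 / (root_rep j * root_rep k)"
    using lt assms r by (auto simp: A_def)
  moreover have "root_rep j \<noteq> 0" "root_rep k \<noteq> 0" using assms by (simp_all add: root_rep_def r)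
  ultimately show ?thesis by simp
qed

text \<open>Triangles through the representative hold by construction. Any other triangle is
  compared with the three through the representative by \<open>\<tau>_four\<close>, where the
  representative is the fourth index.\<close>

lemma A_triangle:
  assumes d: "distinct3 n i j k" and nz: "\<beta> i j \<noteq> 0" "\<beta> i k \<noteq> 0" "\<beta> j k \<noteq> 0"
  shows "2 * A i j * A i k * A j k = \<tau> i j k"
proof -
  have lt: "i < n" "j < n" "k < n" "i \<noteq> j" "i \<noteq> k" "j \<noteq> k" using d by (auto simp: distinct3_def)
  consider "rep i = i" | "rep j = j" | "rep k = k" | "rep i \<noteq> i" "rep j \<noteq> j" "rep k \<noteq> k" by blast
  then show ?thesis
  proof cases
    case 1
    then show ?thesis using A_triangle_rep assms by blast
  next
    case 2
    have "2 * A j i * A j k * A i k = \<tau> j i k"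
      by (rule A_triangle_rep) (use 2 nz lt \<beta>_sym[of i j] in \<open>simp_all add: distinct3_def\<close>)
    then show ?thesis using A_sym[of i j] \<tau>_sym(1)[of i j k] by (simp add: algebra_simps)
  next
    case 3
    have "2 * A k i * A k j * A i j = \<tau> k i j"
      by (rule A_triangle_rep) (use 3 nz lt \<beta>_sym[of i k] \<beta>_sym[of j k] in \<open>simp_all add: distinct3_def\<close>)
    moreover have "\<tau> k i j = \<tau> i j k" using \<tau>_sym by metis
    ultimately show ?thesis using A_sym[of i k] A_sym[of j k] by (simp add: algebra_simps)
  next
    case 4
    define l where "l = rep i"
    have r: "rep i = l" "rep j = l" "rep k = l"
      using rep_cong[of i j] rep_cong[of i k] lt nz by (auto simp: l_def)
    have ln: "l < n" "\<beta> l i \<noteq> 0" "\<beta> l j \<noteq> 0" "\<beta> l k \<noteq> 0"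
      using rep[OF lt(1)] rep[OF lt(2)] rep[OF lt(3)] 4 r by auto
    have l: "l \<notin> {i, j, k}" using 4 r by auto
    have rt: "root_rep i ^ 2 = \<beta> i l" "root_rep j ^ 2 = \<beta> j l" "root_rep k ^ 2 = \<beta> k l"
      by (simp_all add: root_rep_def r \<beta>_sym)
    have nz0: "root_rep i \<noteq> 0" "root_rep j \<noteq> 0" "root_rep k \<noteq> 0"
      using ln by (auto simp: root_rep_def r)
    have t: "\<tau> l i j = \<tau> i j l" "\<tau> l i k = \<tau> i k l" "\<tau> l j k = \<tau> j k l"
      using \<tau>_sym by metis+
    have "A i j = \<tau> i j l / 2 / (root_rep i * root_rep j)" "A i k = \<tau> i k l / 2 / (root_rep i * root_rep k)"
      "A j k = \<tau> j k l / 2 / (root_rep j * root_rep k)"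
      using 4 lt nz by (simp_all add: A_def r t)
    then have "\<tau> i j l = 2 * (A i j * root_rep i * root_rep j)" "\<tau> i k l = 2 * (A i k * root_rep i * root_rep k)"
      "\<tau> j k l = 2 * (A j k * root_rep j * root_rep k)"
      using nz0 by simp_all
    then have "4 * (2 * A i j * A i k * A j k) * (root_rep i ^ 2 * root_rep j ^ 2 * root_rep k ^ 2) = \<tau> i j l * \<tau> i k l * \<tau> j k l"
      by (simp add: power2_eq_square)
    then have "4 * (2 * A i j * A i k * A j k) * (root_rep i ^ 2 * root_rep j ^ 2 * root_rep k ^ 2) =
        4 * \<tau> i j k * (root_rep i ^ 2 * root_rep j ^ 2 * root_rep k ^ 2)"
      using \<tau>_four[OF d ln(1) l nz] unfolding rt by simp
    then show ?thesis using nz0 by (simp add: algebra_simps)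
  qed
qed

lemma A_blocks:
  assumes "i < n" "p \<in> {p. p < n \<and> (p = i \<or> \<beta> i p \<noteq> 0)}" "q \<notin> {p. p < n \<and> (p = i \<or> \<beta> i p \<noteq> 0)}"
  shows "A p q = 0 \<and> A q p = 0"
proof -
  have "A p q = 0"
  proof (cases "q < n")
    case True
    with assms have "q \<noteq> i" "\<beta> i q = 0" "p \<noteq> q" by auto
    then have "\<beta> p q = 0" using \<beta>_equiv[of i p q] assms True by auto
    then show ?thesis using \<open>p \<noteq> q\<close> by (simp add: A_def)
  qed (simp add: A_def)
  then show ?thesis using A_sym[of p q] by simp
qed

text \<open>Two indices of different classes. Along the line in \<open>I - {i, j}\<close> the
  determinant vanishes for \<open>w\<close> by genericity, and for the minors because they factor
  over the block of \<open>i\<close>, which makes the array of rank one. The two determinants differ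
  only by the top coordinate, multiplied by \<open>line_contract w ?Q s {}\<close>, which is 1 at
  \<open>s = 0\<close>.\<close>

lemma w_eq_minor_cross:
  assumes I: "I \<subseteq> {..<n}" and ij: "i \<in> I" "j \<in> I" "i \<noteq> j" "\<beta> i j = 0"
    and IH: "\<And>J. J \<subset> I \<Longrightarrow> w J = pminor J A"
  shows "w I = pminor I A"
proof -
  let ?Q = "I - {i, j}" and ?f = "\<lambda>I. pminor I A"
  let ?B = "{p. p < n \<and> (p = i \<or> \<beta> i p \<noteq> 0)}"
  have lt: "i < n" "j < n" using I ij by auto
  have fin: "finite I" using I finite_subset by blast
  have "det2 (\<lambda>a c. line_contract w ?Q s (select2 i j a c)) = 0" for s
    by (rule slice_det_line_contract) (use lt ij I in auto)
  moreover have "det2 (\<lambda>a c. line_contract ?f ?Q s (select2 i j a c)) = 0" for s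
  proof -
    have "line_contract ?f ?Q s (select2 i j a c) = contract (?Q \<inter> ?B) ?f (affine_row (\<lambda>_. s)) (if a then {i} else {})
        * contract (?Q - ?B) ?f (affine_row (\<lambda>_. s)) (if c then {j} else {})" for a c
    proof -
      have "line_contract ?f ?Q s (select2 i j a c) = contract (?Q \<inter> ?B) ?f (affine_row (\<lambda>_. s)) (select2 i j a c \<inter> ?B)
        * contract (?Q - ?B) ?f (affine_row (\<lambda>_. s)) (select2 i j a c - ?B)"
        unfolding line_contract_def
      proof (rule contract_product)
        show "pminor I A = pminor (I \<inter> ?B) A * pminor (I - ?B) A" if "finite I" for I
          by (rule pminor_mult_blocks[OF that]) (rule A_blocks[OF lt(1)])
      qed (use fin in \<open>auto simp: select2_def\<close>)
      moreover have "select2 i j a c \<inter> ?B = (if a then {i} else {})" "select2 i j a c - ?B = (if c then {j} else {})"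
        using lt ij by (auto simp: select2_def)
      ultimately show ?thesis by simp
    qed
    then show ?thesis by (simp add: det2_def)
  qed
  moreover have "line_contract w ?Q s (select2 i j a c) = line_contract ?f ?Q s (select2 i j a c)" if "\<not> (a \<and> c)" for s a c
    by (rule line_contract_cong, rule IH) (use that ij in \<open>auto simp: select2_def\<close>)
  moreover have "line_contract w ?Q s (select2 i j True True) - line_contract ?f ?Q s (select2 i j True True) = s ^ card ?Q * (w I - pminor I A)" for s
  proof -
    have "?Q \<union> select2 i j True True = I" using ij by (auto simp: select2_def)
    moreover have "w (J \<union> select2 i j True True) = pminor (J \<union> select2 i j True True) A" if "J \<subset> ?Q" for J
      by (rule IH) (use that ij in \<open>auto simp: select2_def\<close>)
    ultimately show ?thesis using line_contract_diff[of ?Q w "select2 i j True True" ?f s] fin by simp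
  qed
  ultimately have "line_contract w ?Q s {} * (s ^ card ?Q * (w I - pminor I A)) = 0" for s
  proof -
    assume a: "\<And>s. det2 (\<lambda>a c. line_contract w ?Q s (select2 i j a c)) = 0" "\<And>s. det2 (\<lambda>a c. line_contract ?f ?Q s (select2 i j a c)) = 0"
      and eq: "\<And>a c s. \<not> (a \<and> c) \<Longrightarrow> line_contract w ?Q s (select2 i j a c) = line_contract ?f ?Q s (select2 i j a c)"
      and top: "\<And>s. line_contract w ?Q s (select2 i j True True) - line_contract ?f ?Q s (select2 i j True True) = s ^ card ?Q * (w I - pminor I A)"
    have "select2 i j False False = {}" by (simp add: select2_def)
    then have "line_contract w ?Q s {} * (s ^ card ?Q * (w I - pminor I A)) =
       det2 (\<lambda>a c. line_contract w ?Q s (select2 i j a c)) - det2 (\<lambda>a c. line_contract ?f ?Q s (select2 i j a c))"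
      unfolding top[symmetric] det2_def using eq[of False False s] eq[of False True s] eq[of True False s]
      by (simp add: algebra_simps)
    then show ?thesis by (simp add: a)
  qed
  then have *: "(s ^ card ?Q * (w I - pminor I A)) * line_contract w ?Q s {} = 0" for s
    by (simp add: mult.commute)
  have "1 ^ card ?Q * (w I - pminor I A) = 0"
    by (rule polyfun_no_zero_divisors[where g = "\<lambda>s. line_contract w ?Q s {}" and b = 0])
      (use fin * in \<open>auto simp: line_contract_at_0 w_empty intro!: polyfun_intros line_contract_polyfun\<close>)
  then show ?thesis by simp
qed

lemma w_eq_minor_2:
  assumes "i < n" "j < n" "i \<noteq> j"
  shows "w {i, j} = pminor {i, j} A"
  using A_squared[OF assms] A_sym[of i j] assms
  by (simp add: pminor_2 \<beta>_def A_def[of i i] A_def[of j j] power2_eq_square)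

lemma w_eq_minor_3:
  assumes d: "distinct3 n i j k" and nz: "\<beta> i j \<noteq> 0" "\<beta> i k \<noteq> 0" "\<beta> j k \<noteq> 0"
  shows "w {i, j, k} = pminor {i, j, k} A"
proof -
  have lt: "i < n" "j < n" "k < n" "i \<noteq> j" "i \<noteq> k" "j \<noteq> k" using d by (auto simp: distinct3_def)
  have s: "A j i = A i j" "A k i = A i k" "A k j = A j k" using A_sym by auto
  have diag: "A i i = w {i}" "A j j = w {j}" "A k k = w {k}" using lt by (simp_all add: A_def)
  have sq: "A i j * A i j = \<beta> i j" "A i k * A i k = \<beta> i k" "A j k * A j k = \<beta> j k"
    using A_squared lt by (simp_all add: power2_eq_square)
  have "2 * A i j * A i k * A j k = \<tau> i j k" by (rule A_triangle[OF assms])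
  then have t: "A i j * A i k * A j k = \<tau> i j k / 2" by (simp add: algebra_simps)
  have "pminor {i, j, k} A = w {i} * w {j} * w {k} + 2 * (A i j * A i k * A j k)
      - (A i j * A i j) * w {k} - (A i k * A i k) * w {j} - (A j k * A j k) * w {i}"
    unfolding pminor_3[OF lt(4-6)] s diag by (simp add: algebra_simps)
  also have "\<dots> = w {i, j, k}"
    unfolding t sq \<beta>_def \<tau>_def by (simp add: field_simps)
  finally show ?thesis by simp
qed

text \<open>Three indices of one class. Along the line in the remaining positions both
  hyperdeterminants vanish and the faces agree, so the two cumulants have equal squares; at
  \<open>s = 0\<close> both are \<open>\<tau> i j k\<close>, which is nonzero and fixes the sign.
  The cumulant is linear in the top entry, so this entry agrees as well.\<close>

lemma w_eq_minor_block:
  assumes I: "I \<subseteq> {..<n}" and d: "distinct3 n i j k" and ijk: "i \<in> I" "j \<in> I" "k \<in> I"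
    and nz: "\<beta> i j \<noteq> 0" "\<beta> i k \<noteq> 0" "\<beta> j k \<noteq> 0"
    and IH: "\<And>J. J \<subset> I \<Longrightarrow> w J = pminor J A"
  shows "w I = pminor I A"
proof -
  let ?Q = "I - {i, j, k}" and ?f = "\<lambda>I. pminor I A"
  define W where "W s x y z = line_contract w ?Q s (select3 i j k x y z)" for s x y z
  define V where "V s x y z = line_contract ?f ?Q s (select3 i j k x y z)" for s x y z
  have lt: "i < n" "j < n" "k < n" "i \<noteq> j" "i \<noteq> k" "j \<noteq> k" using d by (auto simp: distinct3_def)
  have fin: "finite I" using I finite_subset by blast
  have hW: "cayley (W s) = 0" for s
    unfolding W_def by (rule slice_hyperdet_line_contract[OF d]) (use I in auto)
  have hV: "cayley (V s) = 0" for s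
    unfolding V_def line_contract_def by (rule hyp_minors) (use fin lt A_sym in auto)
  have eq: "W s x y z = V s x y z" if "\<not> (x \<and> y \<and> z)" for s x y z
    unfolding W_def V_def
    by (rule line_contract_cong, rule IH) (use that ijk lt in \<open>auto simp: select3_def\<close>)
  have top: "W s True True True - V s True True True = s ^ card ?Q * (w I - pminor I A)" for s
  proof -
    have "?Q \<union> select3 i j k True True True = I" using ijk by (auto simp: select3_def)
    moreover have "w (J \<union> select3 i j k True True True) = pminor (J \<union> select3 i j k True True True) A" if "J \<subset> ?Q" for J
      by (rule IH) (use that ijk in \<open>auto simp: select3_def\<close>)
    ultimately show ?thesis unfolding W_def V_def
      using line_contract_diff[of ?Q w "select3 i j k True True True" ?f s] fin by simp
  qed
  have diff: "cumulant (W s) - cumulant (V s) = W s False False False ^ 2 * (s ^ card ?Q * (w I - pminor I A))" for s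
    unfolding top[symmetric] cumulant_def by (simp add: eq algebra_simps)
  have kdeq: "det2 (\<lambda>a b. W s a b False) = det2 (\<lambda>a b. V s a b False)"
    "det2 (\<lambda>a b. W s a False b) = det2 (\<lambda>a b. V s a False b)"
    "det2 (\<lambda>a b. W s False a b) = det2 (\<lambda>a b. V s False a b)" for s
    by (simp_all add: det2_def eq)
  have "cumulant (W s) ^ 2 = cumulant (V s) ^ 2" for s
    using cayley_cumulant[of "W s"] cayley_cumulant[of "V s"] unfolding hW hV kdeq
    by (metis add_right_cancel mult_zero_right)
  then have prod: "(cumulant (W s) - cumulant (V s)) * (cumulant (W s) + cumulant (V s)) = 0" for s
    by (simp add: power2_eq_square algebra_simps)
  have W0: "W 0 x y z = w (select3 i j k x y z)" for x y z
    unfolding W_def using fin by (simp add: line_contract_at_0)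
  \<comment> \<open>The entry with all three bits needs \<open>w_eq_minor_3\<close>: the induction
    hypothesis does not reach \<open>{i, j, k}\<close> when this is all of \<open>I\<close>.\<close>
  have V0: "V 0 x y z = w (select3 i j k x y z)" for x y z
  proof (cases "x \<and> y \<and> z")
    case True
    then have "select3 i j k x y z = {i, j, k}" by (auto simp: select3_def)
    then show ?thesis unfolding V_def using fin w_eq_minor_3[OF d nz] by (simp add: line_contract_at_0)
  qed (use eq W0 in metis)
  have "cumulant (W 0) = \<tau> i j k" "cumulant (V 0) = \<tau> i j k"
    by (simp_all add: cumulant_def \<tau>_def W0 V0 select3_def w_empty insert_commute algebra_simps)
  moreover have "\<tau> i j k \<noteq> 0" using \<tau>_squared[OF d] nz by auto
  ultimately have nz0: "cumulant (W 0) + cumulant (V 0) \<noteq> 0" by simp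
  have poly: "polyfun (\<lambda>s. cumulant (W s))" "polyfun (\<lambda>s. cumulant (V s))"
    unfolding cumulant_def W_def V_def by (intro polyfun_intros line_contract_polyfun)+
  have "cumulant (W s) - cumulant (V s) = 0" for s
    by (rule polyfun_no_zero_divisors[OF polyfun_diff[OF poly] polyfun_add[OF poly] prod nz0])
  then have *: "(s ^ card ?Q * (w I - pminor I A)) * W s False False False ^ 2 = 0" for s
    unfolding diff by (simp add: mult.commute)
  have "1 ^ card ?Q * (w I - pminor I A) = 0"
  proof (rule polyfun_no_zero_divisors[where f = "\<lambda>s. s ^ card ?Q * (w I - pminor I A)" and g = "\<lambda>s. W s False False False ^ 2" and b = 0])
    show "polyfun (\<lambda>s. W s False False False ^ 2)" unfolding W_def by (intro polyfun_intros line_contract_polyfun)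
    show "W 0 False False False ^ 2 \<noteq> 0" by (simp add: W0 select3_def w_empty)
    show "s ^ card ?Q * (w I - pminor I A) * W s False False False ^ 2 = 0" for s by (rule *)
  qed (intro polyfun_intros)
  then show ?thesis by simp
qed

text \<open>Among three indices, either all three \<open>\<beta>\<close> are nonzero or some pair is
  separated. Sets with at most two elements agree by the choice of the diagonal and by
  \<open>A_squared\<close>.\<close>

lemma w_eq_minor: "I \<subseteq> {..<n} \<Longrightarrow> w I = pminor I A"
proof (induction "card I" arbitrary: I rule: less_induct)
  case less
  have fin: "finite I" using less.prems finite_subset by blast
  have IH: "w J = pminor J A" if "J \<subset> I" for J
    by (rule less.hyps) (use that less.prems fin psubset_card_mono in auto)
  consider "I = {}" | i where "I = {i}" | i j where "I = {i, j}" "i \<noteq> j"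
    | i j k where "i \<in> I" "j \<in> I" "k \<in> I" "i \<noteq> j" "i \<noteq> k" "j \<noteq> k"
  proof (cases "\<exists>i j k. i \<in> I \<and> j \<in> I \<and> k \<in> I \<and> i \<noteq> j \<and> i \<noteq> k \<and> j \<noteq> k")
    case True
    then show ?thesis using that(4) by blast
  next
    case no3: False
    show ?thesis
    proof (cases "\<exists>i j. i \<in> I \<and> j \<in> I \<and> i \<noteq> j")
      case True
      then obtain i j where "i \<in> I" "j \<in> I" "i \<noteq> j" by blast
      then show ?thesis using that(3)[of i j] no3 by blast
    next
      case False
      then show ?thesis using that(1,2) by (cases "I = {}") blast+
    qed
  qed
  then show ?case
  proof cases
    case 1
    then show ?thesis by (simp add: w_empty)
  next
    case 2
    then show ?thesis using less.prems by (simp add: pminor_1 A_def)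
  next
    case 3
    then show ?thesis using less.prems w_eq_minor_2 by simp
  next
    case 4
    then have "distinct3 n i j k" using less.prems by (auto simp: distinct3_def)
    then show ?thesis
      using w_eq_minor_block[OF less.prems _ 4(1-3) _ _ _ IH]
        w_eq_minor_cross[OF less.prems 4(1,2,4) _ IH] w_eq_minor_cross[OF less.prems 4(1,3,5) _ IH]
        w_eq_minor_cross[OF less.prems 4(2,3,6) _ IH] by blast
  qed
qed

end

section \<open>Equality of the two varieties\<close>

definition line_poly :: "((nat \<Rightarrow> complex) \<Rightarrow> complex) \<Rightarrow> bool" where
  "line_poly f \<longleftrightarrow> (\<forall>x y. polyfun (\<lambda>s. f (\<lambda>p. x p + s * y p)))"

text \<open>On the line from a point where the old functions are nonzero to a point where the new
  one is, each function has finitely many zeros.\<close>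

lemma common_nonzero:
  assumes "finite F" "\<And>f. f \<in> F \<Longrightarrow> line_poly f" "\<And>f. f \<in> F \<Longrightarrow> \<exists>x. f x \<noteq> 0"
  shows "\<exists>x. \<forall>f\<in>F. f x \<noteq> 0"
  using assms
proof (induction F rule: finite_induct)
  case (insert g F)
  then obtain x y where x: "\<And>f. f \<in> F \<Longrightarrow> f x \<noteq> 0" and y: "g y \<noteq> 0" by (metis insert_iff)
  define l where "l s = (\<lambda>p. x p + s * (y p - x p))" for s
  have poly: "polyfun (\<lambda>s. f (l s))" if "f \<in> insert g F" for f
    unfolding l_def
    using insert.prems(1)[OF that, unfolded line_poly_def, rule_format, of x "\<lambda>p. y p - x p"] .
  have l: "l 0 = x" "l 1 = y" by (auto simp: l_def)
  have "finite {s. f (l s) = 0}" if "f \<in> F" for f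
    using polyfun_finite_zeros[of "\<lambda>s. f (l s)" 0] poly x that by (simp add: l)
  moreover have "finite {s. g (l s) = 0}"
    using polyfun_finite_zeros[of "\<lambda>s. g (l s)" 1] poly y by (simp add: l)
  ultimately have "finite ((\<Union>f\<in>F. {s. f (l s) = 0}) \<union> {s. g (l s) = 0})"
    using insert.hyps by blast
  then obtain s where "s \<notin> (\<Union>f\<in>F. {s. f (l s) = 0}) \<union> {s. g (l s) = 0}"
    using ex_new_if_finite[OF infinite_UNIV_char_0] by blast
  then show ?case by (intro exI[of _ "l s"]) auto
qed simp

lemma contract_polyfun:
  assumes "\<And>p b. p \<in> Q \<Longrightarrow> polyfun (\<lambda>s. r s p b)"
  shows "polyfun (\<lambda>s. contract Q z (r s) L)"
  unfolding contract_def by (intro polyfun_intros assms)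

lemma polyfun_affine_row: "polyfun (\<lambda>s. affine_row (\<lambda>p. x p + s * y p) p b)"
  by (cases b) (auto intro!: polyfun_intros)

lemma line_poly_contract_all: "line_poly (\<lambda>x. contract_all n z (affine_row x))"
  unfolding line_poly_def by (intro allI contract_polyfun polyfun_affine_row)

lemma line_poly_slice_det: "line_poly (\<lambda>x. slice_det n i j (affine_row x) z)"
  unfolding line_poly_def
proof (intro allI)
  fix x y
  have upd: "polyfun (\<lambda>s. ((affine_row (\<lambda>p. x p + s * y p))(i := u, j := v)) p b)" for p b u v
    by (cases "p = j"; cases "p = i") (simp_all add: polyfun_affine_row polyfun_const)
  then show "polyfun (\<lambda>s. slice_det n i j (affine_row (\<lambda>p. x p + s * y p)) z)"
    unfolding slice_det_def det2_def by (intro polyfun_intros contract_polyfun)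
qed

text \<open>Covectors with first coordinate 1 separate tensors: the second coordinates 0 and 1 in
  position \<open>m\<close> already isolate the two halves of the tensor.\<close>

lemma contract_affine_row_eq_0:
  assumes "finite Q" "\<And>x. contract Q z (affine_row x) L = 0" "J \<subseteq> Q"
  shows "z (J \<union> L) = 0"
  using assms
proof (induction Q arbitrary: J L rule: finite_induct)
  case empty
  then show ?case by simp
next
  case (insert m Q)
  have cong: "contract Q z (affine_row (x(m := v))) L' = contract Q z (affine_row x) L'" for x v L'
    by (rule contract_cong) (use insert.hyps in \<open>auto simp: affine_row_def fun_eq_iff\<close>)
  have *: "contract Q z (affine_row x) L + v * contract Q z (affine_row x) (insert m L) = 0" for x v
    using insert.prems(1)[of "x(m := v)"] unfolding contract_insert[OF insert.hyps] cong by simp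
  have 1: "contract Q z (affine_row x) L = 0" and 2: "contract Q z (affine_row x) (insert m L) = 0" for x
    using *[of x 0] *[of x 1] by simp_all
  show ?case
  proof (cases "m \<in> J")
    case True
    have "z ((J - {m}) \<union> insert m L) = 0" by (rule insert.IH) (use 2 insert.prems in auto)
    moreover have "(J - {m}) \<union> insert m L = J \<union> L" using True by auto
    ultimately show ?thesis by simp
  next
    case False
    then show ?thesis using insert.IH[OF 1] insert.prems by blast
  qed
qed

lemma contract_select:
  assumes "finite D" "finite Q" "D \<inter> Q = {}" "\<And>p. p \<in> D \<Longrightarrow> r p = bvec True"
  shows "contract (D \<union> Q) z r L = contract Q z r (D \<union> L)"
  using assms
proof (induction D arbitrary: L rule: finite_induct)
  case (insert m D)
  have "contract (insert m (D \<union> Q)) z r L = contract (D \<union> Q) z r (insert m L)"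
    by (subst contract_insert) (use insert in auto)
  with insert show ?case by simp
qed simp

text \<open>How unipotent upper triangular matrices act on covectors. On affine covectors this is
  translation by \<open>c\<close>, which brings a chosen generic point to the origin.\<close>

definition shear :: "(nat \<Rightarrow> complex) \<Rightarrow> (nat \<Rightarrow> bool \<Rightarrow> complex) \<Rightarrow> nat \<Rightarrow> bool \<Rightarrow> complex" where
  "shear c r p b = (if b then c p * r p False + r p True else r p False)"

definition shear_mat :: "nat \<Rightarrow> (nat \<Rightarrow> complex) \<Rightarrow> nat \<Rightarrow> complex mat" where
  "shear_mat n c = restrict (\<lambda>p. mat 2 2 (\<lambda>(i, j). if i = j then 1 else if i = 0 then c p else 0)) {..<n}"

lemma shear_mat_carrier: "(shear_mat n c, id) \<in> carrier (SL2_sym n)"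
proof -
  have "det (mat 2 2 (\<lambda>(i, j). if i = j then 1 else if i = 0 then c p else 0)) = 1" for p
    by (subst det_mat_2x2) auto
  then show ?thesis
    by (auto simp: carrier_SL2_sym shear_mat_def permutes_id)
qed

lemma vec_act_shear_mat: "p < n \<Longrightarrow> vec_act r (shear_mat n c) p = shear c r p"
  by (auto simp: vec_act_def shear_mat_def shear_def fun_eq_iff)

lemma contract_all_shear: "contract_all n (tensor_act n (shear_mat n c, id) z) r = contract_all n z (shear c r)"
proof -
  have "contract_all n z (vec_act r (shear_mat n c)) = contract_all n z (shear c r)"
    by (rule contract_cong) (simp_all add: vec_act_shear_mat)
  then show ?thesis by (simp add: contract_all_tensor_act[OF permutes_id])
qed

lemma shear_affine_row: "shear c (affine_row x) = affine_row (\<lambda>p. c p + x p)"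
  by (auto simp: shear_def affine_row_def fun_eq_iff)

lemma unit_eq_affine_row: "(\<lambda>_. bvec False) = affine_row (\<lambda>_. 0)"
  by (auto simp: affine_row_def fun_eq_iff)

lemma slice_det_shear:
  assumes "i < n" "j < n" "i \<noteq> j"
  shows "slice_det n i j r (tensor_act n (shear_mat n c, id) z) = slice_det n i j (shear c r) z"
proof -
  let ?X = "\<lambda>i a b. if b then c i * of_bool (\<not> a) + of_bool a else of_bool (\<not> a) :: complex"
  have "shear c (r(i := bvec a, j := bvec b)) = (shear c r)(i := ?X i a, j := ?X j b)" for a b
    using assms by (auto simp: shear_def fun_eq_iff)
  then have "slice_det n i j r (tensor_act n (shear_mat n c, id) z) = slice_det_rows n i j (?X i) (?X j) (shear c r) z"
    by (simp add: slice_det_def slice_det_rows_def contract_all_shear)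
  also have "\<dots> = slice_det n i j (shear c r) z"
    unfolding slice_det_rows_eq[OF assms] by (simp add: det2_def)
  finally show ?thesis .
qed

lemma slice_hyperdet_scale: "slice_hyperdet n i j k r (\<lambda>I. x * z I) = x ^ 4 * slice_hyperdet n i j k r z"
  unfolding slice_hyperdet_def contract_scale cayley_scale ..

lemma slice_det_scale: "slice_det n i j r (\<lambda>I. x * z I) = x ^ 2 * slice_det n i j r z"
  unfolding slice_det_def contract_scale by (simp add: det2_def power2_eq_square algebra_simps)

text \<open>The translation \<open>c\<close> is chosen where the full contraction and each slice
  determinant that is not identically zero are nonzero. The translated and rescaled tensor satisfies
  \<open>normalized\<close>, hence consists of minors; translating back by \<open>- c\<close> yields
  the contraction in the conclusion.\<close>

lemma HD_point_is_sheared_minors: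
  assumes z: "z \<in> tensors {..<n}" "z \<noteq> 0"
    and slice_hyperdet_z: "\<And>i j k r. distinct3 n i j k \<Longrightarrow> slice_hyperdet n i j k r z = 0"
  obtains c y A where "\<And>i j. A i j = A j i"
    "\<And>I. I \<subseteq> {..<n} \<Longrightarrow> z I = y * contract ({..<n} - I) (\<lambda>I. pminor I A) (affine_row c) I"
proof -
  let ?E = "{(i, j). i < n \<and> j < n \<and> (\<exists>x. slice_det n i j (affine_row x) z \<noteq> 0)}"
  let ?F = "insert (\<lambda>x. contract_all n z (affine_row x)) ((\<lambda>(i, j) x. slice_det n i j (affine_row x) z) ` ?E)"
  have "?E \<subseteq> {..<n} \<times> {..<n}" by auto
  then have "finite ?E" by (rule finite_subset) simp
  then have "finite ?F" by simp
  moreover have "\<exists>x. contract_all n z (affine_row x) \<noteq> 0"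
  proof (rule ccontr)
    assume "\<not> ?thesis"
    then have "z I = 0" if "I \<subseteq> {..<n}" for I
      using contract_affine_row_eq_0[of "{..<n}" z "{}" I] that by simp
    then have "z = 0" using z(1) by (auto simp: tensors_def fun_eq_iff)
    then show False using z(2) by simp
  qed
  ultimately have "\<exists>c. \<forall>f\<in>?F. f c \<noteq> 0"
    by (intro common_nonzero) (auto simp: line_poly_contract_all line_poly_slice_det)
  then obtain c where c0: "contract_all n z (affine_row c) \<noteq> 0"
    and cK: "\<And>i j x. i < n \<Longrightarrow> j < n \<Longrightarrow> slice_det n i j (affine_row x) z \<noteq> 0 \<Longrightarrow> slice_det n i j (affine_row c) z \<noteq> 0"
    by auto
  define y where "y = tensor_act n (shear_mat n c, id) z"
  have contract_all_y: "contract_all n y r = contract_all n z (shear c r)" for r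
    by (simp add: y_def contract_all_shear)
  have y_eq: "y I = contract_all n y (\<lambda>p. bvec (p \<in> I))" if "I \<subseteq> {..<n}" for I
    using contract_unit_vectors[of "{..<n}" I y] that by simp
  have "(\<lambda>p. bvec (p \<in> {})) = affine_row (\<lambda>_. 0)"
    by (auto simp: affine_row_def fun_eq_iff)
  then have "y {} = contract_all n z (shear c (affine_row (\<lambda>_. 0)))"
    using y_eq[of "{}"] by (simp only: contract_all_y empty_subsetI)
  then have y0: "y {} \<noteq> 0"
    using c0 by (simp add: shear_affine_row)
  define w where "w = (\<lambda>I. (1 / y {}) * y I)"
  interpret normalized n w
  proof
    show "w {} = 1" using y0 by (simp add: w_def)
    show "slice_hyperdet n i j k r w = 0" if "distinct3 n i j k" for i j k r
    proof -
      have "slice_hyperdet n i j k r y = 0"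
        unfolding y_def using that slice_hyperdet_tensor_act[OF shear_mat_carrier] slice_hyperdet_z[OF that]
        by (simp add: distinct3_def)
      then show ?thesis unfolding w_def slice_hyperdet_scale by simp
    qed
    show "slice_det n i j (affine_row x) w = 0" if "i < n" "j < n" "i \<noteq> j" "slice_det n i j (\<lambda>_. bvec False) w = 0" for i j x
    proof -
      have "slice_det n i j (\<lambda>_. bvec False) y = 0" using that(4) y0 unfolding w_def slice_det_scale by simp
      then have "slice_det n i j (affine_row c) z = 0"
        using that(1-3) unfolding y_def unit_eq_affine_row by (simp add: slice_det_shear shear_affine_row)
      then have "slice_det n i j (affine_row x') z = 0" for x' using cK that by blast
      then show ?thesis using that(1-3) unfolding w_def slice_det_scale y_def by (simp add: slice_det_shear shear_affine_row)
    qed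
  qed
  show ?thesis
  proof (rule that[where A = A and y = "y {}" and c = "\<lambda>p. - c p"])
    show "A i j = A j i" for i j by (rule A_sym)
    fix I assume I: "I \<subseteq> {..<n}"
    \<comment> \<open>The covectors that the shear by \<open>c\<close> carries to the unit covectors
      selecting the coordinate \<open>I\<close>.\<close>
    let ?r = "\<lambda>p. if p \<in> I then bvec True else affine_row (\<lambda>p. - c p) p"
    have "shear c ?r = (\<lambda>p. bvec (p \<in> I))"
      by (auto simp: shear_def fun_eq_iff)
    then have "z I = contract_all n y ?r"
      using contract_unit_vectors[of "{..<n}" I z] I by (simp add: contract_all_y)
    also have "\<dots> = contract_all n (\<lambda>I. y {} * pminor I A) ?r"
    proof (rule contract_cong[OF refl])
      fix J assume "J \<subseteq> {..<n}"
      then show "y (J \<union> {}) = y {} * pminor (J \<union> {}) A"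
        using w_eq_minor[of J] y0 by (simp add: w_def field_simps)
    qed
    also have "\<dots> = y {} * contract (I \<union> ({..<n} - I)) (\<lambda>I. pminor I A) ?r {}"
      using I by (simp add: contract_scale Un_absorb1)
    also have "contract (I \<union> ({..<n} - I)) (\<lambda>I. pminor I A) ?r {} = contract ({..<n} - I) (\<lambda>I. pminor I A) ?r (I \<union> {})"
      by (rule contract_select) (use I finite_subset in auto)
    also have "\<dots> = contract ({..<n} - I) (\<lambda>I. pminor I A) (affine_row (\<lambda>p. - c p)) I"
      by (rule contract_cong) auto
    finally show "z I = y {} * contract ({..<n} - I) (\<lambda>I. pminor I A) (affine_row (\<lambda>p. - c p)) I" .
  qed
qed

text \<open>With \<open>pminor_shear_in\<close>: a shear in position \<open>m\<close> sends the
  minors of \<open>A\<close> to one common multiple of the minors of A - c A e e^T A / (1 + c A_mm),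
  where e is the unit vector at \<open>m\<close>. For invertible \<open>A\<close>, by the
  Sherman-Morrison formula, this matrix is (A^-1 + c e e^T)^-1.\<close>

lemma pminor_shear_notin:
  assumes "finite K" "m \<notin> K" "1 + c * A m m \<noteq> 0"
  shows "pminor K A + c * pminor (insert m K) A
    = (1 + c * A m m) * pminor K (\<lambda>i j. A i j - c * A i m * A m j / (1 + c * A m m))"
proof (cases "c = 0")
  case False
  have d: "A m m + 1 / c = (1 + c * A m m) / c" using False by (simp add: field_simps)
  with False assms have "A m m + 1 / c \<noteq> 0" by simp
  from pminor_lincomb[where s = 1 and A = A, OF assms(1,2) False this] show ?thesis
    unfolding d using False by (simp add: mult_ac)
qed simp

text \<open>Both minors are pivoted at \<open>m\<close>: the two matrices have the same Schur
  complement there, and their pivots differ by the factor \<open>1 + c * A m m\<close>.\<close>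

lemma pminor_shear_in:
  assumes "finite K" "m \<notin> K" "1 + c * A m m \<noteq> 0" "A m m \<noteq> 0"
  shows "pminor (insert m K) A
    = (1 + c * A m m) * pminor (insert m K) (\<lambda>i j. A i j - c * A i m * A m j / (1 + c * A m m))"
proof -
  let ?\<delta> = "1 + c * A m m"
  let ?B = "\<lambda>i j. A i j - c * A i m * A m j / ?\<delta>"
  have col: "?B i m = A i m / ?\<delta>" "?B m i = A m i / ?\<delta>" for i
    using assms(3) by (simp_all add: field_simps)
  have "?B i j - ?B i m * ?B m j / ?B m m = A i j - A i m * A m j / A m m" for i j
  proof -
    have "?B i m * ?B m j / ?B m m = A i m * A m j / (?\<delta> * A m m)"
      unfolding col using assms(3,4) by simp
    moreover have "c * A i m * A m j / ?\<delta> + A i m * A m j / (?\<delta> * A m m) = A i m * A m j / A m m"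
      using assms(3,4) by (simp add: divide_simps) (simp add: algebra_simps)
    ultimately show ?thesis by (simp add: algebra_simps)
  qed
  moreover have "?B m m \<noteq> 0" unfolding col using assms(3,4) by simp
  ultimately have "pminor (insert m K) ?B = ?B m m * pminor K (\<lambda>i j. A i j - A i m * A m j / A m m)"
    using pminor_pivot[OF assms(1,2), of ?B] by presburger
  also have "?B m m = A m m / ?\<delta>" by (rule col)
  finally show ?thesis using pminor_pivot[OF assms(1,2), of A] assms(3,4) by simp
qed

lemma sym_power_cong:
  assumes "f \<in> sym_power n d" "\<And>I. I \<subseteq> {..<n} \<Longrightarrow> z I = z' I"
  shows "f z = f z'"
  using assms(1)[unfolded sym_power_def]
proof (induction rule: cfun.span_induct_alt)
  case (step b x y)
  then obtain Is where Is: "x = (\<lambda>z. prod_list (map z Is))" "set Is \<subseteq> Pow {..<n}" by blast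
  then have "map z Is = map z' Is" using assms(2) by (intro map_cong) auto
  then have "x z = x z'" unfolding Is(1) by (simp only:)
  with step(2) show ?case by (simp add: fscale_def)
qed simp

text \<open>Stands in for the invariance of \<open>Z_variety\<close> under shears. One position at a
  time, \<open>A\<close> is exchanged for the sheared matrix; shifting the diagonal entry at
  \<open>m\<close> by \<open>s\<close> makes the denominators nonzero for all but at most two values
  of \<open>s\<close>, and polynomiality in \<open>s\<close> recovers \<open>s = 0\<close>.\<close>

lemma vanish_sheared:
  assumes q: "q \<in> sym_power n d"
    and q0: "\<And>A. (\<And>i j. A i j = A j i) \<Longrightarrow> q (\<lambda>I. pminor I A) = 0"
    and "finite Q" "\<And>i j. A i j = A j i"
  shows "q (\<lambda>I. contract (Q - I) (\<lambda>I. pminor I A) (affine_row c) I) = 0"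
  using assms(3,4)
proof (induction Q arbitrary: A rule: finite_induct)
  case empty
  then show ?case using q0 by simp
next
  case (insert m Q)
  define As where "As s = (\<lambda>i j. if i = m \<and> j = m then A i j + s else A i j)" for s
  have sym: "As s i j = As s j i" for s i j using insert.prems[of i j] by (auto simp: As_def)
  define Z where "Z s = (\<lambda>I. contract (insert m Q - I) (\<lambda>I. pminor I (As s)) (affine_row c) I)" for s
  \<comment> \<open>The values where \<open>1 + c m * As s m m\<close> or \<open>As s m m\<close>
    vanishes. For \<open>c m = 0\<close> the first never does, and \<open>- 1 / c m\<close> is 0 by
    convention.\<close>
  let ?S = "{- 1 / c m - A m m, - A m m}"
  have poly: "polyfun (\<lambda>s. q (Z s))"
  proof (rule sym_power_polyfun[OF q])
    fix I :: "nat set" assume "I \<subseteq> {..<n}"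
    then have fin: "finite I" using finite_subset by blast
    have "polyfun (\<lambda>s. pminor K (As s))" if "finite K" for K
    proof (cases "m \<in> K")
      case True
      then have K: "K = insert m (K - {m})" by auto
      have "pminor K (As s) = pminor K A + s * pminor (K - {m}) A" for s
        using pminor_add_diag[of "K - {m}" m A s] that K by (simp add: As_def)
      then show ?thesis by (auto intro!: polyfun_intros)
    next
      case False
      then have "pminor K (As s) = pminor K A" for s by (intro pminor_cong) (auto simp: As_def)
      then show ?thesis by (simp add: polyfun_const)
    qed
    then have "polyfun (\<lambda>s. pminor (J \<union> I) (As s))" if "J \<in> Pow (insert m Q - I)" for J
    proof -
      have "finite J" using that insert.hyps(1) finite_subset[of J "insert m Q"] by auto
      with fin show ?thesis by (intro \<open>\<And>K. finite K \<Longrightarrow> polyfun (\<lambda>s. pminor K (As s))\<close>) simp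
    qed
    then show "polyfun (\<lambda>s. Z s I)"
      unfolding Z_def contract_def by (intro polyfun_sum polyfun_mult polyfun_const)
  qed
  have "q (Z s) = 0" if "s \<notin> ?S" for s
  proof -
    let ?\<delta> = "1 + c m * As s m m"
    let ?B = "\<lambda>i j. As s i j - c m * As s i m * As s m j / ?\<delta>"
    have \<delta>: "?\<delta> \<noteq> 0"
    proof
      assume "?\<delta> = 0"
      then have "c m \<noteq> 0" and "c m * (A m m + s) = - 1" by (auto simp: As_def add_eq_0_iff)
      then have "s = - 1 / c m - A m m" by (simp add: field_simps)
      with that show False by simp
    qed
    have nz: "As s m m \<noteq> 0" using that by (auto simp: As_def add_eq_0_iff)
    have notin: "pminor K (As s) + c m * pminor (insert m K) (As s) = ?\<delta> * pminor K ?B" if "finite K" "m \<notin> K" for K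
      by (rule pminor_shear_notin[where A = "As s", OF that \<delta>])
    have isin: "pminor (insert m K) (As s) = ?\<delta> * pminor (insert m K) ?B" if "finite K" "m \<notin> K" for K
      by (rule pminor_shear_in[where A = "As s", OF that \<delta> nz])
    have "Z s I = fscale ?\<delta> (\<lambda>I. contract (Q - I) (\<lambda>I. pminor I ?B) (affine_row c) I) I" if "I \<subseteq> {..<n}" for I
    proof -
      have fin: "finite I" "finite (Q - I)" using that finite_subset insert.hyps by auto
      show ?thesis
      proof (cases "m \<in> I")
        case True
        have "contract (Q - I) (\<lambda>I. pminor I (As s)) (affine_row c) I = contract (Q - I) (\<lambda>I. ?\<delta> * pminor I ?B) (affine_row c) I"
        proof (rule contract_cong[OF refl])
          fix J assume "J \<subseteq> Q - I"
          then have "finite (J \<union> I - {m})" "J \<union> I = insert m (J \<union> I - {m})"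
            using fin True finite_subset by auto
          then show "pminor (J \<union> I) (As s) = ?\<delta> * pminor (J \<union> I) ?B"
            using isin[of "J \<union> I - {m}"] by simp
        qed
        then show ?thesis using True by (simp add: Z_def fscale_def contract_scale)
      next
        case False
        have "insert m Q - I = insert m (Q - I)" using False by auto
        then have "Z s I = contract (Q - I) (\<lambda>I. pminor I (As s)) (affine_row c) I
            + c m * contract (Q - I) (\<lambda>I. pminor I (As s)) (affine_row c) (insert m I)"
          using fin insert.hyps by (simp add: Z_def contract_insert)
        also have "contract (Q - I) (\<lambda>I. pminor I (As s)) (affine_row c) (insert m I) = contract (Q - I) (\<lambda>I. pminor (insert m I) (As s)) (affine_row c) I"
          by (rule contract_cong) auto
        also have "contract (Q - I) (\<lambda>I. pminor I (As s)) (affine_row c) I + c m * contract (Q - I) (\<lambda>I. pminor (insert m I) (As s)) (affine_row c) I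
           = contract (Q - I) (\<lambda>I. 1 * pminor I (As s) + c m * pminor (insert m I) (As s)) (affine_row c) I"
          unfolding contract_lincomb by simp
        also have "\<dots> = contract (Q - I) (\<lambda>I. ?\<delta> * pminor I ?B) (affine_row c) I"
        proof (rule contract_cong[OF refl])
          fix J assume "J \<subseteq> Q - I"
          then have "finite (J \<union> I)" "m \<notin> J \<union> I"
            using fin False insert.hyps finite_subset by auto
          then show "1 * pminor (J \<union> I) (As s) + c m * pminor (insert m (J \<union> I)) (As s) = ?\<delta> * pminor (J \<union> I) ?B"
            using notin[of "J \<union> I"] by simp
        qed
        finally show ?thesis by (simp add: fscale_def contract_scale)
      qed
    qed
    then have "q (Z s) = q (fscale ?\<delta> (\<lambda>I. contract (Q - I) (\<lambda>I. pminor I ?B) (affine_row c) I))"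
      by (rule sym_power_cong[OF q])
    also have "\<dots> = ?\<delta> ^ d * q (\<lambda>I. contract (Q - I) (\<lambda>I. pminor I ?B) (affine_row c) I)"
      by (rule sym_power_homogeneous[OF q])
    also have "q (\<lambda>I. contract (Q - I) (\<lambda>I. pminor I ?B) (affine_row c) I) = 0"
    proof (rule insert.IH)
      show "?B i j = ?B j i" for i j using sym[of s i j] sym[of s i m] sym[of s m j] by simp
    qed
    finally show ?thesis by simp
  qed
  then have "q (Z 0) = 0"
    using polyfun_eq_zero[OF poly, of ?S 0] by blast
  moreover have "As 0 = A" by (auto simp: As_def fun_eq_iff)
  ultimately show ?case by (simp add: Z_def)
qed

text \<open>The closure is tested one polynomial at a time: a polynomial that vanishes on the
  tensors of minors vanishes, by \<open>vanish_sheared\<close> and homogeneity, at every zero of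
  \<open>HD n\<close>.\<close>

lemma zero_locus_subset_Z_variety:
  assumes "n \<ge> 3"
  shows "zero_locus n (HD n) \<subseteq> Z_variety n"
proof
  fix p assume p: "p \<in> zero_locus n (HD n)"
  then have proj: "p \<in> proj_space n" by (simp add: zero_locus_def)
  then obtain z0 where z0: "z0 \<in> tensors {..<n}" "z0 \<noteq> 0" "p = proj_point z0"
    by (auto simp: proj_space_def)
  show "p \<in> Z_variety n"
    unfolding Z_variety_def zariski_closure_def minor_points_def[symmetric]
  proof (intro InterI, elim CollectE conjE)
    fix X assume "zariski_closed n X" and sub: "minor_points n \<subseteq> X"
    then obtain F where F: "F \<subseteq> (\<Union>d. sym_power n d)" "X = zero_locus n F"
      by (auto simp: zariski_closed_def)
    have "f z = 0" if f: "f \<in> F" and z: "z \<in> p" for f z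
    proof -
      obtain d where d: "f \<in> sym_power n d" using F f by blast
      obtain x where x: "z = fscale x z0" "x \<noteq> 0" using z z0 by (auto simp: proj_point_def)
      have zt: "z \<in> tensors {..<n}" using z0 x by (simp add: tensors_def fscale_def)
      have znz: "z \<noteq> 0" using z0 x by (auto simp: fscale_def fun_eq_iff)
      have "slice_hyperdet n i j k r z = 0" if "distinct3 n i j k" for i j k r
      proof -
        have "slice_hyperdet n i j k r \<in> HD n"
          unfolding HD_eq[OF assms] by (rule cfun.span_base) (use that in \<open>auto simp: slice_hyperdets_def\<close>)
        then show ?thesis using p z by (auto simp: zero_locus_def)
      qed
      from HD_point_is_sheared_minors[OF zt znz this] obtain c y A where
        A: "\<And>i j. A i j = A j i"
        and zI: "\<And>I. I \<subseteq> {..<n} \<Longrightarrow> z I = y * contract ({..<n} - I) (\<lambda>I. pminor I A) (affine_row c) I"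
        by metis
      have minors: "f (\<lambda>I. pminor I B) = 0" if B: "\<And>i j. B i j = B j i" for B
      proof -
        let ?M = "mat n n (\<lambda>(i, j). B i j)"
        have "transpose_mat ?M = ?M" by (rule eq_matI) (use B in auto)
        then have "proj_point (minors_tensor n ?M 1) \<in> minor_points n"
          by (auto simp: minor_points_def intro!: exI[of _ ?M] exI[of _ 1])
        then have "proj_point (minors_tensor n ?M 1) \<in> zero_locus n F" using sub F by auto
        moreover have "minors_tensor n ?M 1 \<in> proj_point (minors_tensor n ?M 1)"
          by (auto simp: proj_point_def fscale_def intro!: exI[of _ 1])
        ultimately have "f (minors_tensor n ?M 1) = 0" using f by (auto simp: zero_locus_def)
        moreover have "minors_tensor n ?M 1 I = pminor I B" if "I \<subseteq> {..<n}" for I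
        proof -
          have "pminor I (\<lambda>i j. ?M $$ (i, j)) = pminor I B"
            by (rule pminor_cong) (use that in \<open>auto simp: subset_iff\<close>)
          then show ?thesis using minors_tensor_eq[of ?M n 1 I] that by simp
        qed
        ultimately show ?thesis using sym_power_cong[OF d, of "minors_tensor n ?M 1" "\<lambda>I. pminor I B"] by simp
      qed
      have "f z = f (fscale y (\<lambda>I. contract ({..<n} - I) (\<lambda>I. pminor I A) (affine_row c) I))"
        by (rule sym_power_cong[OF d]) (simp add: zI fscale_def)
      also have "\<dots> = y ^ d * f (\<lambda>I. contract ({..<n} - I) (\<lambda>I. pminor I A) (affine_row c) I)"
        by (rule sym_power_homogeneous[OF d])
      also have "f (\<lambda>I. contract ({..<n} - I) (\<lambda>I. pminor I A) (affine_row c) I) = 0"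
        by (rule vanish_sheared[OF d minors]) (use A in auto)
      finally show ?thesis by simp
    qed
    then show "p \<in> X" using proj by (simp add: F zero_locus_def)
  qed
qed

section \<open>Schur functors of the plane\<close>

text \<open>A subset of \<open>A \<times> B\<close> is a family of rows. Together with
  \<open>prod_Pow_cols\<close> this lets a tensor in the positions \<open>(k, j)\<close> be read by
  factors \<open>k\<close> or by copies \<open>j\<close>.\<close>

lemma prod_Pow_rows:
  fixes f :: "'a \<Rightarrow> 'c set \<Rightarrow> 'b :: comm_semiring_1"
  assumes "finite A" "finite B"
  shows "(\<Sum>J\<in>Pow (A \<times> B). \<Prod>a\<in>A. f a (J `` {a})) = (\<Prod>a\<in>A. \<Sum>S\<in>Pow B. f a S)"
proof -
  have "(\<Prod>a\<in>A. \<Sum>S\<in>Pow B. f a S) = (\<Sum>g\<in>PiE A (\<lambda>_. Pow B). \<Prod>a\<in>A. f a (g a))"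
    by (rule prod_sum_PiE) (use assms in auto)
  also have "\<dots> = (\<Sum>J\<in>Pow (A \<times> B). \<Prod>a\<in>A. f a (J `` {a}))"
  proof (rule sum.reindex_bij_witness[where i = "\<lambda>J. \<lambda>a\<in>A. J `` {a}" and j = "\<lambda>g. Sigma A g"])
    fix g assume g: "g \<in> PiE A (\<lambda>_. Pow B)"
    then have row: "Sigma A g `` {a} = g a" if "a \<in> A" for a using that by auto
    show "(\<lambda>a\<in>A. Sigma A g `` {a}) = g"
    proof
      fix a show "(\<lambda>a\<in>A. Sigma A g `` {a}) a = g a"
        using g row by (cases "a \<in> A") (auto simp: PiE_def extensional_def)
    qed
    show "Sigma A g \<in> Pow (A \<times> B)" using g by (auto simp: PiE_def Pi_def)
    show "(\<Prod>a\<in>A. f a (Sigma A g `` {a})) = (\<Prod>a\<in>A. f a (g a))"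
      by (rule prod.cong) (simp_all add: row)
  qed auto
  finally show ?thesis by simp
qed

lemma prod_Pow_cols:
  fixes f :: "'c \<Rightarrow> 'a set \<Rightarrow> 'b :: comm_semiring_1"
  assumes "finite A" "finite B"
  shows "(\<Sum>J\<in>Pow (A \<times> B). \<Prod>j\<in>B. f j {k. (k, j) \<in> J}) = (\<Prod>j\<in>B. \<Sum>I\<in>Pow A. f j I)"
proof -
  have "(\<Sum>J\<in>Pow (A \<times> B). \<Prod>j\<in>B. f j {k. (k, j) \<in> J}) = (\<Sum>J\<in>Pow (B \<times> A). \<Prod>j\<in>B. f j (J `` {j}))"
    by (rule sum.reindex_bij_witness[where i = "\<lambda>J. J\<inverse>" and j = "\<lambda>J. J\<inverse>"])
      (auto simp: Image_def)
  then show ?thesis using prod_Pow_rows[OF assms(2,1)] by simp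
qed

text \<open>
  This is \<open>\<epsilon>\<^sub>0\<^sub>2 \<epsilon>\<^sub>1\<^sub>3 + \<epsilon>\<^sub>0\<^sub>3 \<epsilon>\<^sub>1\<^sub>2\<close> with the invariant alternating form \<open>\<epsilon>\<^sub>i\<^sub>j\<close> in the positions \<open>i, j\<close>.
\<close>
definition u22 :: "nat set \<Rightarrow> complex" where
  "u22 S = (if \<not> S \<subseteq> {..<4} then 0
    else if (0 \<in> S) = (1 \<in> S) \<and> (2 \<in> S) = (3 \<in> S) \<and> (0 \<in> S) \<noteq> (2 \<in> S) then 2
    else if (0 \<in> S) \<noteq> (1 \<in> S) \<and> (2 \<in> S) \<noteq> (3 \<in> S) then - 1 else 0)"

lemma u22_values [simp]:
  "u22 {0, 1} = 2" "u22 {2, 3} = 2" "u22 {0, 2} = - 1" "u22 {0, 3} = - 1" "u22 {1, 2} = - 1" "u22 {1, 3} = - 1"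
  by (auto simp: u22_def)

definition bits4 :: "bool \<Rightarrow> bool \<Rightarrow> bool \<Rightarrow> bool \<Rightarrow> nat set" where
  "bits4 a b c d = {x. x = 0 \<and> a \<or> x = 1 \<and> b \<or> x = 2 \<and> c \<or> x = 3 \<and> d}"

lemma bits4_eq:
  assumes "S \<subseteq> {..<4}"
  shows "S = bits4 (0 \<in> S) (1 \<in> S) (2 \<in> S) (3 \<in> S)"
proof (rule Set.set_eqI)
  fix x
  show "x \<in> S \<longleftrightarrow> x \<in> bits4 (0 \<in> S) (1 \<in> S) (2 \<in> S) (3 \<in> S)"
  proof (cases "x < 4")
    case True
    then have "x = 0 \<or> x = 1 \<or> x = 2 \<or> x = 3" by auto
    then show ?thesis by (auto simp: bits4_def)
  qed (use assms in \<open>auto simp: bits4_def\<close>)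
qed

lemma u22_sum: "(\<Sum>S\<in>Pow {..<4}. u22 S * f S)
   = 2 * f {0, 1} + 2 * f {2, 3} - f {0, 2} - f {0, 3} - f {1, 2} - f {1, 3}"
proof -
  have "(\<Sum>S\<in>Pow {..<4}. u22 S * f S) = (\<Sum>S\<in>{{0, 1}, {2, 3}, {0, 2}, {0, 3}, {1, 2}, {1, 3}}. u22 S * f S)"
  proof (rule sum.mono_neutral_right)
    show "\<forall>S\<in>Pow {..<4} - {{0, 1}, {2, 3}, {0, 2}, {0, 3}, {1, 2}, {1, 3}}. u22 S * f S = 0"
    proof
      fix S :: "nat set" assume S: "S \<in> Pow {..<4} - {{0, 1}, {2, 3}, {0, 2}, {0, 3}, {1, 2}, {1, 3}}"
      then have sub: "S \<subseteq> {..<4}" by auto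
      have "u22 S = 0"
      proof (rule ccontr)
        assume "u22 S \<noteq> 0"
        then have "(0 \<in> S) = (1 \<in> S) \<and> (2 \<in> S) = (3 \<in> S) \<and> (0 \<in> S) \<noteq> (2 \<in> S) \<or> (0 \<in> S) \<noteq> (1 \<in> S) \<and> (2 \<in> S) \<noteq> (3 \<in> S)"
          by (auto simp: u22_def split: if_splits)
        then have "S = bits4 True True False False \<or> S = bits4 False False True True \<or> S = bits4 True False True False
          \<or> S = bits4 True False False True \<or> S = bits4 False True True False \<or> S = bits4 False True False True"
          using bits4_eq[OF sub] by (cases "0 \<in> S"; cases "1 \<in> S"; cases "2 \<in> S"; cases "3 \<in> S") simp_all
        moreover have "bits4 True True False False = {0, 1}" "bits4 False False True True = {2, 3}"
          "bits4 True False True False = {0, 2}" "bits4 True False False True = {0, 3}"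
          "bits4 False True True False = {1, 2}" "bits4 False True False True = {1, 3}"
          by (auto simp: bits4_def)
        ultimately show False using S by (simp del: One_nat_def)
      qed
      then show "u22 S * f S = 0" by simp
    qed
  qed auto
  also have "\<dots> = 2 * f {0, 1} + 2 * f {2, 3} - f {0, 2} - f {0, 3} - f {1, 2} - f {1, 3}"
    by (simp add: doubleton_eq_iff del: One_nat_def)
  finally show ?thesis .
qed

section \<open>The Young symmetrizer of shape (2,2)\<close>

lemma box_row_22: "j < 4 \<Longrightarrow> box_row [2, 2] j = j div 2"
  unfolding box_row_def by (rule Least_equality) (auto simp: take_Cons' split: if_splits)

lemma box_col_22:
  assumes "j < 4"
  shows "box_col [2, 2] j = j mod 2"
proof -
  have "j \<in> {0, 1, 2, 3}" using assms by auto
  then show ?thesis unfolding box_col_def box_row_22[OF assms] by auto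
qed

text \<open>The boxes 0, 1 form the first row and 2, 3 the second, so the row group is generated by
  the swaps of 0, 1 and of 2, 3, and the column group by those of 0, 2 and of 1, 3.\<close>

definition rowp :: "bool \<Rightarrow> bool \<Rightarrow> nat \<Rightarrow> nat" where
  "rowp a b = (if a then transpose 0 1 else id) \<circ> (if b then transpose 2 3 else id)"

definition colp :: "bool \<Rightarrow> bool \<Rightarrow> nat \<Rightarrow> nat" where
  "colp a b = (if a then transpose 0 2 else id) \<circ> (if b then transpose 1 3 else id)"

lemma fun_eq_4:
  assumes "p permutes {..<4}" "q permutes {..<4}" "p 0 = q 0" "p 1 = q 1" "p 2 = q 2" "p 3 = q (3 :: nat)"
  shows "p = q"
proof
  fix x
  show "p x = q x"
  proof (cases "x < 4")
    case True
    then have "x = 0 \<or> x = 1 \<or> x = 2 \<or> x = 3" by auto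
    then show ?thesis using assms by auto
  qed (use assms in \<open>simp add: permutes_not_in\<close>)
qed

lemma rowp_permutes: "rowp a b permutes {..<4}"
  unfolding rowp_def by (intro permutes_compose) (auto intro!: permutes_swap_id permutes_id)

lemma colp_permutes: "colp a b permutes {..<4}"
  unfolding colp_def by (intro permutes_compose) (auto intro!: permutes_swap_id permutes_id)

lemma row_group_22:
  "{p. p permutes {..<4} \<and> (\<forall>j\<in>{..<4}. box_row [2, 2] (p j) = box_row [2, 2] j)}
    = (\<lambda>(a, b). rowp a b) ` UNIV" (is "?R = _")
proof
  show "?R \<subseteq> (\<lambda>(a, b). rowp a b) ` UNIV"
  proof
    fix p assume "p \<in> ?R"
    then have p: "p permutes {..<4}" and r: "\<And>j. j < 4 \<Longrightarrow> box_row [2, 2] (p j) = box_row [2, 2] j" by auto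
    have lt: "p j < 4" if "j < 4" for j using permutes_in_image[OF p, of j] that by simp
    have d: "p j div 2 = j div 2" if "j < 4" for j using r[OF that] that lt by (simp add: box_row_22)
    have inj: "p x = p y \<longleftrightarrow> x = y" for x y using permutes_inj[OF p] by (simp add: inj_eq)
    have 0: "p 0 = 0 \<and> p 1 = 1 \<or> p 0 = 1 \<and> p 1 = 0" "p 2 = 2 \<and> p 3 = 3 \<or> p 2 = 3 \<and> p 3 = 2"
      using d[of 0] d[of 1] d[of 2] d[of 3] inj[of 0 1] inj[of 2 3] by auto
    have "p = (case (p 0 = 1, p 2 = 3) of (a, b) \<Rightarrow> rowp a b)"
      unfolding prod.case
      by (rule fun_eq_4[OF p rowp_permutes]) (use 0 in \<open>auto simp: rowp_def transpose_def\<close>)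
    then show "p \<in> (\<lambda>(a, b). rowp a b) ` UNIV" by (rule image_eqI) simp
  qed
  show "(\<lambda>(a, b). rowp a b) ` UNIV \<subseteq> ?R"
  proof clarify
    fix a b
    have "box_row [2, 2] (rowp a b j) = box_row [2, 2] j" if "j < 4" for j
    proof -
      have "rowp a b j < 4" using permutes_in_image[OF rowp_permutes[of a b], of j] that by simp
      moreover have "j = 0 \<or> j = 1 \<or> j = 2 \<or> j = 3" using that by auto
      ultimately show ?thesis
        using that by (simp add: box_row_22) (auto simp: rowp_def transpose_def)
    qed
    then show "rowp a b permutes {..<4} \<and> (\<forall>j\<in>{..<4}. box_row [2, 2] (rowp a b j) = box_row [2, 2] j)"
      by (simp add: rowp_permutes)
  qed
qed

lemma col_group_22:
  "{p. p permutes {..<4} \<and> (\<forall>j\<in>{..<4}. box_col [2, 2] (p j) = box_col [2, 2] j)}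
    = (\<lambda>(a, b). colp a b) ` UNIV" (is "?R = _")
proof
  show "?R \<subseteq> (\<lambda>(a, b). colp a b) ` UNIV"
  proof
    fix p assume "p \<in> ?R"
    then have p: "p permutes {..<4}" and r: "\<And>j. j < 4 \<Longrightarrow> box_col [2, 2] (p j) = box_col [2, 2] j" by auto
    have lt: "p j < 4" if "j < 4" for j using permutes_in_image[OF p, of j] that by simp
    have m: "p j mod 2 = j mod 2" if "j < 4" for j using r[OF that] that lt by (simp add: box_col_22)
    have d: "p 0 = 0 \<or> p 0 = 2" "p 1 = 1 \<or> p 1 = 3" "p 2 = 0 \<or> p 2 = 2" "p 3 = 1 \<or> p 3 = 3"
      using lt[of 0] m[of 0] lt[of 1] m[of 1] lt[of 2] m[of 2] lt[of 3] m[of 3] by presburger+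
    have inj: "p x = p y \<longleftrightarrow> x = y" for x y using permutes_inj[OF p] by (simp add: inj_eq)
    have 0: "p 0 = 0 \<and> p 2 = 2 \<or> p 0 = 2 \<and> p 2 = 0" "p 1 = 1 \<and> p 3 = 3 \<or> p 1 = 3 \<and> p 3 = 1"
      using d inj[of 0 2] inj[of 1 3] by auto
    have "p = (case (p 0 = 2, p 1 = 3) of (a, b) \<Rightarrow> colp a b)"
      unfolding prod.case
      by (rule fun_eq_4[OF p colp_permutes]) (use 0 in \<open>auto simp: colp_def transpose_def\<close>)
    then show "p \<in> (\<lambda>(a, b). colp a b) ` UNIV" by (rule image_eqI) simp
  qed
  show "(\<lambda>(a, b). colp a b) ` UNIV \<subseteq> ?R"
  proof clarify
    fix a b
    have "box_col [2, 2] (colp a b j) = box_col [2, 2] j" if "j < 4" for j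
    proof -
      have "colp a b j < 4" using permutes_in_image[OF colp_permutes[of a b], of j] that by simp
      moreover have "j = 0 \<or> j = 1 \<or> j = 2 \<or> j = 3" using that by auto
      ultimately show ?thesis
        using that by (simp add: box_col_22) (auto simp: colp_def transpose_def)
    qed
    then show "colp a b permutes {..<4} \<and> (\<forall>j\<in>{..<4}. box_col [2, 2] (colp a b j) = box_col [2, 2] j)"
      by (simp add: colp_permutes)
  qed
qed

lemma inj_rowp: "inj (\<lambda>(a, b). rowp a b)"
proof (rule injI, clarify)
  fix a b a' b' assume "rowp a b = rowp a' b'"
  then have "rowp a b 0 = rowp a' b' 0" "rowp a b 2 = rowp a' b' 2" by auto
  then show "a = a' \<and> b = b'" by (auto simp: rowp_def transpose_def split: if_splits)
qed

lemma inj_colp: "inj (\<lambda>(a, b). colp a b)"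
proof (rule injI, clarify)
  fix a b a' b' assume "colp a b = colp a' b'"
  then have "colp a b 0 = colp a' b' 0" "colp a b 1 = colp a' b' 1" by auto
  then show "a = a' \<and> b = b'" by (auto simp: colp_def transpose_def split: if_splits)
qed

lemma sign_colp: "sign (colp a b) = (if a = b then 1 else - 1)"
proof -
  have "sign (colp a b) = sign (if a then transpose 0 2 else id :: nat \<Rightarrow> nat) * sign (if b then transpose 1 3 else id :: nat \<Rightarrow> nat)"
    unfolding colp_def by (rule sign_compose) (auto simp: permutation_swap_id)
  then show ?thesis by (auto simp: sign_swap_id sign_id)
qed

lemma sum_fun_apply: "(\<Sum>i\<in>S. f i) x = (\<Sum>i\<in>S. f i x)"
  by (induction S rule: infinite_finite_induct) auto

lemma young_22:
  "young_symmetrizer [2, 2] z I = (\<Sum>(a, b)\<in>UNIV. \<Sum>(c, d)\<in>UNIV.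
     (if c = d then 1 else - 1) * z (colp c d -` (rowp a b -` I)))"
proof -
  have s: "sum_list [2, 2 :: nat] = 4" by simp
  have "young_symmetrizer [2, 2] z I = (\<Sum>p\<in>(\<lambda>(a, b). rowp a b) ` UNIV. \<Sum>q\<in>(\<lambda>(a, b). colp a b) ` UNIV.
      of_int (sign q) * z (q -` (p -` I)))"
    unfolding young_symmetrizer_def Let_def s row_group_22 col_group_22
    by (simp add: fscale_def perm_act_def sum_fun_apply)
  also have "\<dots> = (\<Sum>x\<in>UNIV. \<Sum>q\<in>(\<lambda>(a, b). colp a b) ` UNIV.
      of_int (sign q) * z (q -` ((case x of (a, b) \<Rightarrow> rowp a b) -` I)))"
    by (rule sum.reindex[OF inj_rowp, unfolded o_def])
  also have "\<dots> = (\<Sum>x\<in>UNIV. \<Sum>y\<in>UNIV.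
      of_int (sign (case y of (a, b) \<Rightarrow> colp a b)) * z ((case y of (a, b) \<Rightarrow> colp a b) -` ((case x of (a, b) \<Rightarrow> rowp a b) -` I)))"
    by (intro sum.cong refl sum.reindex[OF inj_colp, unfolded o_def])
  also have "\<dots> = (\<Sum>(a, b)\<in>UNIV. \<Sum>(c, d)\<in>UNIV.
     (if c = d then 1 else - 1) * z (colp c d -` (rowp a b -` I)))"
    by (simp add: case_prod_beta sign_colp if_distrib cong: if_cong)
  finally show ?thesis .
qed

text \<open>The scalar pairs \<open>z\<close> with the product of the alternating forms in the
  columns 0, 2 and 1, 3; symmetrizing that product along the rows gives twice
  \<open>u22\<close>.\<close>

lemma young_22_eq:
  assumes z: "z \<in> tensors {..<4}"
  shows "young_symmetrizer [2, 2] z = fscale (2 * (z {0, 1} - z {1, 2} - z {0, 3} + z {2, 3})) u22"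
proof
  fix I :: "nat set"
  show "young_symmetrizer [2, 2] z I = fscale (2 * (z {0, 1} - z {1, 2} - z {0, 3} + z {2, 3})) u22 I"
  proof (cases "I \<subseteq> {..<4}")
    case False
    have "\<not> colp c d -` (rowp a b -` I) \<subseteq> {..<4}" for a b c d
    proof
      assume sub: "colp c d -` (rowp a b -` I) \<subseteq> {..<4}"
      have "I \<subseteq> {..<4}"
      proof
        fix x assume "x \<in> I"
        define y where "y = Hilbert_Choice.inv (colp c d) (Hilbert_Choice.inv (rowp a b) x)"
        have "rowp a b (colp c d y) = x"
          unfolding y_def permutes_inverses[OF colp_permutes] permutes_inverses[OF rowp_permutes] ..
        with \<open>x \<in> I\<close> sub have "y \<in> {..<4}" by auto
        then have "rowp a b (colp c d y) \<in> {..<4}"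
          using permutes_in_image[OF colp_permutes] permutes_in_image[OF rowp_permutes] by metis
        with \<open>rowp a b (colp c d y) = x\<close> show "x \<in> {..<4}" by simp
      qed
      with False show False by blast
    qed
    then have "young_symmetrizer [2, 2] z I = 0"
      unfolding young_22 using z by (intro sum.neutral) (auto simp: tensors_def intro!: sum.neutral)
    moreover have "u22 I = 0" using False by (auto simp: u22_def)
    ultimately show ?thesis by (simp add: fscale_def)
  next
    case True
    have U: "(UNIV :: (bool \<times> bool) set) = {(False, False), (False, True), (True, False), (True, True)}"
      by auto
    define \<zeta> where "\<zeta> a b c d = z (bits4 a b c d)" for a b c d
    have z4: "z J = \<zeta> (0 \<in> J) (1 \<in> J) (2 \<in> J) (3 \<in> J)" if "J \<subseteq> {..<4}" for J
      using bits4_eq[OF that] by (simp add: \<zeta>_def)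
    have pre: "z (colp c d -` (rowp a b -` I)) = \<zeta> (rowp a b (colp c d 0) \<in> I) (rowp a b (colp c d 1) \<in> I)
        (rowp a b (colp c d 2) \<in> I) (rowp a b (colp c d 3) \<in> I)" for a b c d
    proof -
      have "colp c d -` (rowp a b -` I) \<subseteq> {..<4}"
      proof
        fix x assume "x \<in> colp c d -` (rowp a b -` I)"
        then have "rowp a b (colp c d x) \<in> {..<4}" using True by auto
        then show "x \<in> {..<4}"
          using permutes_in_image[OF colp_permutes] permutes_in_image[OF rowp_permutes] by metis
      qed
      from z4[OF this] show ?thesis by simp
    qed
    have t: "z {0, 1} = \<zeta> True True False False" "z {1, 2} = \<zeta> False True True False"
      "z {0, 3} = \<zeta> True False False True" "z {2, 3} = \<zeta> False False True True"
      by (subst z4; simp)+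
    have c: "rowp a b (colp c d 0) = (if c then (if b then 3 else 2) else (if a then 1 else 0))"
      "rowp a b (colp c d 1) = (if d then (if b then 2 else 3) else (if a then 0 else 1))"
      "rowp a b (colp c d 2) = (if c then (if a then 1 else 0) else (if b then 3 else 2))"
      "rowp a b (colp c d 3) = (if d then (if a then 0 else 1) else (if b then 2 else 3))" for a b c d
      by (auto simp: rowp_def colp_def transpose_def)
    show ?thesis
      unfolding young_22 pre c t U fscale_def u22_def using True
      by (cases "0 \<in> I"; cases "1 \<in> I"; cases "2 \<in> I"; cases "3 \<in> I") (simp_all add: algebra_simps)
  qed
qed

lemma schur_22: "schur [2, 2] = range (\<lambda>c. fscale c u22)"
proof
  show "schur [2, 2] \<subseteq> range (\<lambda>c. fscale c u22)"
    unfolding schur_def using young_22_eq by auto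
  show "range (\<lambda>c. fscale c u22) \<subseteq> schur [2, 2]"
  proof clarify
    fix c :: complex
    \<comment> \<open>Chosen so that the factor \<open>2 * z {0, 1}\<close> in
      \<open>young_22_eq\<close> is \<open>c\<close>.\<close>
    define z where "z = (\<lambda>S :: nat set. if S = {0, 1} then c / 2 else 0)"
    have "z \<in> tensors {..<4}" by (auto simp: z_def tensors_def)
    from young_22_eq[OF this] have "young_symmetrizer [2, 2] z = fscale c u22"
      by (simp add: z_def doubleton_eq_iff)
    with \<open>z \<in> tensors {..<4}\<close> show "fscale c u22 \<in> schur [2, 2]"
      unfolding schur_def by (intro image_eqI[of _ _ z]) auto
  qed
qed

lemma ex_permutes_card:
  assumes "I \<subseteq> B" "I' \<subseteq> B" "finite B" "card I = card I'"
  obtains s where "s permutes B" "s -` I = I'"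
proof -
  have fin: "finite I" "finite I'" using assms finite_subset by auto
  obtain f where f: "bij_betw f I' I" using finite_same_card_bij[OF fin(2,1)] assms(4) by auto
  have "card (B - I') = card (B - I)" using assms fin by (simp add: card_Diff_subset)
  then obtain g where g: "bij_betw g (B - I') (B - I)"
    using finite_same_card_bij[of "B - I'" "B - I"] assms(3) by auto
  define s where "s x = (if x \<in> I' then f x else if x \<in> B then g x else x)" for x
  have 1: "bij_betw s I' I" using f by (rule bij_betw_cong[THEN iffD1, rotated]) (simp add: s_def)
  have 2: "bij_betw s (B - I') (B - I)" using g by (rule bij_betw_cong[THEN iffD1, rotated]) (simp add: s_def)
  have "bij_betw s (I' \<union> (B - I')) (I \<union> (B - I))"
    by (rule bij_betw_combine[OF 1 2]) auto
  moreover have "I' \<union> (B - I') = B" "I \<union> (B - I) = B" using assms by auto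
  ultimately have s: "s permutes B"
    using assms by (intro bij_imp_permutes) (auto simp: s_def)
  moreover have "s -` I = I'"
  proof (rule Set.set_eqI)
    fix x
    show "x \<in> s -` I \<longleftrightarrow> x \<in> I'"
    proof (cases "x \<in> B - I'")
      case True
      then have "s x \<in> B - I" using 2 by (auto simp: bij_betw_def)
      with True show ?thesis by auto
    next
      case False
      then show ?thesis using 1 assms by (auto simp: bij_betw_def s_def)
    qed
  qed
  ultimately show ?thesis by (rule that)
qed

section \<open>The Young symmetrizer of shape (4)\<close>

lemma box_row_4: "j < 4 \<Longrightarrow> box_row [4] j = 0"
  unfolding box_row_def by (rule Least_equality) auto

lemma box_col_4: "j < 4 \<Longrightarrow> box_col [4] j = j"
  unfolding box_col_def by (simp add: box_row_4)

lemma young_4: "young_symmetrizer [4] z I = (\<Sum>p | p permutes {..<4}. z (p -` I))"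
proof -
  have R: "{p. p permutes {..<4} \<and> (\<forall>j\<in>{..<4}. box_row [4] (p j) = box_row [4] j)} = {p. p permutes {..<4}}"
  proof (rule Collect_cong)
    fix p show "p permutes {..<4} \<and> (\<forall>j\<in>{..<4}. box_row [4] (p j) = box_row [4] j) \<longleftrightarrow> p permutes {..<4}"
    proof
      assume p: "p permutes {..<4}"
      have "box_row [4] (p j) = box_row [4] j" if "j < 4" for j
        using permutes_in_image[OF p, of j] that by (simp add: box_row_4)
      with p show "p permutes {..<4} \<and> (\<forall>j\<in>{..<4}. box_row [4] (p j) = box_row [4] j)" by simp
    qed simp
  qed
  have C: "{p. p permutes {..<4} \<and> (\<forall>j\<in>{..<4}. box_col [4] (p j) = box_col [4] j)} = {id}"
  proof
    show "{p. p permutes {..<4} \<and> (\<forall>j\<in>{..<4}. box_col [4] (p j) = box_col [4] j)} \<subseteq> {id}"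
    proof clarify
      fix p assume p: "p permutes {..<4 :: nat}" and c: "\<forall>j\<in>{..<4}. box_col [4] (p j) = box_col [4] j"
      have "p x = x" for x
      proof (cases "x < 4")
        case True
        then have "p x < 4" using permutes_in_image[OF p, of x] by simp
        moreover have "box_col [4] (p x) = box_col [4] x" using c True by blast
        ultimately show ?thesis using True by (simp add: box_col_4)
      qed (use p in \<open>simp add: permutes_not_in\<close>)
      then show "p = id" by auto
    qed
  qed (simp add: permutes_id)
  have s: "sum_list [4 :: nat] = 4" by simp
  show ?thesis
    unfolding young_symmetrizer_def Let_def s R C
    by (simp add: fscale_def perm_act_def sum_fun_apply sign_id)
qed

text \<open>Summing over all permutations leaves a dependence on the cardinality only. Conversely
  such a tensor is fixed by every permutation, and division by 4! = 24 exhibits it as a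
  symmetrization.\<close>

lemma schur_4: "y \<in> schur [4] \<longleftrightarrow> (\<exists>c. y = (\<lambda>S. if S \<subseteq> {..<4} then c (card S) else 0))"
proof
  assume "y \<in> schur [4]"
  then obtain z where z: "z \<in> tensors {..<4}" and y: "y = young_symmetrizer [4] z"
    by (auto simp: schur_def)
  define c where "c k = y {..<k}" for k
  have "y S = (if S \<subseteq> {..<4} then c (card S) else 0)" for S
  proof (cases "S \<subseteq> {..<4}")
    case True
    then have "card S \<le> 4" using card_mono[OF _ True] by simp
    then have sub: "{..<card S} \<subseteq> {..<4}" by auto
    obtain s where s: "s permutes {..<4}" "s -` {..<card S} = S"
      using ex_permutes_card[OF sub True] by auto
    have "y S = (\<Sum>p | p permutes {..<4}. z (p -` s -` {..<card S}))"
      by (simp add: y young_4 s(2))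
    also have "\<dots> = (\<Sum>p | p permutes {..<4}. z ((s \<circ> p) -` {..<card S}))"
      by (simp add: vimage_comp)
    also have "\<dots> = y {..<card S}"
      unfolding y young_4 using setum_permutations_compose_left[OF s(1), of "\<lambda>p. z (p -` {..<card S})"] by simp
    finally show ?thesis using True by (simp add: c_def)
  next
    case False
    have "z (p -` S) = 0" if p: "p permutes {..<4}" for p
    proof -
      obtain x where x: "x \<in> S" "x \<notin> {..<4}" using False by auto
      then have "p x = x" using p by (simp add: permutes_not_in)
      then have "x \<in> p -` S" using x by simp
      then have "\<not> p -` S \<subseteq> {..<4}" using x by auto
      then show ?thesis using z by (auto simp: tensors_def)
    qed
    then have "y S = 0" by (simp add: y young_4)
    with False show ?thesis by simp
  qed
  then show "\<exists>c. y = (\<lambda>S. if S \<subseteq> {..<4} then c (card S) else 0)" by auto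
next
  assume "\<exists>c. y = (\<lambda>S. if S \<subseteq> {..<4} then c (card S) else 0)"
  then obtain c where y: "y = (\<lambda>S. if S \<subseteq> {..<4} then c (card S) else 0)" by blast
  define z where "z = (\<lambda>S. y S / 24)"
  have "z \<in> tensors {..<4}" by (simp add: z_def y tensors_def)
  moreover have "young_symmetrizer [4] z = y"
  proof
    fix S
    have "y (p -` S) = y S" if p: "p permutes {..<4}" for p
    proof -
      have "bij p" using p by (rule permutes_bij)
      then have "card (p -` S) = card S" by (simp add: bij_is_inj bij_is_surj card_vimage_inj)
      moreover have "p -` S \<subseteq> {..<4} \<longleftrightarrow> S \<subseteq> {..<4}"
      proof
        assume *: "p -` S \<subseteq> {..<4}"
        show "S \<subseteq> {..<4}"
        proof
          fix x assume "x \<in> S"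
          obtain w where w: "x = p w" using \<open>bij p\<close> by (metis bij_pointE)
          then have "w \<in> {..<4}" using * \<open>x \<in> S\<close> by auto
          then show "x \<in> {..<4}" using permutes_in_image[OF p] w by auto
        qed
      next
        assume "S \<subseteq> {..<4}"
        then show "p -` S \<subseteq> {..<4}" using permutes_in_image[OF p] by blast
      qed
      ultimately show ?thesis by (simp add: y)
    qed
    then have "young_symmetrizer [4] z S = (\<Sum>p | p permutes {..<4 :: nat}. y S / 24)"
      by (simp add: young_4 z_def)
    also have "\<dots> = y S"
      by (simp add: card_permutations[OF refl, of "{..<4 :: nat}"] fact_numeral)
    finally show "young_symmetrizer [4] z S = y S" .
  qed
  ultimately show "y \<in> schur [4]" unfolding schur_def by (intro image_eqI[of _ _ z]) simp_all
qed

section \<open>Quartic forms from tensors\<close>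

definition pure_tensor :: "nat \<Rightarrow> (nat \<Rightarrow> nat set \<Rightarrow> complex) \<Rightarrow> (nat \<times> nat) set \<Rightarrow> complex" where
  "pure_tensor n u J = (if J \<subseteq> {..<n} \<times> UNIV then \<Prod>k<n. u k (J `` {k}) else 0)"

text \<open>The pairing of \<open>X\<close> with the fourth tensor power of \<open>z\<close>: the
  column \<open>{k. (k, j) \<in> J}\<close> is the multi-index in the \<open>j\<close>-th
  copy.\<close>

definition quartic :: "nat \<Rightarrow> ((nat \<times> nat) set \<Rightarrow> complex) \<Rightarrow> (nat set \<Rightarrow> complex) \<Rightarrow> complex" where
  "quartic n X z = (\<Sum>J\<in>Pow ({..<n} \<times> {..<4}). X J * (\<Prod>j<4. z {k. (k, j) \<in> J}))"

lemma quartic_add: "quartic n (X + Y) z = quartic n X z + quartic n Y z"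
  by (simp add: quartic_def algebra_simps sum.distrib)

lemma quartic_fscale: "quartic n (fscale c X) z = c * quartic n X z"
  by (simp add: quartic_def fscale_def sum_distrib_left mult.assoc)

text \<open>For \<open>z\<close> a sum of two product tensors, \<open>T\<close> records the copies
  in which the second one is taken; after this choice everything factors over the positions
  \<open>k\<close>.\<close>

lemma quartic_pure_product:
  assumes "\<And>I. I \<subseteq> {..<n} \<Longrightarrow> z I = (\<Prod>p<n. \<zeta> False p (p \<in> I)) + (\<Prod>p<n. \<zeta> True p (p \<in> I))"
  shows "quartic n (pure_tensor n u) z = (\<Sum>T\<in>Pow {..<4}. \<Prod>k<n. \<Sum>S\<in>Pow {..<4}. u k S * (\<Prod>j<4. \<zeta> (j \<in> T) k (j \<in> S)))"
proof -
  have col: "(\<Prod>j<4. z {k. (k, j) \<in> J}) = (\<Sum>T\<in>Pow {..<4}. \<Prod>k<n. \<Prod>j<4. \<zeta> (j \<in> T) k (j \<in> J `` {k}))"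
    if "J \<in> Pow ({..<n} \<times> {..<4})" for J :: "(nat \<times> nat) set"
  proof -
    have "(\<Prod>j<4. z {k. (k, j) \<in> J}) = (\<Prod>j<4. (\<Prod>p<n. \<zeta> False p ((p, j) \<in> J)) + (\<Prod>p<n. \<zeta> True p ((p, j) \<in> J)))"
    proof (rule prod.cong[OF refl])
      fix j
      have "{k. (k, j) \<in> J} \<subseteq> {..<n}" using that by auto
      from assms[OF this] show "z {k. (k, j) \<in> J} = (\<Prod>p<n. \<zeta> False p ((p, j) \<in> J)) + (\<Prod>p<n. \<zeta> True p ((p, j) \<in> J))"
        by simp
    qed
    also have "\<dots> = (\<Sum>T\<in>Pow {..<4}. \<Prod>j<4. \<Prod>p<n. \<zeta> (j \<in> T) p ((p, j) \<in> J))"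
      by (rule prod_Pow_bool) simp
    also have "\<dots> = (\<Sum>T\<in>Pow {..<4}. \<Prod>k<n. \<Prod>j<4. \<zeta> (j \<in> T) k ((k, j) \<in> J))"
      by (rule sum.cong[OF refl]) (rule prod.swap)
    finally show ?thesis by (simp add: Image_singleton)
  qed
  have "quartic n (pure_tensor n u) z = (\<Sum>J\<in>Pow ({..<n} \<times> {..<4}). \<Sum>T\<in>Pow {..<4}.
      \<Prod>k<n. u k (J `` {k}) * (\<Prod>j<4. \<zeta> (j \<in> T) k (j \<in> J `` {k})))"
    unfolding quartic_def
  proof (rule sum.cong[OF refl])
    fix J assume J: "J \<in> Pow ({..<n} \<times> {..<4 :: nat})"
    then have "pure_tensor n u J = (\<Prod>k<n. u k (J `` {k}))" by (auto simp: pure_tensor_def)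
    then show "pure_tensor n u J * (\<Prod>j<4. z {k. (k, j) \<in> J}) = (\<Sum>T\<in>Pow {..<4}.
      \<Prod>k<n. u k (J `` {k}) * (\<Prod>j<4. \<zeta> (j \<in> T) k (j \<in> J `` {k})))"
      unfolding col[OF J] sum_distrib_left prod.distrib by simp
  qed
  also have "\<dots> = (\<Sum>T\<in>Pow {..<4}. \<Sum>J\<in>Pow ({..<n} \<times> {..<4}).
      \<Prod>k<n. u k (J `` {k}) * (\<Prod>j<4. \<zeta> (j \<in> T) k (j \<in> J `` {k})))"
    by (rule sum.swap)
  also have "\<dots> = (\<Sum>T\<in>Pow {..<4}. \<Prod>k<n. \<Sum>S\<in>Pow {..<4}. u k S * (\<Prod>j<4. \<zeta> (j \<in> T) k (j \<in> S)))"
    by (rule sum.cong[OF refl]) (rule prod_Pow_rows; simp)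
  finally show ?thesis .
qed

text \<open>The factor on \<open>K\<close> is the sum of the two basis tensors with all bits equal,
  whose hyperdeterminant is 1 for three positions; every other position carries the vector (1, v
  p).\<close>

definition test_tensor :: "nat set \<Rightarrow> (nat \<Rightarrow> complex) \<Rightarrow> nat set \<Rightarrow> complex" where
  "test_tensor K v I = (if I \<inter> K = {} \<or> K \<subseteq> I then \<Prod>p\<in>I - K. v p else 0)"

definition eval4 :: "(nat set \<Rightarrow> complex) \<Rightarrow> complex \<Rightarrow> complex" where
  "eval4 s x = (\<Sum>S\<in>Pow {..<4}. s S * x ^ card S)"

lemma prod_eq_of_bool:
  assumes "finite Q"
  shows "(\<Prod>p\<in>Q. (of_bool (P p) :: complex)) = of_bool (\<forall>p\<in>Q. P p)"
  using assms by (induction Q rule: finite_induct) auto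

lemma prod_if_in:
  assumes "finite Q" "S \<subseteq> Q"
  shows "(\<Prod>p\<in>Q. if p \<in> S then f p else 1) = (\<Prod>p\<in>S. f p :: complex)"
  using assms by (simp add: prod.If_cases Int_absorb1)

text \<open>In a position of \<open>K\<close> the bits of the two summands force the row to be
  \<open>T\<close>; elsewhere both summands carry the same vector, so the factor does not depend on
  \<open>T\<close>.\<close>

lemma quartic_pure_test_tensor:
  assumes K: "K \<subseteq> {..<n}" "K \<noteq> {}"
  shows "quartic n (pure_tensor n u) (test_tensor K v) = (\<Sum>T\<in>Pow {..<4}. \<Prod>k\<in>K. u k T) * (\<Prod>p\<in>{..<n} - K. eval4 (u p) (v p))"
proof -
  define \<zeta> where "\<zeta> b p c = (if p \<in> K then of_bool (c = b) else if c then v p else 1)" for b p c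
  have split: "(\<Prod>p<n. f p) = (\<Prod>p\<in>K. f p) * (\<Prod>p\<in>{..<n} - K. f p)" for f :: "nat \<Rightarrow> complex"
    using prod.subset_diff[OF K(1), of f] by (simp add: mult.commute)
  have finK: "finite K" using K finite_subset by blast
  have z: "test_tensor K v I = (\<Prod>p<n. \<zeta> False p (p \<in> I)) + (\<Prod>p<n. \<zeta> True p (p \<in> I))" if "I \<subseteq> {..<n}" for I
  proof -
    have 1: "(\<Prod>p\<in>K. \<zeta> b p (p \<in> I)) = of_bool (\<forall>p\<in>K. (p \<in> I) = b)" for b
    proof -
      have "(\<Prod>p\<in>K. \<zeta> b p (p \<in> I)) = (\<Prod>p\<in>K. of_bool ((p \<in> I) = b))"
        by (rule prod.cong) (auto simp: \<zeta>_def)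
      then show ?thesis using finK by (simp only: prod_eq_of_bool)
    qed
    have 2: "(\<Prod>p\<in>{..<n} - K. \<zeta> b p (p \<in> I)) = (\<Prod>p\<in>I - K. v p)" for b
    proof -
      have "(\<Prod>p\<in>{..<n} - K. \<zeta> b p (p \<in> I)) = (\<Prod>p\<in>{..<n} - K. if p \<in> I - K then v p else 1)"
        by (rule prod.cong) (auto simp: \<zeta>_def)
      also have "\<dots> = (\<Prod>p\<in>I - K. v p)"
        by (rule prod_if_in) (use that in auto)
      finally show ?thesis .
    qed
    show ?thesis
      unfolding split 1 2 test_tensor_def using K(2) by (cases "I \<inter> K = {}"; cases "K \<subseteq> I") auto
  qed
  have T: "(\<Prod>k<n. \<Sum>S\<in>Pow {..<4}. u k S * (\<Prod>j<4. \<zeta> (j \<in> T) k (j \<in> S)))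
      = (\<Prod>k\<in>K. u k T) * (\<Prod>p\<in>{..<n} - K. eval4 (u p) (v p))" if "T \<in> Pow {..<4}" for T
  proof -
    have "(\<Sum>S\<in>Pow {..<4}. u k S * (\<Prod>j<4. \<zeta> (j \<in> T) k (j \<in> S))) = u k T" if "k \<in> K" for k
    proof -
      have "(\<Prod>j<4. \<zeta> (j \<in> T) k (j \<in> S)) = of_bool (S = T)" if "S \<in> Pow {..<4}" for S
      proof -
        have "(\<Prod>j<4. \<zeta> (j \<in> T) k (j \<in> S)) = (\<Prod>j<4. of_bool ((j \<in> S) = (j \<in> T)))"
          using \<open>k \<in> K\<close> by (intro prod.cong) (auto simp: \<zeta>_def)
        also have "\<dots> = of_bool (\<forall>j\<in>{..<4}. (j \<in> S) = (j \<in> T))"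
          by (rule prod_eq_of_bool) simp
        also have "(\<forall>j\<in>{..<4}. (j \<in> S) = (j \<in> T)) \<longleftrightarrow> S = T"
          using that \<open>T \<in> Pow {..<4}\<close> by blast
        finally show ?thesis .
      qed
      then have "(\<Sum>S\<in>Pow {..<4}. u k S * (\<Prod>j<4. \<zeta> (j \<in> T) k (j \<in> S))) = (\<Sum>S\<in>Pow {..<4}. if S = T then u k S else 0)"
        by (intro sum.cong) auto
      then show ?thesis using \<open>T \<in> Pow {..<4}\<close> by simp
    qed
    moreover have "(\<Sum>S\<in>Pow {..<4}. u k S * (\<Prod>j<4. \<zeta> (j \<in> T) k (j \<in> S))) = eval4 (u k) (v k)" if "k \<notin> K" for k
      unfolding eval4_def
    proof (intro sum.cong refl arg_cong2[where f = "(*)"])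
      fix S assume "S \<in> Pow {..<4 :: nat}"
      have "(\<Prod>j<4. \<zeta> (j \<in> T) k (j \<in> S)) = (\<Prod>j<4. if j \<in> S then v k else 1)"
        using that by (intro prod.cong) (auto simp: \<zeta>_def)
      also have "\<dots> = (\<Prod>j\<in>S. v k)" by (rule prod_if_in) (use \<open>S \<in> _\<close> in auto)
      finally show "(\<Prod>j<4. \<zeta> (j \<in> T) k (j \<in> S)) = v k ^ card S" by simp
    qed
    ultimately show ?thesis unfolding split by simp
  qed
  have "quartic n (pure_tensor n u) (test_tensor K v) = (\<Sum>T\<in>Pow {..<4}. \<Prod>k<n. \<Sum>S\<in>Pow {..<4}. u k S * (\<Prod>j<4. \<zeta> (j \<in> T) k (j \<in> S)))"
    by (rule quartic_pure_product[where \<zeta> = \<zeta>, OF z])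
  also have "\<dots> = (\<Sum>T\<in>Pow {..<4}. (\<Prod>k\<in>K. u k T) * (\<Prod>p\<in>{..<n} - K. eval4 (u p) (v p)))"
    by (rule sum.cong[OF refl T])
  finally show ?thesis by (simp add: sum_distrib_right)
qed

text \<open>A product of alternating forms vanishes when all four arguments are the same
  vector.\<close>

lemma eval4_u22: "eval4 (fscale c u22) x = 0"
proof -
  have "eval4 (fscale c u22) x = c * (\<Sum>S\<in>Pow {..<4}. u22 S * x ^ card S)"
    by (simp add: eval4_def fscale_def sum_distrib_left mult.assoc)
  also have "(\<Sum>S\<in>Pow {..<4}. u22 S * x ^ card S) = 0"
    unfolding u22_sum by simp
  finally show ?thesis by simp
qed

definition power4 :: "(bool \<Rightarrow> complex) \<Rightarrow> nat set \<Rightarrow> complex" where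
  "power4 r S = (if S \<subseteq> {..<4} then \<Prod>j<4. r (j \<in> S) else 0)"

lemma power4_eq: "power4 r S = (if S \<subseteq> {..<4} then r False ^ (4 - card S) * r True ^ card S else 0)"
proof (cases "S \<subseteq> {..<4}")
  case True
  then have fin: "finite S" using finite_subset by blast
  have "(\<Prod>j<4. r (j \<in> S)) = (\<Prod>j\<in>{..<4} - S. r (j \<in> S)) * (\<Prod>j\<in>S. r (j \<in> S))"
    using prod.subset_diff[OF True, of "\<lambda>j. r (j \<in> S)"] by simp
  also have "\<dots> = (\<Prod>j\<in>{..<4} - S. r False) * (\<Prod>j\<in>S. r True)"
    by (intro arg_cong2[where f = "(*)"] prod.cong) auto
  finally show ?thesis using True fin by (simp add: power4_def card_Diff_subset)
qed (simp add: power4_def)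

lemma power4_in_schur: "power4 r \<in> schur [4]"
  unfolding schur_4 by (rule exI[of _ "\<lambda>k. r False ^ (4 - k) * r True ^ k"]) (auto simp: power4_eq)

lemma eval4_power4: "eval4 (power4 r) x = (r False + x * r True) ^ 4"
proof -
  have "(r False + x * r True) ^ 4 = (\<Prod>j<4 :: nat. r False + x * r True)" by simp
  also have "\<dots> = (\<Sum>S\<in>Pow {..<4 :: nat}. \<Prod>j<4. if j \<in> S then x * r True else r False)"
    using prod_Pow_bool[of "{..<4 :: nat}" "\<lambda>_ b. if b then x * r True else r False"] by simp
  also have "\<dots> = eval4 (power4 r) x"
    unfolding eval4_def
  proof (rule sum.cong[OF refl])
    fix S assume S: "S \<in> Pow {..<4 :: nat}"
    have "(\<Prod>j<4. if j \<in> S then x * r True else r False) = (\<Prod>j<4. r (j \<in> S) * (if j \<in> S then x else 1))"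
      by (intro prod.cong) auto
    also have "\<dots> = (\<Prod>j<4. r (j \<in> S)) * (\<Prod>j<4. if j \<in> S then x else 1)"
      by (rule prod.distrib)
    also have "(\<Prod>j<4. if j \<in> S then x else 1) = (\<Prod>j\<in>S. x)"
      by (rule prod_if_in) (use S in auto)
    finally show "(\<Prod>j<4. if j \<in> S then x * r True else r False) = power4 r S * x ^ card S"
      using S by (simp add: power4_def)
  qed
  finally show ?thesis by simp
qed

lemma quartic_cols:
  "(\<Sum>J\<in>Pow ({..<n} \<times> {..<4 :: nat}). (\<Prod>j<4. \<Prod>p<n. \<rho> j p ((p, j) \<in> J)) * (\<Prod>j<4. z {k. (k, j) \<in> J}))
    = (\<Prod>j<4. contract_all n z (\<rho> j))"
proof -
  have "(\<Sum>J\<in>Pow ({..<n} \<times> {..<4 :: nat}). (\<Prod>j<4. \<Prod>p<n. \<rho> j p ((p, j) \<in> J)) * (\<Prod>j<4. z {k. (k, j) \<in> J}))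
    = (\<Sum>J\<in>Pow ({..<n} \<times> {..<4}). \<Prod>j<4. (\<lambda>j I. (\<Prod>p<n. \<rho> j p (p \<in> I)) * z I) j {k. (k, j) \<in> J})"
    by (simp add: prod.distrib)
  also have "\<dots> = (\<Prod>j<4. \<Sum>I\<in>Pow {..<n}. (\<Prod>p<n. \<rho> j p (p \<in> I)) * z I)"
    by (rule prod_Pow_cols) auto
  finally show ?thesis by (simp add: contract_def)
qed

definition hyp_factor :: "nat set \<Rightarrow> (nat \<Rightarrow> bool \<Rightarrow> complex) \<Rightarrow> nat \<Rightarrow> nat set \<Rightarrow> complex" where
  "hyp_factor K r p = (if p \<in> K then u22 else power4 (r p))"

lemma u22_eq_sum:
  assumes "S \<subseteq> {..<4}"
  shows "u22 S = (\<Sum>T\<in>Pow {..<4}. u22 T * (\<Prod>j<4. bvec (j \<in> T) (j \<in> S)))"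
proof -
  have "(\<Prod>j<4. bvec (j \<in> T) (j \<in> S)) = of_bool (T = S)" if "T \<in> Pow {..<4}" for T
  proof -
    have "(\<Prod>j<4. bvec (j \<in> T) (j \<in> S)) = of_bool (\<forall>j\<in>{..<4}. (j \<in> T) = (j \<in> S))"
      by (rule prod_eq_of_bool) simp
    also have "(\<forall>j\<in>{..<4}. (j \<in> T) = (j \<in> S)) \<longleftrightarrow> T = S"
      using that assms by blast
    finally show ?thesis .
  qed
  then have "(\<Sum>T\<in>Pow {..<4}. u22 T * (\<Prod>j<4. bvec (j \<in> T) (j \<in> S))) = (\<Sum>T\<in>Pow {..<4}. if T = S then u22 T else 0)"
    by (intro sum.cong) auto
  then show ?thesis using assms by simp
qed

text \<open>The bracket form [02][13] + [03][12] of \<open>u22\<close> on four vectors.\<close>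

lemma u22_bracket:
  "(\<Sum>T\<in>Pow {..<4}. u22 T * (X 0 (0 \<in> T) * X 1 (1 \<in> T) * X 2 (2 \<in> T) * X 3 (3 \<in> T))) =
    (X 0 False * X 2 True - X 0 True * X 2 False) * (X 1 False * X 3 True - X 1 True * X 3 False) +
    (X 0 False * X 3 True - X 0 True * X 3 False) * (X 1 False * X 2 True - X (1 :: nat) True * X (2 :: nat) False)"
proof -
  define a0 a1 a2 a3 b0 b1 b2 b3 where "a0 = X 0 False" "a1 = X 1 False" "a2 = X 2 False" "a3 = X 3 False"
    "b0 = X 0 True" "b1 = X 1 True" "b2 = X 2 True" "b3 = X 3 True"
  note x = a0_a1_a2_a3_b0_b1_b2_b3_def
  show ?thesis
    unfolding u22_sum x[symmetric] by (simp add: x[symmetric, unfolded One_nat_def] x[symmetric]) (simp add: algebra_simps)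
qed

lemma prod_lessThan_4: "(\<Prod>j<(4::nat). f j) = f 0 * f 1 * f 2 * (f 3 :: complex)"
  by (simp add: eval_nat_numeral)

text \<open>Cayley's invariant in symbolic form, one \<open>u22\<close> for each factor. The scalar
  is seen at the array with two opposite entries
  \<open>W False False False = W True True True = 1\<close> and zeros elsewhere, where the left side
  is the sum of \<open>u22 T ^ 3\<close>.\<close>

lemma u22_cubed: "(\<Sum>T1\<in>Pow {..<4}. u22 T1 * (\<Sum>T2\<in>Pow {..<4}. u22 T2 * (\<Sum>T3\<in>Pow {..<4}. u22 T3 *
    (\<Prod>j<4. W (j \<in> T1) (j \<in> T2) (j \<in> T3))))) = 12 * cayley W"
proof -
  define x0 x1 x2 x3 x4 x5 x6 x7 where "x0 = W False False False" "x1 = W False False True"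
    "x2 = W False True False" "x3 = W False True True" "x4 = W True False False" "x5 = W True False True"
    "x6 = W True True False" "x7 = W True True True"
  note x = x0_x1_x2_x3_x4_x5_x6_x7_def
  have inner: "(\<Sum>T3\<in>Pow {..<4}. u22 T3 * (\<Prod>j<4. W (j \<in> T1) (j \<in> T2) (j \<in> T3))) =
     (let B = (\<lambda>i j. W (i \<in> T1) (i \<in> T2) False * W (j \<in> T1) (j \<in> T2) True - W (i \<in> T1) (i \<in> T2) True * W (j \<in> T1) (j \<in> T2) False)
      in B 0 2 * B 1 3 + B 0 3 * B (1 :: nat) (2 :: nat))" for T1 T2
    unfolding prod_lessThan_4 Let_def
    using u22_bracket[of "\<lambda>j b. W (j \<in> T1) (j \<in> T2) b"] by simp
  show ?thesis
    unfolding inner u22_sum Let_def cayley_def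
    by (simp add: x[symmetric] power2_eq_square algebra_simps)
qed

lemma sum_pull:
  fixes Z :: "'a \<Rightarrow> complex"
  shows "(\<Sum>J\<in>A. (\<Sum>T\<in>B. u T * g T J) * Z J) = (\<Sum>T\<in>B. u T * (\<Sum>J\<in>A. g T J * Z J))"
  unfolding sum_distrib_left sum_distrib_right mult.assoc by (rule sum.swap)

text \<open>Expanding the three \<open>u22\<close> into unit covectors turns the form into products
  of four full contractions, one per copy; the sums over \<open>T1\<close>, \<open>T2\<close>,
  \<open>T3\<close> are then those of \<open>u22_cubed\<close>.\<close>

lemma quartic_hyp_factor:
  assumes d: "distinct3 n i j k"
  shows "quartic n (pure_tensor n (hyp_factor {i, j, k} r)) z = 12 * slice_hyperdet n i j k r z"
proof -
  define \<rho> where "\<rho> T1 T2 T3 l = r(i := bvec (l \<in> T1), j := bvec (l \<in> T2), k := bvec (l \<in> T3))" for T1 T2 T3 and l :: nat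
  define G where "G T1 T2 T3 J = (\<Prod>l<4. \<Prod>p<n. \<rho> T1 T2 T3 l p ((p, l) \<in> J))" for T1 T2 T3 J
  define Z where "Z J = (\<Prod>l<(4 :: nat). z {k. (k, l) \<in> J})" for J
  have lt: "i < n" "j < n" "k < n" "i \<noteq> j" "i \<noteq> k" "j \<noteq> k" using d by (auto simp: distinct3_def)
  have split: "(\<Prod>p<n. f p) = f i * f j * f k * (\<Prod>p\<in>{..<n} - {i, j, k}. f p)" for f :: "nat \<Rightarrow> complex"
    using prod.subset_diff[of "{i, j, k}" "{..<n}" f] lt by (simp add: mult_ac)
  have pure: "pure_tensor n (hyp_factor {i, j, k} r) J = (\<Sum>T1\<in>Pow {..<4}. u22 T1 * (\<Sum>T2\<in>Pow {..<4}. u22 T2 * (\<Sum>T3\<in>Pow {..<4}. u22 T3 * G T1 T2 T3 J)))"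
    if J: "J \<in> Pow ({..<n} \<times> {..<4})" for J
  proof -
    define R where "R = (\<Prod>p\<in>{..<n} - {i, j, k}. \<Prod>l<(4::nat). r p ((p, l) \<in> J))"
    define E where "E q T = (\<Prod>l<4. bvec (l \<in> T) ((q, l) \<in> J))" for q and T :: "nat set"
    have row: "J `` {q} \<subseteq> {..<4}" for q using J by auto
    have E: "(\<Sum>T\<in>Pow {..<4}. u22 T * E q T) = u22 (J `` {q})" for q
      using u22_eq_sum[OF row[of q]] by (simp add: E_def)
    have G: "G T1 T2 T3 J = E k T3 * (E j T2 * (E i T1 * R))" for T1 T2 T3
    proof -
      have "G T1 T2 T3 J = (\<Prod>p<n. \<Prod>l<4. \<rho> T1 T2 T3 l p ((p, l) \<in> J))"
        unfolding G_def by (rule prod.swap)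
      also have "\<dots> = E i T1 * E j T2 * E k T3 * (\<Prod>p\<in>{..<n} - {i, j, k}. \<Prod>l<4. \<rho> T1 T2 T3 l p ((p, l) \<in> J))"
        unfolding split using lt by (simp add: \<rho>_def E_def)
      also have "(\<Prod>p\<in>{..<n} - {i, j, k}. \<Prod>l<4. \<rho> T1 T2 T3 l p ((p, l) \<in> J)) = R"
        unfolding R_def by (rule prod.cong) (auto simp: \<rho>_def)
      finally show ?thesis by simp
    qed
    have step: "(\<Sum>T\<in>Pow {..<4}. u22 T * (E q T * c)) = u22 (J `` {q}) * c" for q c
      unfolding E[symmetric] sum_distrib_right by (simp add: mult.assoc)
    have rr: "hyp_factor {i, j, k} r p (J `` {p}) = (\<Prod>l<4. r p ((p, l) \<in> J))" if "p \<in> {..<n} - {i, j, k}" for p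
      using that row[of p] by (simp add: hyp_factor_def power4_def)
    have "(\<Prod>p\<in>{..<n} - {i, j, k}. hyp_factor {i, j, k} r p (J `` {p})) = R"
      unfolding R_def by (rule prod.cong[OF refl rr])
    then have "(\<Prod>p<n. hyp_factor {i, j, k} r p (J `` {p})) = u22 (J `` {i}) * u22 (J `` {j}) * u22 (J `` {k}) * R"
      unfolding split by (simp add: hyp_factor_def)
    moreover have "J \<subseteq> {..<n} \<times> UNIV" using J by auto
    ultimately have 1: "pure_tensor n (hyp_factor {i, j, k} r) J = u22 (J `` {i}) * (u22 (J `` {j}) * (u22 (J `` {k}) * R))"
      by (simp add: pure_tensor_def)
    have step': "(\<Sum>T\<in>Pow {..<4}. u22 T * (a * (E q T * c))) = a * (u22 (J `` {q}) * c)" for q a c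
      unfolding E[symmetric] sum_distrib_right sum_distrib_left by (simp add: mult_ac)
    have "(\<Sum>T1\<in>Pow {..<4}. u22 T1 * (\<Sum>T2\<in>Pow {..<4}. u22 T2 * (\<Sum>T3\<in>Pow {..<4}. u22 T3 * G T1 T2 T3 J)))
      = (\<Sum>T1\<in>Pow {..<4}. u22 T1 * (\<Sum>T2\<in>Pow {..<4}. u22 T2 * (u22 (J `` {k}) * (E j T2 * (E i T1 * R)))))"
      unfolding G step ..
    also have "\<dots> = (\<Sum>T1\<in>Pow {..<4}. u22 T1 * (u22 (J `` {k}) * (u22 (J `` {j}) * (E i T1 * R))))"
      unfolding step' ..
    also have "\<dots> = (\<Sum>T1\<in>Pow {..<4}. u22 T1 * ((u22 (J `` {k}) * u22 (J `` {j})) * (E i T1 * R)))"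
      by (simp only: mult.assoc)
    also have "\<dots> = (u22 (J `` {k}) * u22 (J `` {j})) * (u22 (J `` {i}) * R)"
      by (rule step')
    also have "\<dots> = pure_tensor n (hyp_factor {i, j, k} r) J"
      unfolding 1 by simp
    finally show ?thesis by simp
  qed
  have "quartic n (pure_tensor n (hyp_factor {i, j, k} r)) z = (\<Sum>J\<in>Pow ({..<n} \<times> {..<4}).
      (\<Sum>T1\<in>Pow {..<4}. u22 T1 * (\<Sum>T2\<in>Pow {..<4}. u22 T2 * (\<Sum>T3\<in>Pow {..<4}. u22 T3 * G T1 T2 T3 J))) * Z J)"
    unfolding quartic_def Z_def by (intro sum.cong refl arg_cong2[where f = "(*)"] pure)
  also have "\<dots> = (\<Sum>T1\<in>Pow {..<4}. u22 T1 * (\<Sum>T2\<in>Pow {..<4}. u22 T2 * (\<Sum>T3\<in>Pow {..<4}. u22 T3 *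
      (\<Sum>J\<in>Pow ({..<n} \<times> {..<4}). G T1 T2 T3 J * Z J))))"
    unfolding sum_pull ..
  also have "\<dots> = (\<Sum>T1\<in>Pow {..<4}. u22 T1 * (\<Sum>T2\<in>Pow {..<4}. u22 T2 * (\<Sum>T3\<in>Pow {..<4}. u22 T3 *
      (\<Prod>l<4. contract_all n z (\<rho> T1 T2 T3 l)))))"
    unfolding G_def Z_def quartic_cols ..
  also have "\<dots> = 12 * slice_hyperdet n i j k r z"
    unfolding \<rho>_def slice_hyperdet_def
    by (rule u22_cubed[of "\<lambda>a b c. contract_all n z (r(i := bvec a, j := bvec b, k := bvec c))"])
  finally show ?thesis .
qed

lemma sum_Pow_insert_card:
  assumes "finite Q" "m \<notin> Q"
  shows "(\<Sum>S\<in>Pow (insert m Q). f (card S)) = (\<Sum>S\<in>Pow Q. f (card S)) + (\<Sum>S\<in>Pow Q. f (Suc (card S)) :: complex)"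
proof -
  have "(\<Sum>S\<in>Pow (insert m Q). f (card S)) = (\<Sum>S\<in>Pow Q. f (card S)) + (\<Sum>S\<in>insert m ` Pow Q. f (card S))"
    unfolding Pow_insert using assms by (intro sum.union_disjoint) auto
  also have "(\<Sum>S\<in>insert m ` Pow Q. f (card S)) = (\<Sum>S\<in>Pow Q. f (Suc (card S)))"
  proof (intro sum.reindex_cong[where l = "insert m"])
    fix S assume "S \<in> Pow Q"
    then have "finite S" "m \<notin> S" using assms finite_subset by auto
    then show "f (card (insert m S)) = f (Suc (card S))" by simp
  qed (use assms in \<open>auto simp: inj_on_def\<close>)
  finally show ?thesis .
qed

definition sym4 :: "(nat \<Rightarrow> complex) \<Rightarrow> nat set \<Rightarrow> complex" where
  "sym4 c S = (if S \<subseteq> {..<4} then c (card S) else 0)"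

lemma schur_4_sym4: "schur [4] = range sym4"
  by (auto simp: schur_4 sym4_def[abs_def])

lemma eval4_sym4: "eval4 (sym4 c) x = c 0 + 4 * c 1 * x + 6 * c 2 * x ^ 2 + 4 * c 3 * x ^ 3 + c 4 * x ^ 4"
proof -
  have s: "{..<4 :: nat} = insert 3 (insert 2 (insert 1 (insert 0 {})))" by auto
  have "eval4 (sym4 c) x = (\<Sum>S\<in>Pow {..<4 :: nat}. (\<lambda>m. c m * x ^ m) (card S))"
    unfolding eval4_def by (rule sum.cong) (auto simp: sym4_def)
  also have "\<dots> = c 0 + 4 * c 1 * x + 6 * c 2 * x ^ 2 + 4 * c 3 * x ^ 3 + c 4 * x ^ 4"
    unfolding s
    by (subst sum_Pow_insert_card, simp, simp)+ (simp add: eval_nat_numeral algebra_simps)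
  finally show ?thesis .
qed

text \<open>Row \<open>m\<close> recovers the \<open>m\<close>-th coefficient of a polynomial of degree 4, divided by \<open>4 choose m\<close>,
  from its values at \<open>0, \<dots>, 4\<close> (Lagrange interpolation).\<close>
definition interp :: "nat \<Rightarrow> nat \<Rightarrow> complex" where
  "interp m i = ([[1, 0, 0, 0, 0], [-25/48, 1, -3/4, 1/3, -1/16], [35/144, -13/18, 19/24, -7/18, 11/144],
     [-5/48, 3/8, -1/2, 7/24, -1/16], [1/24, -1/6, 1/4, -1/6, 1/24]] ! m) ! i"

lemma interp_eval4:
  assumes "m \<le> 4"
  shows "(\<Sum>i\<le>4. interp m i * eval4 (sym4 c) (of_nat i)) = c m"
proof -
  have "m = 0 \<or> m = 1 \<or> m = 2 \<or> m = 3 \<or> m = 4" using assms by auto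
  then show ?thesis
    unfolding eval4_sym4 by (elim disjE) (simp_all add: interp_def eval_nat_numeral field_simps)
qed

text \<open>Fourth powers of the five covectors (1, i) span the symmetric tensors. The coefficients
  are transposed interpolation weights, with the binomials 1, 4, 6, 4, 1 that \<open>interp\<close>
  had divided out.\<close>

lemma sym4_eq_powers:
  obtains a where "\<And>S. sym4 c S = (\<Sum>i\<le>4. a i * power4 (\<lambda>b. if b then of_nat i else 1) S)"
proof -
  define a where "a i = c 0 * interp 0 i + 4 * c 1 * interp 1 i + 6 * c 2 * interp 2 i + 4 * c 3 * interp 3 i + c 4 * interp 4 i" for i
  have *: "(\<Sum>i\<le>4. a i * of_nat i ^ m) = c m" if "m \<le> 4" for m :: nat
  proof -
    have "m = 0 \<or> m = 1 \<or> m = 2 \<or> m = 3 \<or> m = 4" using that by auto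
    then show ?thesis
      by (elim disjE) (simp_all add: a_def interp_def eval_nat_numeral field_simps)
  qed
  show ?thesis
  proof (rule that[of a])
    fix S
    show "sym4 c S = (\<Sum>i\<le>4. a i * power4 (\<lambda>b. if b then of_nat i else 1) S)"
    proof (cases "S \<subseteq> {..<4}")
      case True
      then have "card S \<le> 4" using card_mono[OF _ True] by simp
      with True *[OF this] show ?thesis by (simp add: sym4_def power4_eq)
    qed (simp add: sym4_def power4_def)
  qed
qed

section \<open>The summands, indexed by triples of positions\<close>

definition triples :: "nat \<Rightarrow> nat set set" where
  "triples n = {K. K \<subseteq> {..<n} \<and> card K = 3}"

definition shape :: "nat \<Rightarrow> nat set \<Rightarrow> nat list list" where
  "shape n K = map (\<lambda>k. if k \<in> K then [2, 2] else [4]) [0..<n]"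

lemma finite_triples: "finite (triples n)"
  by (rule finite_subset[of _ "Pow {..<n}"]) (auto simp: triples_def)

lemma triples_obtain:
  assumes "K \<in> triples n"
  obtains i j k where "distinct3 n i j k" "K = {i, j, k}"
proof -
  obtain i j k where K: "K = {i, j, k}" "i \<noteq> j" "i \<noteq> k" "j \<noteq> k"
    using assms by (auto simp: triples_def card_3_iff)
  with assms have "distinct3 n i j k" by (auto simp: triples_def distinct3_def)
  with K show ?thesis by (intro that)
qed

lemma distinct3_triples: "distinct3 n i j k \<Longrightarrow> {i, j, k} \<in> triples n"
  by (auto simp: triples_def distinct3_def)

lemma mset_qs_iff:
  assumes "n \<ge> 3"
  shows "mset qs = mset ([[2, 2], [2, 2], [2, 2]] @ replicate (n - 3) [4 :: nat]) \<longleftrightarrow> (\<exists>K\<in>triples n. qs = shape n K)"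
    (is "mset qs = mset ?ps \<longleftrightarrow> _")
proof
  assume m: "mset qs = mset ?ps"
  then have len: "length qs = n" using mset_eq_length[OF m] assms by simp
  have "set qs = set ?ps" using m by (rule mset_eq_setD)
  then have vals: "qs ! k = [2, 2] \<or> qs ! k = [4]" if "k < n" for k
    using nth_mem[of k qs] that len by (auto split: if_splits)
  define K where "K = {k. k < n \<and> qs ! k = [2, 2]}"
  have "card K = length (filter (\<lambda>x. x = [2, 2]) qs)"
    unfolding K_def length_filter_conv_card len ..
  also have "\<dots> = size (filter_mset (\<lambda>x. x = [2, 2]) (mset qs))"
    by (metis mset_filter size_mset)
  also have "\<dots> = 3" unfolding m by (simp add: filter_replicate flip: mset_filter)
  finally have "K \<in> triples n" by (auto simp: triples_def K_def)
  moreover have "qs = shape n K"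
    by (rule nth_equalityI) (use len vals in \<open>auto simp: shape_def K_def\<close>)
  ultimately show "\<exists>K\<in>triples n. qs = shape n K" by blast
next
  assume "\<exists>K\<in>triples n. qs = shape n K"
  then obtain K where K: "K \<subseteq> {..<n}" "card K = 3" and qs: "qs = shape n K" by (auto simp: triples_def)
  have c: "count (mset (map f [0..<n])) x = card {k. k < n \<and> f k = x}" for f :: "nat \<Rightarrow> nat list" and x
    unfolding count_mset count_list_eq_length_filter length_filter_conv_card
    by (intro arg_cong[where f = card]) auto
  show "mset qs = mset ?ps"
  proof (rule multiset_eqI)
    fix x
    have "count (mset qs) x = card {k. k < n \<and> (if k \<in> K then [2, 2] else [4]) = x}"
      unfolding qs shape_def by (rule c)
    also have "{k. k < n \<and> (if k \<in> K then [2, 2] else [4]) = x} =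
        (if x = [2, 2] then K else if x = [4] then {..<n} - K else {})"
      using K by auto
    also have "card \<dots> = count (mset ?ps) x"
      using K finite_subset[OF K(1)] by (simp add: card_Diff_subset)
    finally show "count (mset qs) x = count (mset ?ps) x" .
  qed
qed

lemma shape_inj: "K \<subseteq> {..<n} \<Longrightarrow> K' \<subseteq> {..<n} \<Longrightarrow> shape n K = shape n K' \<Longrightarrow> K = K'"
proof -
  assume K: "K \<subseteq> {..<n}" "K' \<subseteq> {..<n}" and eq: "shape n K = shape n K'"
  have "shape n L ! k = (if k \<in> L then [2, 2] else [4])" if "k < n" for k L
    using that by (simp add: shape_def)
  with eq have "k \<in> K \<longleftrightarrow> k \<in> K'" if "k < n" for k
    using that by (metis list.inject list.distinct(1))
  with K show "K = K'" by auto
qed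

lemma schur_tensor_shape:
  "schur_tensor (shape n K) = cfun.span {pure_tensor n u | u. \<forall>k<n. u k \<in> schur (if k \<in> K then [2, 2] else [4])}"
proof -
  have 1: "(\<forall>k<n. u k \<in> schur (shape n K ! k)) \<longleftrightarrow> (\<forall>k<n. u k \<in> schur (if k \<in> K then [2, 2] else [4]))" for u
    by (auto simp: shape_def)
  have 2: "length (shape n K) = n" by (simp add: shape_def)
  show ?thesis by (simp only: schur_tensor_def pure_tensor_def[abs_def] 1 2)
qed

text \<open>A left inverse of \<open>quartic\<close> on the summand \<open>K\<close> that uses
  values at test tensors only. In the positions of \<open>K\<close> the tensor is a multiple of
  \<open>u22\<close>, and 1/12 undoes the sum of cubes; in every other position
  \<open>interp\<close> recovers the coefficient belonging to the size of the row.\<close>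

definition component_of_poly :: "nat \<Rightarrow> nat set \<Rightarrow> ((nat set \<Rightarrow> complex) \<Rightarrow> complex) \<Rightarrow> (nat \<times> nat) set \<Rightarrow> complex" where
  "component_of_poly n K f J = (if J \<subseteq> {..<n} \<times> {..<4} then
     1 / 12 * (\<Prod>k\<in>K. u22 (J `` {k})) * (\<Sum>\<iota>\<in>PiE ({..<n} - K) (\<lambda>_. {..4}).
       (\<Prod>p\<in>{..<n} - K. interp (card (J `` {p})) (\<iota> p)) * f (test_tensor K (\<lambda>p. of_nat (\<iota> p)))) else 0)"

lemma component_of_poly_add: "component_of_poly n K (f + g) = component_of_poly n K f + component_of_poly n K g"
  by (auto simp: component_of_poly_def fun_eq_iff algebra_simps sum.distrib)

lemma component_of_poly_fscale: "component_of_poly n K (fscale c f) = fscale c (component_of_poly n K f)"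
  by (auto simp: component_of_poly_def fun_eq_iff fscale_def sum_distrib_left mult_ac)

lemma u22_power_sum: "(\<Sum>T\<in>Pow {..<4}. u22 T ^ 3) = 12"
proof -
  have "(\<Sum>T\<in>Pow {..<4}. u22 T ^ 3) = (\<Sum>T\<in>Pow {..<4}. u22 T * u22 T ^ 2)"
    by (simp add: power3_eq_cube power2_eq_square mult.assoc)
  also have "\<dots> = 12" unfolding u22_sum by (simp del: One_nat_def)
  finally show ?thesis .
qed

lemma component_of_poly_quartic_pure:
  assumes K: "K \<in> triples n" and u: "\<forall>k<n. u k \<in> schur (if k \<in> K then [2, 2] else [4])"
  shows "component_of_poly n K (quartic n (pure_tensor n u)) = pure_tensor n u"
proof
  fix J
  have Kn: "K \<subseteq> {..<n}" "card K = 3" "finite K" "K \<noteq> {}"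
    using K finite_subset by (auto simp: triples_def)
  have "\<exists>c. u k = fscale c u22" if "k \<in> K" for k
  proof -
    have "k < n" using Kn that by auto
    then have "u k \<in> schur [2, 2]" using u that by auto
    then show ?thesis by (auto simp: schur_22)
  qed
  then obtain a where a: "\<And>k. k \<in> K \<Longrightarrow> u k = fscale (a k) u22" by metis
  have "\<exists>c. u k = sym4 c" if "k \<in> {..<n} - K" for k
  proof -
    have "u k \<in> schur [4]" using u that by auto
    then show ?thesis by (auto simp: schur_4_sym4)
  qed
  then obtain c where c: "\<And>k. k \<in> {..<n} - K \<Longrightarrow> u k = sym4 (c k)" by metis
  show "component_of_poly n K (quartic n (pure_tensor n u)) J = pure_tensor n u J"
  proof (cases "J \<subseteq> {..<n} \<times> {..<4}")
    case False
    have "pure_tensor n u J = 0"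
    proof (cases "J \<subseteq> {..<n} \<times> UNIV")
      case True
      then obtain k j where kj: "(k, j) \<in> J" "k < n" "\<not> j < 4" using False by auto
      then have "\<not> J `` {k} \<subseteq> {..<4}" by auto
      then have "u k (J `` {k}) = 0"
        using a[of k] c[of k] kj by (cases "k \<in> K") (auto simp: fscale_def u22_def sym4_def)
      then have "(\<Prod>k<n. u k (J `` {k})) = 0" using kj by (auto intro!: prod_zero)
      then show ?thesis by (simp add: pure_tensor_def)
    qed (simp add: pure_tensor_def)
    then show ?thesis using False by (simp add: component_of_poly_def)
  next
    case True
    have row: "J `` {p} \<subseteq> {..<4}" for p using True by auto
    have "(\<Sum>T\<in>Pow {..<4}. \<Prod>k\<in>K. u k T) = (\<Sum>T\<in>Pow {..<4}. (\<Prod>k\<in>K. a k) * u22 T ^ 3)"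
    proof (rule sum.cong[OF refl])
      fix T
      have "(\<Prod>k\<in>K. u k T) = (\<Prod>k\<in>K. a k * u22 T)"
        by (rule prod.cong) (simp_all add: a fscale_def)
      then show "(\<Prod>k\<in>K. u k T) = (\<Prod>k\<in>K. a k) * u22 T ^ 3"
        using Kn by (simp add: prod.distrib)
    qed
    then have S: "(\<Sum>T\<in>Pow {..<4}. \<Prod>k\<in>K. u k T) = (\<Prod>k\<in>K. a k) * 12"
      by (simp add: sum_distrib_left[symmetric] u22_power_sum)
    have "(\<Sum>\<iota>\<in>PiE ({..<n} - K) (\<lambda>_. {..4}). (\<Prod>p\<in>{..<n} - K. interp (card (J `` {p})) (\<iota> p)) *
         quartic n (pure_tensor n u) (test_tensor K (\<lambda>p. of_nat (\<iota> p))))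
      = (\<Sum>\<iota>\<in>PiE ({..<n} - K) (\<lambda>_. {..4}). (\<Prod>k\<in>K. a k) * 12 *
         (\<Prod>p\<in>{..<n} - K. interp (card (J `` {p})) (\<iota> p) * eval4 (u p) (of_nat (\<iota> p))))"
      unfolding quartic_pure_test_tensor[OF Kn(1,4)] S prod.distrib by (simp add: mult_ac)
    also have "\<dots> = (\<Prod>k\<in>K. a k) * 12 *
        (\<Prod>p\<in>{..<n} - K. \<Sum>i\<le>4. interp (card (J `` {p})) i * eval4 (u p) (of_nat i))"
      unfolding sum_distrib_left[symmetric] by (subst prod_sum_PiE) auto
    also have "(\<Prod>p\<in>{..<n} - K. \<Sum>i\<le>4. interp (card (J `` {p})) i * eval4 (u p) (of_nat i))
        = (\<Prod>p\<in>{..<n} - K. u p (J `` {p}))"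
    proof (rule prod.cong[OF refl])
      fix p assume p: "p \<in> {..<n} - K"
      have "card (J `` {p}) \<le> 4" using card_mono[OF _ row[of p]] by simp
      then show "(\<Sum>i\<le>4. interp (card (J `` {p})) i * eval4 (u p) (of_nat i)) = u p (J `` {p})"
        using row[of p] by (simp add: c[OF p] interp_eval4) (simp add: sym4_def)
    qed
    finally have "component_of_poly n K (quartic n (pure_tensor n u)) J =
        (\<Prod>k\<in>K. u22 (J `` {k})) * (\<Prod>k\<in>K. a k) * (\<Prod>p\<in>{..<n} - K. u p (J `` {p}))"
      using True by (simp add: component_of_poly_def)
    also have "(\<Prod>k\<in>K. u22 (J `` {k})) * (\<Prod>k\<in>K. a k) = (\<Prod>k\<in>K. u k (J `` {k}))"
      unfolding prod.distrib[symmetric] by (rule prod.cong) (simp_all add: a fscale_def)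
    also have "(\<Prod>k\<in>K. u k (J `` {k})) * (\<Prod>p\<in>{..<n} - K. u p (J `` {p})) = (\<Prod>k<n. u k (J `` {k}))"
      using prod.subset_diff[OF Kn(1), of "\<lambda>k. u k (J `` {k})"] by simp
    also have "\<dots> = pure_tensor n u J"
      using True by (auto simp: pure_tensor_def)
    finally show ?thesis .
  qed
qed

text \<open>Distinct triples have equal size, so some position of \<open>K'\<close> lies outside
  \<open>K\<close>; there a multiple of \<open>u22\<close> is evaluated at the fourth power of a
  vector.\<close>

lemma quartic_pure_test_tensor_other:
  assumes K: "K \<in> triples n" "K' \<in> triples n" "K \<noteq> K'" and u: "\<forall>k<n. u k \<in> schur (if k \<in> K' then [2, 2] else [4])"
  shows "quartic n (pure_tensor n u) (test_tensor K v) = 0"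
proof -
  have Kn: "K \<subseteq> {..<n}" "card K = 3" "K' \<subseteq> {..<n}" "card K' = 3" "finite K" "finite K'" "K \<noteq> {}"
    using K finite_subset by (auto simp: triples_def)
  have "\<not> K' \<subseteq> K" using card_subset_eq[OF Kn(5), of K'] Kn K(3) by auto
  then obtain p where p: "p \<in> K'" "p \<notin> K" by auto
  then have "p < n" using Kn by auto
  then have "u p \<in> range (\<lambda>c. fscale c u22)" using u p by (auto simp: schur_22)
  then have "eval4 (u p) (v p) = 0" by (auto simp: eval4_u22)
  then have "(\<Prod>p\<in>{..<n} - K. eval4 (u p) (v p)) = 0"
    using p \<open>p < n\<close> by (intro prod_zero) auto
  then show ?thesis by (simp add: quartic_pure_test_tensor[OF Kn(1,7)])
qed

section \<open>The isomorphism with the sum of Schur modules\<close>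

lemma HD_add: "f \<in> HD n \<Longrightarrow> g \<in> HD n \<Longrightarrow> f + g \<in> HD n"
  unfolding HD_def by (rule cfun.span_add)

lemma HD_scale: "f \<in> HD n \<Longrightarrow> fscale c f \<in> HD n"
  unfolding HD_def by (rule cfun.span_scale)

lemma HD_sum: "(\<And>i. i \<in> S \<Longrightarrow> f i \<in> HD n) \<Longrightarrow> (\<Sum>i\<in>S. f i) \<in> HD n"
  unfolding HD_def by (rule cfun.span_sum)

lemma HD_zero: "0 \<in> HD n"
  unfolding HD_def by (rule cfun.span_zero)

lemma slice_hyperdet_in_HD: "n \<ge> 3 \<Longrightarrow> distinct3 n i j k \<Longrightarrow> slice_hyperdet n i j k r \<in> HD n"
  unfolding HD_eq by (rule cfun.span_base) (auto simp: slice_hyperdets_def)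

lemma quartic_zero: "quartic n 0 z = 0"
  by (simp add: quartic_def)

lemma quartic_zero_fun: "quartic n 0 = 0"
  by (rule ext) (simp add: quartic_zero)

lemma component_of_poly_zero: "component_of_poly n K 0 = 0"
  by (rule ext) (simp add: component_of_poly_def)

lemma quartic_add_fun: "quartic n (X + Y) = quartic n X + quartic n Y"
  by (rule ext) (simp add: quartic_add)

lemma quartic_fscale_fun: "quartic n (fscale c X) = fscale c (quartic n X)"
  by (rule ext) (simp add: quartic_fscale, simp add: fscale_def)

text \<open>Writing each symmetric factor as a combination of fourth powers turns the pure tensor
  into a combination of tensors built from \<open>hyp_factor\<close>, whose forms are multiples of
  hyperdeterminants.\<close>

lemma quartic_pure_in_HD:
  assumes n: "n \<ge> 3" and K: "K \<in> triples n" and u: "\<forall>k<n. u k \<in> schur (if k \<in> K then [2, 2] else [4])"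
  shows "quartic n (pure_tensor n u) \<in> HD n"
proof -
  let ?C = "{..<n} - K" and ?I = "PiE ({..<n} - K) (\<lambda>_. {..4 :: nat})"
  have Kn: "K \<subseteq> {..<n}" using K by (auto simp: triples_def)
  obtain i j k where d: "distinct3 n i j k" and Ke: "K = {i, j, k}" using triples_obtain[OF K] .
  have "\<exists>c. u k = fscale c u22" if "k \<in> K" for k
  proof -
    have "k < n" using Kn that by auto
    then have "u k \<in> schur [2, 2]" using u that by auto
    then show ?thesis by (auto simp: schur_22)
  qed
  then obtain a where a: "\<And>k. k \<in> K \<Longrightarrow> u k = fscale (a k) u22" by metis
  define rr where "rr i b = (if b then of_nat i else 1 :: complex)" for i :: nat and b
  have "\<exists>\<alpha>. \<forall>S. u p S = (\<Sum>i\<le>4. \<alpha> i * power4 (rr i) S)" if "p \<in> ?C" for p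
  proof -
    have "u p \<in> schur [4]" using u that by auto
    then obtain c where "u p = sym4 c" by (auto simp: schur_4_sym4)
    then show ?thesis using sym4_eq_powers[of c] unfolding rr_def by metis
  qed
  then obtain \<alpha> where \<alpha>: "\<And>p S. p \<in> ?C \<Longrightarrow> u p S = (\<Sum>i\<le>4. \<alpha> p i * power4 (rr i) S)" by metis
  define m where "m \<iota> = (\<Prod>k\<in>K. a k) * (\<Prod>p\<in>?C. \<alpha> p (\<iota> p))" for \<iota> :: "nat \<Rightarrow> nat"
  have split: "(\<Prod>p<n. f p) = (\<Prod>p\<in>?C. f p) * (\<Prod>p\<in>K. f p)" for f :: "nat \<Rightarrow> complex"
    by (rule prod.subset_diff[OF Kn]) simp
  have p: "pure_tensor n u J = (\<Sum>\<iota>\<in>?I. m \<iota> * pure_tensor n (hyp_factor K (\<lambda>p. rr (\<iota> p))) J)" for J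
  proof (cases "J \<subseteq> {..<n} \<times> UNIV")
    case True
    have 1: "(\<Prod>k\<in>K. u k (J `` {k})) = (\<Prod>k\<in>K. a k) * (\<Prod>k\<in>K. u22 (J `` {k}))"
      unfolding prod.distrib[symmetric] by (rule prod.cong) (simp_all add: a fscale_def)
    have "(\<Prod>p\<in>?C. u p (J `` {p})) = (\<Prod>p\<in>?C. \<Sum>i\<le>4. \<alpha> p i * power4 (rr i) (J `` {p}))"
      by (rule prod.cong) (simp_all add: \<alpha>)
    also have "\<dots> = (\<Sum>\<iota>\<in>?I. \<Prod>p\<in>?C. \<alpha> p (\<iota> p) * power4 (rr (\<iota> p)) (J `` {p}))"
      by (rule prod_sum_PiE) auto
    finally have 2: "(\<Prod>p\<in>?C. u p (J `` {p})) = \<dots>" .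
    have "pure_tensor n (hyp_factor K (\<lambda>p. rr (\<iota> p))) J = (\<Prod>p\<in>?C. power4 (rr (\<iota> p)) (J `` {p})) * (\<Prod>k\<in>K. u22 (J `` {k}))" for \<iota>
      using True by (simp add: pure_tensor_def split) (simp add: hyp_factor_def)
    then show ?thesis
      using True by (simp add: pure_tensor_def split 1 2 m_def prod.distrib sum_distrib_left sum_distrib_right mult_ac)
  qed (simp add: pure_tensor_def)
  have "quartic n (pure_tensor n u) = (\<Sum>\<iota>\<in>?I. fscale (12 * m \<iota>) (slice_hyperdet n i j k (\<lambda>p. rr (\<iota> p))))"
  proof
    fix z
    have "quartic n (pure_tensor n u) z = (\<Sum>\<iota>\<in>?I. m \<iota> * quartic n (pure_tensor n (hyp_factor K (\<lambda>p. rr (\<iota> p)))) z)"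
      unfolding quartic_def p sum_distrib_left sum_distrib_right
      by (subst sum.swap) (simp add: mult.assoc)
    also have "\<dots> = (\<Sum>\<iota>\<in>?I. 12 * m \<iota> * slice_hyperdet n i j k (\<lambda>p. rr (\<iota> p)) z)"
      unfolding Ke quartic_hyp_factor[OF d] by (simp add: mult_ac)
    finally show "quartic n (pure_tensor n u) z = (\<Sum>\<iota>\<in>?I. fscale (12 * m \<iota>) (slice_hyperdet n i j k (\<lambda>p. rr (\<iota> p)))) z"
      by (simp add: sum_fun_apply fscale_def)
  qed
  then show ?thesis
    by (simp only:) (intro HD_sum HD_scale slice_hyperdet_in_HD[OF n d])
qed

lemma quartic_in_HD:
  assumes "n \<ge> 3" "K \<in> triples n" "X \<in> schur_tensor (shape n K)"
  shows "quartic n X \<in> HD n"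
  using assms(3)[unfolded schur_tensor_shape]
proof (induction rule: cfun.span_induct_alt)
  case base
  show ?case unfolding quartic_zero_fun by (rule HD_zero)
next
  case (step c x y)
  then obtain u where "x = pure_tensor n u" "\<forall>k<n. u k \<in> schur (if k \<in> K then [2, 2] else [4])" by blast
  then have "quartic n x \<in> HD n" using quartic_pure_in_HD[OF assms(1,2)] by simp
  with step(2) show ?case
    unfolding quartic_add_fun quartic_fscale_fun by (intro HD_add HD_scale)
qed

lemma component_of_poly_quartic:
  assumes "K \<in> triples n" "X \<in> schur_tensor (shape n K)"
  shows "component_of_poly n K (quartic n X) = X"
  using assms(2)[unfolded schur_tensor_shape]
proof (induction rule: cfun.span_induct_alt)
  case base
  show ?case unfolding quartic_zero_fun by (rule component_of_poly_zero)
next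
  case (step c x y)
  then obtain u where "x = pure_tensor n u" "\<forall>k<n. u k \<in> schur (if k \<in> K then [2, 2] else [4])" by blast
  then have "component_of_poly n K (quartic n x) = x" using component_of_poly_quartic_pure[OF assms(1)] by simp
  with step(2) show ?case
    unfolding quartic_add_fun quartic_fscale_fun component_of_poly_add component_of_poly_fscale by simp
qed

lemma quartic_test_tensor_other:
  assumes "K \<in> triples n" "K' \<in> triples n" "K \<noteq> K'" "X \<in> schur_tensor (shape n K')"
  shows "quartic n X (test_tensor K v) = 0"
  using assms(4)[unfolded schur_tensor_shape]
proof (induction rule: cfun.span_induct_alt)
  case base
  show ?case by (rule quartic_zero)
next
  case (step c x y)
  then obtain u where "x = pure_tensor n u" "\<forall>k<n. u k \<in> schur (if k \<in> K' then [2, 2] else [4])" by blast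
  then have "quartic n x (test_tensor K v) = 0" using quartic_pure_test_tensor_other[OF assms(1-3)] by simp
  with step(2) show ?case
    unfolding quartic_add quartic_fscale by simp
qed

definition sum_to_poly :: "nat \<Rightarrow> (nat list list \<times> (nat \<times> nat) set \<Rightarrow> complex) \<Rightarrow> (nat set \<Rightarrow> complex) \<Rightarrow> complex" where
  "sum_to_poly n F = (\<Sum>K\<in>triples n. quartic n (\<lambda>J. F (shape n K, J)))"

definition poly_to_sum :: "nat \<Rightarrow> ((nat set \<Rightarrow> complex) \<Rightarrow> complex) \<Rightarrow> nat list list \<times> (nat \<times> nat) set \<Rightarrow> complex" where
  "poly_to_sum n f = (\<lambda>(qs, J). if qs \<in> shape n ` triples n then component_of_poly n {k. k < n \<and> qs ! k = [2, 2]} f J else 0)"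

definition hd_schur_sum :: "nat \<Rightarrow> (nat list list \<times> (nat \<times> nat) set \<Rightarrow> complex) set" where
  "hd_schur_sum n = schur_sum ([[2, 2], [2, 2], [2, 2]] @ replicate (n - 3) [4])"

lemma poly_to_sum_shape:
  assumes "K \<in> triples n"
  shows "poly_to_sum n f (shape n K, J) = component_of_poly n K f J"
proof -
  have "{k. k < n \<and> shape n K ! k = [2, 2]} = K"
    using assms by (auto simp: triples_def shape_def split: if_splits)
  then show ?thesis using assms by (simp add: poly_to_sum_def)
qed

lemma hd_schur_sum_iff:
  assumes "n \<ge> 3"
  shows "F \<in> hd_schur_sum n \<longleftrightarrow> (\<forall>K\<in>triples n. (\<lambda>J. F (shape n K, J)) \<in> schur_tensor (shape n K)) \<and>
    (\<forall>qs. qs \<notin> shape n ` triples n \<longrightarrow> (\<forall>J. F (qs, J) = 0))"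
proof -
  have m: "mset qs = mset ([[2, 2], [2, 2], [2, 2]] @ replicate (n - 3) [4 :: nat]) \<longleftrightarrow> qs \<in> shape n ` triples n" for qs
    using mset_qs_iff[OF assms, of qs] by blast
  have "F \<in> hd_schur_sum n \<longleftrightarrow> (\<forall>qs. (\<lambda>J. F (qs, J)) \<in> (if qs \<in> shape n ` triples n then schur_tensor qs else {0}))"
    unfolding hd_schur_sum_def schur_sum_def m by blast
  also have "\<dots> \<longleftrightarrow> (\<forall>K\<in>triples n. (\<lambda>J. F (shape n K, J)) \<in> schur_tensor (shape n K)) \<and>
    (\<forall>qs. qs \<notin> shape n ` triples n \<longrightarrow> (\<forall>J. F (qs, J) = 0))"
    by (auto simp: fun_eq_iff split: if_splits)
  finally show ?thesis .
qed

lemma sum_to_poly_in_HD: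
  assumes "n \<ge> 3" "F \<in> hd_schur_sum n"
  shows "sum_to_poly n F \<in> HD n"
  unfolding sum_to_poly_def using assms hd_schur_sum_iff by (intro HD_sum quartic_in_HD) auto

text \<open>At the test tensors for \<open>K\<close> all other summands vanish, so
  \<open>component_of_poly\<close> sees the component \<open>K\<close> alone.\<close>

lemma poly_to_sum_sum_to_poly:
  assumes "n \<ge> 3" "F \<in> hd_schur_sum n"
  shows "poly_to_sum n (sum_to_poly n F) = F"
proof (rule ext, clarify)
  fix qs J
  show "poly_to_sum n (sum_to_poly n F) (qs, J) = F (qs, J)"
  proof (cases "qs \<in> shape n ` triples n")
    case True
    then obtain K where K: "K \<in> triples n" "qs = shape n K" by blast
    have X: "(\<lambda>J. F (shape n K', J)) \<in> schur_tensor (shape n K')" if "K' \<in> triples n" for K'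
      using assms that hd_schur_sum_iff by blast
    have "sum_to_poly n F (test_tensor K v) = quartic n (\<lambda>J. F (shape n K, J)) (test_tensor K v)" for v
    proof -
      have "sum_to_poly n F (test_tensor K v) = (\<Sum>K'\<in>triples n. quartic n (\<lambda>J. F (shape n K', J)) (test_tensor K v))"
        by (simp add: sum_to_poly_def sum_fun_apply)
      also have "\<dots> = (\<Sum>K'\<in>{K}. quartic n (\<lambda>J. F (shape n K', J)) (test_tensor K v))"
        using K(1) quartic_test_tensor_other[OF K(1) _ _ X] by (intro sum.mono_neutral_right finite_triples) auto
      finally show ?thesis by simp
    qed
    then have "component_of_poly n K (sum_to_poly n F) = component_of_poly n K (quartic n (\<lambda>J. F (shape n K, J)))"
      by (simp add: component_of_poly_def fun_eq_iff)
    also have "\<dots> = (\<lambda>J. F (shape n K, J))" by (rule component_of_poly_quartic[OF K(1) X[OF K(1)]])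
    finally show ?thesis by (simp add: K poly_to_sum_shape)
  next
    case False
    then show ?thesis using assms hd_schur_sum_iff by (simp add: poly_to_sum_def)
  qed
qed

lemma poly_to_sum_add: "poly_to_sum n (f + g) = poly_to_sum n f + poly_to_sum n g"
  by (auto simp: poly_to_sum_def fun_eq_iff component_of_poly_add)

lemma poly_to_sum_fscale: "poly_to_sum n (fscale c f) = fscale c (poly_to_sum n f)"
  by (auto simp: poly_to_sum_def fun_eq_iff component_of_poly_fscale) (auto simp: fscale_def)

lemma sum_to_poly_add: "sum_to_poly n (F + G) = sum_to_poly n F + sum_to_poly n G"
  by (rule ext) (simp add: sum_to_poly_def sum_fun_apply sum.distrib[symmetric] quartic_def algebra_simps)

lemma sum_to_poly_fscale: "sum_to_poly n (fscale c F) = fscale c (sum_to_poly n F)"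
  by (rule ext) (simp add: sum_to_poly_def sum_fun_apply fscale_def quartic_def sum_distrib_left mult.assoc)

lemma hd_schur_sum_zero: "n \<ge> 3 \<Longrightarrow> 0 \<in> hd_schur_sum n"
proof -
  assume n: "n \<ge> 3"
  have "(\<lambda>J. (0 :: nat list list \<times> (nat \<times> nat) set \<Rightarrow> complex) (qs, J)) = 0" for qs
    by (simp add: zero_fun_def)
  moreover have "0 \<in> schur_tensor qs" for qs unfolding schur_tensor_def by (rule cfun.span_zero)
  ultimately show ?thesis unfolding hd_schur_sum_iff[OF n] by simp
qed

lemma hd_schur_sum_add:
  assumes "n \<ge> 3" "F \<in> hd_schur_sum n" "G \<in> hd_schur_sum n"
  shows "F + G \<in> hd_schur_sum n"
proof -
  have "(\<lambda>J. (F + G) (qs, J)) = (\<lambda>J. F (qs, J)) + (\<lambda>J. G (qs, J))" for qs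
    by (simp add: fun_eq_iff)
  with assms show ?thesis
    unfolding hd_schur_sum_iff[OF assms(1)] schur_tensor_def by (auto intro!: cfun.span_add)
qed

lemma hd_schur_sum_fscale:
  assumes "n \<ge> 3" "F \<in> hd_schur_sum n"
  shows "fscale c F \<in> hd_schur_sum n"
proof -
  have 1: "(\<lambda>J. fscale c F (qs, J)) = fscale c (\<lambda>J. F (qs, J))" for qs
    by (simp add: fun_eq_iff fscale_def)
  have 2: "fscale c X \<in> schur_tensor qs" if "X \<in> schur_tensor qs" for X qs
    using that unfolding schur_tensor_def by (rule cfun.span_scale)
  show ?thesis
    unfolding hd_schur_sum_iff[OF assms(1)]
  proof (intro conjI ballI allI impI)
    fix K assume "K \<in> triples n"
    then show "(\<lambda>J. fscale c F (shape n K, J)) \<in> schur_tensor (shape n K)"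
      unfolding 1 using assms hd_schur_sum_iff by (intro 2) blast
  next
    fix qs J assume "qs \<notin> shape n ` triples n"
    then show "fscale c F (qs, J) = 0" using assms hd_schur_sum_iff by (simp add: fscale_def)
  qed
qed

lemma hyp_factor_in_schur: "hyp_factor K r k \<in> schur (if k \<in> K then [2, 2] else [4])"
proof -
  have "u22 = fscale 1 u22" by (simp add: fscale_def)
  then have "u22 \<in> schur [2, 2]" unfolding schur_22 by (rule range_eqI)
  then show ?thesis by (simp add: hyp_factor_def power4_in_schur)
qed

lemma slice_hyperdet_in_image:
  assumes n: "n \<ge> 3" and d: "distinct3 n i j k"
  obtains F where "F \<in> hd_schur_sum n" "sum_to_poly n F = slice_hyperdet n i j k r"
proof -
  let ?K = "{i, j, k}"
  let ?X = "fscale (1 / 12) (pure_tensor n (hyp_factor ?K r))"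
  define F where "F = (\<lambda>(qs, J). if qs = shape n ?K then ?X J else 0)"
  have K: "?K \<in> triples n" using d by (rule distinct3_triples)
  have F: "(\<lambda>J. F (shape n K', J)) = (if K' = ?K then ?X else 0)" if "K' \<in> triples n" for K'
    using shape_inj[of K' n ?K] that K by (auto simp: F_def triples_def fun_eq_iff)
  have X: "?X \<in> schur_tensor (shape n ?K)"
    unfolding schur_tensor_shape using hyp_factor_in_schur by (intro cfun.span_scale cfun.span_base) blast
  have "0 \<in> schur_tensor qs" for qs unfolding schur_tensor_def by (rule cfun.span_zero)
  with F X K have "F \<in> hd_schur_sum n"
    unfolding hd_schur_sum_iff[OF n] by (auto simp: F_def)
  moreover have "sum_to_poly n F = slice_hyperdet n i j k r"
  proof
    fix z
    have "sum_to_poly n F z = (\<Sum>K'\<in>triples n. if K' = ?K then quartic n ?X z else 0)"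
      unfolding sum_to_poly_def sum_fun_apply by (rule sum.cong) (auto simp: F quartic_zero)
    also have "\<dots> = slice_hyperdet n i j k r z"
      using K by (simp add: finite_triples quartic_fscale quartic_hyp_factor[OF d])
    finally show "sum_to_poly n F z = slice_hyperdet n i j k r z" .
  qed
  ultimately show ?thesis by (rule that)
qed

text \<open>By linearity this concerns only the spanning hyperdeterminants, each of which is the
  image of a single pure tensor.\<close>

lemma HD_poly_to_sum:
  assumes "n \<ge> 3" "f \<in> HD n"
  shows "sum_to_poly n (poly_to_sum n f) = f \<and> poly_to_sum n f \<in> hd_schur_sum n"
  using assms(2)[unfolded HD_eq[OF assms(1)]]
proof (induction rule: cfun.span_induct_alt)
  case base
  have "poly_to_sum n 0 = 0" by (auto simp: poly_to_sum_def component_of_poly_def fun_eq_iff)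
  moreover have "sum_to_poly n 0 = 0" by (rule ext) (simp add: sum_to_poly_def sum_fun_apply quartic_def)
  ultimately show ?case using hd_schur_sum_zero[OF assms(1)] by (simp only:)
next
  case (step c x y)
  then obtain i j k r where x: "x = slice_hyperdet n i j k r" "distinct3 n i j k" by (auto simp: slice_hyperdets_def)
  obtain F where F: "F \<in> hd_schur_sum n" "sum_to_poly n F = slice_hyperdet n i j k r"
    using slice_hyperdet_in_image[OF assms(1) x(2)] .
  then have "poly_to_sum n x = F" using poly_to_sum_sum_to_poly[OF assms(1) F(1)] by (simp add: x)
  with step(2) F show ?case
    unfolding poly_to_sum_add poly_to_sum_fscale sum_to_poly_add sum_to_poly_fscale
    by (simp only: x hd_schur_sum_add[OF assms(1)] hd_schur_sum_fscale[OF assms(1)])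
qed

lemma bij_poly_to_sum:
  assumes "n \<ge> 3"
  shows "bij_betw (poly_to_sum n) (HD n) (hd_schur_sum n)"
  by (rule bij_betw_byWitness[where f' = "sum_to_poly n"])
    (use assms HD_poly_to_sum poly_to_sum_sum_to_poly sum_to_poly_in_HD in auto)

section \<open>Equivariance under SL(2) in each position\<close>

lemma mat_act_add: "mat_act P g (y + z) = mat_act P g y + mat_act P g z"
  by (rule ext) (simp add: mat_act_def algebra_simps sum.distrib)

lemma mat_act_fscale: "mat_act P g (fscale c z) = fscale c (mat_act P g z)"
  by (rule ext) (simp add: mat_act_def fscale_def sum_distrib_left mult_ac)

lemma mat_act_zero: "mat_act P g 0 = 0"
  by (rule ext) (simp add: mat_act_def)

lemma mat_act_sum: "mat_act P g (\<Sum>i\<in>S. f i) = (\<Sum>i\<in>S. mat_act P g (f i))"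
proof (induction S rule: infinite_finite_induct)
  case (infinite S)
  show ?case unfolding sum.infinite[OF infinite] by (rule mat_act_zero)
next
  case empty
  show ?case unfolding sum.empty by (rule mat_act_zero)
next
  case (insert x S)
  show ?case unfolding sum.insert[OF insert.hyps] mat_act_add insert.IH ..
qed

text \<open>The same matrix in all positions commutes with permuting the positions, hence with Young
  symmetrizers; this makes Schur modules stable.\<close>

lemma mat_act_perm_act:
  assumes p: "p permutes B"
  shows "mat_act B (\<lambda>_. m) (perm_act p z) = perm_act p (mat_act B (\<lambda>_. m) z)"
proof
  fix I
  have sub: "p -` I \<subseteq> B \<longleftrightarrow> I \<subseteq> B"
  proof
    assume *: "p -` I \<subseteq> B"
    show "I \<subseteq> B"
    proof
      fix x assume "x \<in> I"
      obtain w where w: "x = p w" using permutes_surj[OF p] by (metis surjD)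
      then have "w \<in> B" using * \<open>x \<in> I\<close> by auto
      then show "x \<in> B" using permutes_in_image[OF p] w by auto
    qed
  next
    assume "I \<subseteq> B"
    then show "p -` I \<subseteq> B" using permutes_in_image[OF p] by blast
  qed
  show "mat_act B (\<lambda>_. m) (perm_act p z) I = perm_act p (mat_act B (\<lambda>_. m) z) I"
  proof (cases "I \<subseteq> B")
    case True
    let ?f = "\<lambda>J. (\<Prod>x\<in>B. m $$ (of_bool (x \<in> p -` I), of_bool (x \<in> J))) * z J"
    have "(\<Sum>J\<in>Pow B. ?f J) = (\<Sum>J\<in>Pow B. (\<Prod>x\<in>B. m $$ (of_bool (x \<in> I), of_bool (x \<in> J))) * z (p -` J))"
    proof (rule sum.reindex_bij_witness[where i = "(-`) p" and j = "(`) p"])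
      fix J assume J: "J \<in> Pow B"
      show 1: "p -` p ` J = J" using permutes_inj[OF p] by (simp add: inj_vimage_image_eq)
      show "p ` J \<in> Pow B" using J permutes_image[OF p] by auto
      have "(\<Prod>x\<in>B. m $$ (of_bool (x \<in> I), of_bool (x \<in> p ` J))) =
          (\<Prod>x\<in>B. m $$ (of_bool (p x \<in> I), of_bool (p x \<in> p ` J)))"
        using prod.permute[OF p, of "\<lambda>x. m $$ (of_bool (x \<in> I), of_bool (x \<in> p ` J))"] by (simp add: o_def)
      then show "(\<Prod>x\<in>B. m $$ (of_bool (x \<in> I), of_bool (x \<in> p ` J))) * z (p -` p ` J) = ?f J"
        using permutes_inj[OF p] by (simp add: inj_vimage_image_eq inj_image_mem_iff)
    next
      fix J assume J: "J \<in> Pow B"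
      show "p ` (p -` J) = J" using permutes_surj[OF p] by (simp add: surj_image_vimage_eq)
      show "p -` J \<in> Pow B" using J permutes_in_image[OF p] by auto
    qed
    then show ?thesis using True sub by (simp add: mat_act_def perm_act_def)
  qed (use sub in \<open>simp add: mat_act_def perm_act_def\<close>)
qed

lemma schur_mat_act:
  assumes "y \<in> schur \<pi>"
  shows "mat_act {..<sum_list \<pi>} (\<lambda>_. m) y \<in> schur \<pi>"
proof -
  let ?B = "{..<sum_list \<pi>}"
  obtain z where z: "z \<in> tensors ?B" and y: "y = young_symmetrizer \<pi> z"
    using assms by (auto simp: schur_def)
  have "mat_act ?B (\<lambda>_. m) z \<in> tensors ?B" by (simp add: tensors_def mat_act_def)
  moreover have "mat_act ?B (\<lambda>_. m) y = young_symmetrizer \<pi> (mat_act ?B (\<lambda>_. m) z)"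
    unfolding y young_symmetrizer_def Let_def mat_act_sum mat_act_fscale
    by (intro sum.cong refl) (simp add: mat_act_perm_act)
  ultimately show ?thesis unfolding schur_def by (intro image_eqI)
qed

lemma mat_act_cong: "(\<And>p. p \<in> P \<Longrightarrow> g p = h p) \<Longrightarrow> mat_act P g z = mat_act P h z"
proof
  fix I
  assume eq: "\<And>p. p \<in> P \<Longrightarrow> g p = h p"
  have "(\<Prod>p\<in>P. g p $$ (of_bool (p \<in> I), of_bool (p \<in> J))) = (\<Prod>p\<in>P. h p $$ (of_bool (p \<in> I), of_bool (p \<in> J)))" for J
    by (rule prod.cong) (simp_all add: eq)
  then show "mat_act P g z I = mat_act P h z I" by (simp add: mat_act_def)
qed

lemma mat_act_pure:
  "mat_act ({..<n} \<times> {..<4}) (\<lambda>(k, j). m k) (pure_tensor n u) = pure_tensor n (\<lambda>k. mat_act {..<4} (\<lambda>_. m k) (u k))"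
proof
  fix I :: "(nat \<times> nat) set"
  show "mat_act ({..<n} \<times> {..<4}) (\<lambda>(k, j). m k) (pure_tensor n u) I = pure_tensor n (\<lambda>k. mat_act {..<4} (\<lambda>_. m k) (u k)) I"
  proof (cases "I \<subseteq> {..<n} \<times> {..<4}")
    case False
    have "pure_tensor n (\<lambda>k. mat_act {..<4} (\<lambda>_. m k) (u k)) I = 0"
    proof (cases "I \<subseteq> {..<n} \<times> UNIV")
      case True
      then obtain k j where kj: "(k, j) \<in> I" "k < n" "\<not> j < 4" using False by auto
      then have "\<not> I `` {k} \<subseteq> {..<4}" by auto
      then have "mat_act {..<4} (\<lambda>_. m k) (u k) (I `` {k}) = 0" by (simp add: mat_act_def)
      then have "(\<Prod>k<n. mat_act {..<4} (\<lambda>_. m k) (u k) (I `` {k})) = 0"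
        using kj by (auto intro!: prod_zero)
      then show ?thesis by (simp add: pure_tensor_def)
    qed (simp add: pure_tensor_def)
    then show ?thesis using False by (simp add: mat_act_def)
  next
    case True
    then have row: "I `` {k} \<subseteq> {..<4}" for k by auto
    let ?f = "\<lambda>k S. (\<Prod>j<4. m k $$ (of_bool (j \<in> I `` {k}), of_bool (j \<in> S))) * u k S"
    have "mat_act ({..<n} \<times> {..<4}) (\<lambda>(k, j). m k) (pure_tensor n u) I
        = (\<Sum>J\<in>Pow ({..<n} \<times> {..<4}). \<Prod>k<n. ?f k (J `` {k}))"
    proof -
      have "mat_act ({..<n} \<times> {..<4}) (\<lambda>(k, j). m k) (pure_tensor n u) I =
          (\<Sum>J\<in>Pow ({..<n} \<times> {..<4}). (\<Prod>p\<in>{..<n} \<times> {..<4}. (case p of (k, j) \<Rightarrow> m k) $$ (of_bool (p \<in> I), of_bool (p \<in> J))) * pure_tensor n u J)"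
        using True by (simp add: mat_act_def)
      also have "\<dots> = (\<Sum>J\<in>Pow ({..<n} \<times> {..<4}). \<Prod>k<n. ?f k (J `` {k}))"
      proof (rule sum.cong[OF refl])
        fix J assume "J \<in> Pow ({..<n} \<times> {..<4 :: nat})"
        then have "pure_tensor n u J = (\<Prod>k<n. u k (J `` {k}))" by (auto simp: pure_tensor_def)
        moreover have "(\<Prod>p\<in>{..<n} \<times> {..<4}. (case p of (k, j) \<Rightarrow> m k) $$ (of_bool (p \<in> I), of_bool (p \<in> J))) =
            (\<Prod>k<n. \<Prod>j<4. m k $$ (of_bool ((k, j) \<in> I), of_bool ((k, j) \<in> J)))"
          by (simp add: prod.cartesian_product case_prod_unfold)
        ultimately show "(\<Prod>p\<in>{..<n} \<times> {..<4}. (case p of (k, j) \<Rightarrow> m k) $$ (of_bool (p \<in> I), of_bool (p \<in> J))) * pure_tensor n u J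
            = (\<Prod>k<n. ?f k (J `` {k}))"
          by (simp add: prod.distrib)
      qed
      finally show ?thesis .
    qed
    also have "\<dots> = (\<Prod>k<n. \<Sum>S\<in>Pow {..<4}. ?f k S)"
      by (rule prod_Pow_rows) auto
    also have "\<dots> = (\<Prod>k<n. mat_act {..<4} (\<lambda>_. m k) (u k) (I `` {k}))"
      using row by (simp add: mat_act_def)
    also have "\<dots> = pure_tensor n (\<lambda>k. mat_act {..<4} (\<lambda>_. m k) (u k)) I"
      using True by (auto simp: pure_tensor_def)
    finally show ?thesis .
  qed
qed

lemma schur_tensor_mat_act:
  assumes "X \<in> schur_tensor (shape n K)"
  shows "mat_act ({..<n} \<times> {..<4}) (\<lambda>(k, j). m k) X \<in> schur_tensor (shape n K)"
  using assms unfolding schur_tensor_shape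
proof (induction rule: cfun.span_induct_alt)
  case base
  show ?case unfolding mat_act_zero by (rule cfun.span_zero)
next
  case (step c x y)
  then obtain u where u: "x = pure_tensor n u" "\<forall>k<n. u k \<in> schur (if k \<in> K then [2, 2] else [4])" by blast
  have "mat_act {..<4} (\<lambda>_. m k) (u k) \<in> schur (if k \<in> K then [2, 2] else [4])" if "k < n" for k
    using schur_mat_act[of "u k" "if k \<in> K then [2, 2] else [4]" "m k"] u(2) that by (simp split: if_splits)
  then have "mat_act ({..<n} \<times> {..<4}) (\<lambda>(k, j). m k) x \<in>
      cfun.span {pure_tensor n u |u. \<forall>k<n. u k \<in> schur (if k \<in> K then [2, 2] else [4])}"
    unfolding u(1) mat_act_pure by (intro cfun.span_base) blast
  with step(2) show ?case
    unfolding mat_act_add mat_act_fscale by (intro cfun.span_add cfun.span_scale)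
qed

lemma schur_act_shape:
  "schur_act g F (shape n K, J) =
    mat_act ({..<n} \<times> {..<4}) (\<lambda>(k, j). transpose_mat (inv\<^bsub>SL2\<^esub> (g k))) (\<lambda>L. F (shape n K, L)) J"
proof -
  have "(SIGMA k:{..<length (shape n K)}. {..<sum_list (shape n K ! k)}) = {..<n} \<times> {..<4}"
    by (rule Sigma_cong) (auto simp: shape_def)
  then show ?thesis by (simp add: schur_act_def)
qed

lemma schur_act_hd_schur_sum:
  assumes "n \<ge> 3" "F \<in> hd_schur_sum n"
  shows "schur_act g F \<in> hd_schur_sum n"
  unfolding hd_schur_sum_iff[OF assms(1)]
proof (intro conjI ballI allI impI)
  fix K assume "K \<in> triples n"
  then have "(\<lambda>L. F (shape n K, L)) \<in> schur_tensor (shape n K)"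
    using assms hd_schur_sum_iff by blast
  from schur_tensor_mat_act[OF this] show "(\<lambda>J. schur_act g F (shape n K, J)) \<in> schur_tensor (shape n K)"
    unfolding schur_act_shape .
next
  fix qs J assume "qs \<notin> shape n ` triples n"
  then have "F (qs, L) = 0" for L using assms hd_schur_sum_iff by blast
  then show "schur_act g F (qs, J) = 0" by (simp add: schur_act_def mat_act_def)
qed

text \<open>Acting on the tensor by transposes is adjoint to acting on each of the four copies of
  \<open>z\<close>. This matches the transposed inverse in \<open>schur_act\<close> with the inverse
  in \<open>poly_act\<close>.\<close>

lemma quartic_mat_act:
  assumes "\<And>k. k < n \<Longrightarrow> h k \<in> carrier_mat 2 2"
  shows "quartic n (mat_act ({..<n} \<times> {..<4}) (\<lambda>(k, j). transpose_mat (h k)) X) z = quartic n X (mat_act {..<n} h z)"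
proof -
  let ?D = "{..<n} \<times> {..<4 :: nat}"
  let ?H = "\<lambda>I J. \<Prod>l<4. \<Prod>k<n. h k $$ (of_bool ((k, l) \<in> J), of_bool ((k, l) \<in> I))"
  have "mat_act ?D (\<lambda>(k, j). transpose_mat (h k)) X I = (\<Sum>J\<in>Pow ?D. ?H I J * X J)" if "I \<in> Pow ?D" for I
  proof -
    have "(\<Prod>p\<in>?D. (case p of (k, j) \<Rightarrow> transpose_mat (h k)) $$ (of_bool (p \<in> I), of_bool (p \<in> J))) = ?H I J" for J
    proof -
      have "(\<Prod>p\<in>?D. (case p of (k, j) \<Rightarrow> transpose_mat (h k)) $$ (of_bool (p \<in> I), of_bool (p \<in> J))) =
          (\<Prod>k<n. \<Prod>l<4. transpose_mat (h k) $$ (of_bool ((k, l) \<in> I), of_bool ((k, l) \<in> J)))"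
        by (simp add: prod.cartesian_product case_prod_unfold)
      also have "\<dots> = (\<Prod>k<n. \<Prod>l<4. h k $$ (of_bool ((k, l) \<in> J), of_bool ((k, l) \<in> I)))"
      proof (intro prod.cong refl)
        fix k l assume "k \<in> {..<n}"
        then have "h k \<in> carrier_mat 2 2" using assms by simp
        then show "transpose_mat (h k) $$ (of_bool ((k, l) \<in> I), of_bool ((k, l) \<in> J)) = h k $$ (of_bool ((k, l) \<in> J), of_bool ((k, l) \<in> I))"
          by (subst index_transpose_mat) auto
      qed
      also have "\<dots> = ?H I J" by (rule prod.swap)
      finally show ?thesis .
    qed
    with that show ?thesis by (simp add: mat_act_def)
  qed
  then have "quartic n (mat_act ?D (\<lambda>(k, j). transpose_mat (h k)) X) z =
      (\<Sum>I\<in>Pow ?D. \<Sum>J\<in>Pow ?D. ?H I J * X J * (\<Prod>l<4. z {k. (k, l) \<in> I}))"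
    by (simp add: quartic_def sum_distrib_right)
  also have "\<dots> = (\<Sum>J\<in>Pow ?D. \<Sum>I\<in>Pow ?D. ?H I J * X J * (\<Prod>l<4. z {k. (k, l) \<in> I}))"
    by (rule sum.swap)
  also have "\<dots> = (\<Sum>J\<in>Pow ?D. X J * (\<Prod>l<4. mat_act {..<n} h z {k. (k, l) \<in> J}))"
  proof (rule sum.cong[OF refl])
    fix J assume J: "J \<in> Pow ?D"
    let ?f = "\<lambda>l I. (\<Prod>k<n. h k $$ (of_bool ((k, l) \<in> J), of_bool (k \<in> I))) * z I"
    have "(\<Sum>I\<in>Pow ?D. ?H I J * X J * (\<Prod>l<4. z {k. (k, l) \<in> I})) = X J * (\<Sum>I\<in>Pow ?D. \<Prod>l<4. ?f l {k. (k, l) \<in> I})"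
      by (simp add: prod.distrib sum_distrib_left mult_ac)
    also have "(\<Sum>I\<in>Pow ?D. \<Prod>l<4. ?f l {k. (k, l) \<in> I}) = (\<Prod>l<4. \<Sum>I\<in>Pow {..<n}. ?f l I)"
      by (rule prod_Pow_cols) auto
    also have "\<dots> = (\<Prod>l<4. mat_act {..<n} h z {k. (k, l) \<in> J})"
    proof (rule prod.cong[OF refl])
      fix l
      have "{k. (k, l) \<in> J} \<subseteq> {..<n}" using J by auto
      then show "(\<Sum>I\<in>Pow {..<n}. ?f l I) = mat_act {..<n} h z {k. (k, l) \<in> J}"
        by (simp add: mat_act_def)
    qed
    finally show "(\<Sum>I\<in>Pow ?D. ?H I J * X J * (\<Prod>l<4. z {k. (k, l) \<in> I})) = X J * (\<Prod>l<4. mat_act {..<n} h z {k. (k, l) \<in> J})" .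
  qed
  finally show ?thesis by (simp add: quartic_def)
qed

lemma inv_SL2_sym_id:
  assumes "g \<in> carrier (SL2_pow n)"
  shows "inv\<^bsub>SL2_sym n\<^esub> (g, id) = ((\<lambda>k\<in>{..<n}. inv\<^bsub>SL2\<^esub> (g k)), id)"
proof -
  interpret S: group SL2 by (rule group_SL2)
  interpret G: group "SL2_sym n" by (rule group_SL2_sym)
  have g: "g k \<in> carrier SL2" if "k < n" for k
    using assms that by (auto simp: SL2_pow_def)
  show ?thesis
  proof (rule G.inv_equality)
    show "((\<lambda>k\<in>{..<n}. inv\<^bsub>SL2\<^esub> (g k)), id) \<otimes>\<^bsub>SL2_sym n\<^esub> (g, id) = \<one>\<^bsub>SL2_sym n\<^esub>"
      using g by (auto simp: SL2_sym_def SL2_pow_def fun_eq_iff)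
    show "(g, id) \<in> carrier (SL2_sym n)"
      using assms by (simp add: SL2_sym_def permutes_id)
    show "((\<lambda>k\<in>{..<n}. inv\<^bsub>SL2\<^esub> (g k)), id) \<in> carrier (SL2_sym n)"
      using g by (auto simp: SL2_sym_def SL2_pow_def permutes_id)
  qed
qed

lemma sum_to_poly_equivariant:
  assumes "g \<in> carrier (SL2_pow n)"
  shows "sum_to_poly n (schur_act g F) = poly_act n (g, id) (sum_to_poly n F)"
proof
  fix z :: "nat set \<Rightarrow> complex"
  interpret S: group SL2 by (rule group_SL2)
  let ?h = "\<lambda>k. inv\<^bsub>SL2\<^esub> (g k)"
  have "g k \<in> carrier SL2" if "k < n" for k
    using assms that by (auto simp: SL2_pow_def)
  then have "?h k \<in> carrier SL2" if "k < n" for k using that by simp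
  then have h: "?h k \<in> carrier_mat 2 2" if "k < n" for k using that by (auto simp: SL2_def)
  have "perm_act id z = z" by (simp add: perm_act_def)
  then have t: "tensor_act n (inv\<^bsub>SL2_sym n\<^esub> (g, id)) z = mat_act {..<n} ?h z"
  proof -
    have "mat_act {..<n} (\<lambda>k\<in>{..<n}. ?h k) z = mat_act {..<n} ?h z" by (rule mat_act_cong) simp
    with \<open>perm_act id z = z\<close> show ?thesis
      unfolding inv_SL2_sym_id[OF assms] tensor_act_def by simp
  qed
  show "sum_to_poly n (schur_act g F) z = poly_act n (g, id) (sum_to_poly n F) z"
    unfolding poly_act_def t sum_to_poly_def sum_fun_apply schur_act_shape
    by (intro sum.cong refl quartic_mat_act h)
qed

text \<open>Equivariance is a direct computation for \<open>sum_to_poly\<close> and passes to the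
  inverse bijection \<open>poly_to_sum\<close>.\<close>

lemma isomorphic_HD:
  assumes n: "n \<ge> 3"
  shows "isomorphic_modules (SL2_pow n) (\<lambda>g. poly_act n (g, id)) (HD n) schur_act (hd_schur_sum n)"
  unfolding isomorphic_modules_def
proof (intro conjI exI[of _ "poly_to_sum n"] ballI allI)
  have c: "(g, id) \<in> carrier (SL2_sym n)" if "g \<in> carrier (SL2_pow n)" for g
    using that by (simp add: SL2_sym_def permutes_id)
  have closed: "poly_act n (g, id) f \<in> HD n" if "g \<in> carrier (SL2_pow n)" "f \<in> HD n" for g f
    using submodule_HD[OF n] c[OF that(1)] that(2) by (auto simp: submodule_def)
  show "submodule (SL2_pow n) (\<lambda>g. poly_act n (g, id)) (HD n)"
    using submodule_HD[OF n] closed by (auto simp: submodule_def)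
  show "submodule (SL2_pow n) schur_act (hd_schur_sum n)"
    unfolding submodule_def cfun.subspace_def
    using hd_schur_sum_zero[OF n] hd_schur_sum_add[OF n] hd_schur_sum_fscale[OF n] schur_act_hd_schur_sum[OF n] by blast
  show "bij_betw (poly_to_sum n) (HD n) (hd_schur_sum n)" by (rule bij_poly_to_sum[OF n])
  show "poly_to_sum n (x + y) = poly_to_sum n x + poly_to_sum n y" for x y by (rule poly_to_sum_add)
  show "poly_to_sum n (fscale c x) = fscale c (poly_to_sum n x)" for c x by (rule poly_to_sum_fscale)
  fix g f assume g: "g \<in> carrier (SL2_pow n)" and f: "f \<in> HD n"
  have F: "sum_to_poly n (poly_to_sum n f) = f" "poly_to_sum n f \<in> hd_schur_sum n" using HD_poly_to_sum[OF n f] by auto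
  have "poly_to_sum n (poly_act n (g, id) f) = poly_to_sum n (sum_to_poly n (schur_act g (poly_to_sum n f)))"
    unfolding sum_to_poly_equivariant[OF g] F(1) ..
  also have "\<dots> = schur_act g (poly_to_sum n f)"
    by (rule poly_to_sum_sum_to_poly[OF n schur_act_hd_schur_sum[OF n F(2)]])
  finally show "poly_to_sum n (poly_act n (g, id) f) = schur_act g (poly_to_sum n f)" .
qed

section \<open>Irreducibility\<close>

text \<open>The hyperdeterminant along \<open>X + t * s * Y\<close> is a quartic in \<open>t\<close>
  with leading coefficient \<open>s ^ 4 * cayley Y\<close>, and the fourth difference is 4! times
  the leading coefficient.\<close>

lemma cayley_fourth_difference:
  "cayley X - 4 * cayley (\<lambda>a b c. X a b c + s * Y a b c) + 6 * cayley (\<lambda>a b c. X a b c + 2 * s * Y a b c)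
    - 4 * cayley (\<lambda>a b c. X a b c + 3 * s * Y a b c) + cayley (\<lambda>a b c. X a b c + 4 * s * Y a b c)
    = 24 * s ^ 4 * cayley Y"
proof -
  define A0 A1 A2 where "A0 = det2 (X False)" "A1 = polar_det2 (X False) (Y False)" "A2 = det2 (Y False)"
  define B0 B1 B2 where "B0 = det2 (X True)" "B1 = polar_det2 (X True) (Y True)" "B2 = det2 (Y True)"
  define P0 P1 P2 where "P0 = polar_det2 (X False) (X True)" "P1 = polar_det2 (X False) (Y True) + polar_det2 (Y False) (X True)"
    "P2 = polar_det2 (Y False) (Y True)"
  have h: "cayley (\<lambda>a b c. X a b c + t * Y a b c) =
      (P0 + t * P1 + t ^ 2 * P2) ^ 2 - 4 * (A0 + t * A1 + t ^ 2 * A2) * (B0 + t * B1 + t ^ 2 * B2)" for t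
  proof -
    have k: "det2 (\<lambda>b c. X a b c + t * Y a b c) = det2 (X a) + t * polar_det2 (X a) (Y a) + t ^ 2 * det2 (Y a)" for a
      by (simp add: det2_def polar_det2_def power2_eq_square algebra_simps)
    have p: "polar_det2 (\<lambda>b c. X False b c + t * Y False b c) (\<lambda>b c. X True b c + t * Y True b c) = P0 + t * P1 + t ^ 2 * P2"
      by (simp add: P0_P1_P2_def polar_det2_def power2_eq_square algebra_simps)
    show ?thesis unfolding cayley_discriminant k p A0_A1_A2_def B0_B1_B2_def ..
  qed
  have x: "cayley X = P0 ^ 2 - 4 * A0 * B0" "cayley Y = P2 ^ 2 - 4 * A2 * B2"
    by (simp_all add: cayley_discriminant A0_A1_A2_def B0_B1_B2_def P0_P1_P2_def)
  show ?thesis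
    unfolding h x by (simp add: eval_nat_numeral algebra_simps)
qed

text \<open>The value of the covector \<open>r p\<close> at (1, v p), the vector that
  \<open>test_tensor\<close> carries in position \<open>p\<close>.\<close>

definition lin_form :: "(nat \<Rightarrow> complex) \<Rightarrow> (nat \<Rightarrow> bool \<Rightarrow> complex) \<Rightarrow> nat \<Rightarrow> complex" where
  "lin_form v r p = r p False + v p * r p True"

definition kernel_vec :: "(nat \<Rightarrow> complex) \<Rightarrow> nat \<Rightarrow> bool \<Rightarrow> complex" where
  "kernel_vec v p b = (if b then 1 else - v p)"

text \<open>The transvection \<open>r \<mapsto> r + t \<sqdot> l(r) k\<close> in position \<open>p\<close>, where \<open>k\<close> spans the kernel of the linear
  form \<open>l\<close>.\<close>
definition transvection :: "nat \<Rightarrow> (nat \<Rightarrow> complex) \<Rightarrow> nat \<Rightarrow> complex \<Rightarrow> (nat \<Rightarrow> complex mat) \<times> (nat \<Rightarrow> nat)" where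
  "transvection n v p t = ((\<lambda>q\<in>{..<n}. if q = p then mat 2 2 (\<lambda>(i, j).
     if i = 0 then (if j = 0 then 1 - t * v p else t) else (if j = 0 then - t * v p ^ 2 else 1 + t * v p)) else 1\<^sub>m 2), id)"

lemma transvection_carrier: "transvection n v p t \<in> carrier (SL2_sym n)"
proof -
  have "det (mat 2 2 (\<lambda>(i, j). if i = 0 then (if j = 0 then 1 - t * v p else t)
      else (if j = 0 then - t * v p ^ 2 else 1 + t * v p))) = 1"
    by (subst det_mat_2x2) (auto simp: power2_eq_square algebra_simps)
  then show ?thesis
    by (auto simp: transvection_def carrier_SL2_sym permutes_id)
qed

lemma slice_hyperdet_transvection:
  assumes d: "distinct3 n i j k" and p: "p < n"
  shows "slice_hyperdet n i j k r (tensor_act n (transvection n v p t) z)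
    = slice_hyperdet n i j k (r(p := (\<lambda>b. r p b + t * lin_form v r p * kernel_vec v p b))) z"
proof -
  define g where "g = fst (transvection n v p t)"
  have g: "transvection n v p t = (g, id)" by (simp add: g_def transvection_def)
  have gq: "g q = (if q = p then mat 2 2 (\<lambda>(i, j).
     if i = 0 then (if j = 0 then 1 - t * v p else t) else (if j = 0 then - t * v p ^ 2 else 1 + t * v p)) else 1\<^sub>m 2)"
    if "q < n" for q
    using that by (simp add: g_def transvection_def)
  have c: "(g, id) \<in> carrier (SL2_sym n)" using transvection_carrier[of n v p t] by (simp add: g)
  have "slice_hyperdet n i j k r (tensor_act n (g, id) z) = slice_hyperdet n i j k (vec_act r g) z"
    using slice_hyperdet_tensor_act[OF c] d by (simp add: distinct3_def)
  also have "\<dots> = slice_hyperdet n i j k (r(p := (\<lambda>b. r p b + t * lin_form v r p * kernel_vec v p b))) z"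
  proof (rule slice_hyperdet_cong)
    fix q assume "q < n" "q \<notin> {i, j, k}"
    then show "vec_act r g q = (r(p := (\<lambda>b. r p b + t * lin_form v r p * kernel_vec v p b))) q"
      by (auto simp: gq vec_act_def lin_form_def kernel_vec_def fun_eq_iff power2_eq_square algebra_simps)
  qed
  finally show ?thesis by (simp add: g)
qed

definition fourth_diff :: "nat \<Rightarrow> (nat \<Rightarrow> complex) \<Rightarrow> nat \<Rightarrow> ((nat set \<Rightarrow> complex) \<Rightarrow> complex) \<Rightarrow> (nat set \<Rightarrow> complex) \<Rightarrow> complex" where
  "fourth_diff n v p f = (\<lambda>z. f (tensor_act n (transvection n v p 0) z) - 4 * f (tensor_act n (transvection n v p 1) z)
     + 6 * f (tensor_act n (transvection n v p 2) z) - 4 * f (tensor_act n (transvection n v p 3) z)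
     + f (tensor_act n (transvection n v p 4) z))"

lemma fourth_diff_add: "fourth_diff n v p (f + g) = fourth_diff n v p f + fourth_diff n v p g"
  by (rule ext) (simp add: fourth_diff_def algebra_simps)

lemma fourth_diff_fscale: "fourth_diff n v p (fscale c f) = fscale c (fourth_diff n v p f)"
  by (rule ext) (simp add: fourth_diff_def fscale_def algebra_simps)

lemma submodule_translate:
  assumes U: "submodule (SL2_sym n) (poly_act n) U" and f: "f \<in> U" and h: "h \<in> carrier (SL2_sym n)"
  shows "(\<lambda>z. f (tensor_act n h z)) \<in> U"
proof -
  interpret G: group "SL2_sym n" by (rule group_SL2_sym)
  have "poly_act n (inv\<^bsub>SL2_sym n\<^esub> h) f \<in> U"
    using U f G.inv_closed[OF h] by (auto simp: submodule_def)
  then show ?thesis using h by (simp add: poly_act_def)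
qed

lemma fourth_diff_submodule:
  assumes U: "submodule (SL2_sym n) (poly_act n) U" and f: "f \<in> U"
  shows "fourth_diff n v p f \<in> U"
proof -
  have s: "cfun.subspace U" using U by (simp add: submodule_def)
  let ?g = "\<lambda>t z. f (tensor_act n (transvection n v p t) z)"
  have g: "?g t \<in> U" for t by (rule submodule_translate[OF U f transvection_carrier])
  have "fourth_diff n v p f = ?g 0 - fscale 4 (?g 1) + fscale 6 (?g 2) - fscale 4 (?g 3) + ?g 4"
    by (rule ext) (simp add: fourth_diff_def fscale_def)
  also have "\<dots> \<in> U"
    by (intro cfun.subspace_add[OF s] cfun.subspace_diff[OF s] cfun.subspace_scale[OF s] g)
  finally show ?thesis .
qed

text \<open>In a position of the triple the transvections fix the hyperdeterminant, and the weights
  1 - 4 + 6 - 4 + 1 add up to 0. In any other position the covector moves along a line with speed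
  \<open>lin_form v r p\<close>.\<close>

lemma fourth_diff_slice_hyperdet:
  assumes d: "distinct3 n i j k" and p: "p < n"
  shows "fourth_diff n v p (slice_hyperdet n i j k r)
    = fscale (if p \<in> {i, j, k} then 0 else 24 * lin_form v r p ^ 4) (slice_hyperdet n i j k (r(p := kernel_vec v p)))"
proof
  fix z
  show "fourth_diff n v p (slice_hyperdet n i j k r) z
    = fscale (if p \<in> {i, j, k} then 0 else 24 * lin_form v r p ^ 4) (slice_hyperdet n i j k (r(p := kernel_vec v p))) z"
  proof (cases "p \<in> {i, j, k}")
    case True
    have "slice_hyperdet n i j k (r(p := w)) z = slice_hyperdet n i j k r z" for w
      by (rule slice_hyperdet_cong) (use True in auto)
    then show ?thesis using True by (simp add: fourth_diff_def slice_hyperdet_transvection[OF d p] fscale_def)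
  next
    case False
    let ?s = "lin_form v r p"
    define X where "X a b c = contract_all n z (r(i := bvec a, j := bvec b, k := bvec c))" for a b c
    define Y where "Y a b c = contract_all n z ((r(p := kernel_vec v p))(i := bvec a, j := bvec b, k := bvec c))" for a b c
    have "contract_all n z ((r(p := (\<lambda>x. r p x + t * ?s * kernel_vec v p x)))(i := bvec a, j := bvec b, k := bvec c)) = X a b c + t * ?s * Y a b c" for a b c t
    proof -
      let ?R = "r(i := bvec a, j := bvec b, k := bvec c)"
      have upd: "(r(p := w))(i := bvec a, j := bvec b, k := bvec c) = ?R(p := w)" for w
        using False by (auto simp: fun_eq_iff)
      have lin: "contract_all n z (?R(p := w)) = w False * contract_all n z (?R(p := bvec False)) + w True * contract_all n z (?R(p := bvec True))" for w
        by (rule contract_linear_at) (use p in auto)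
      have "?R = ?R(p := r p)" using False by (auto simp: fun_eq_iff)
      then have "X a b c = r p False * contract_all n z (?R(p := bvec False)) + r p True * contract_all n z (?R(p := bvec True))"
        unfolding X_def using lin[of "r p"] by simp
      moreover have "Y a b c = kernel_vec v p False * contract_all n z (?R(p := bvec False)) + kernel_vec v p True * contract_all n z (?R(p := bvec True))"
        unfolding Y_def upd by (rule lin)
      ultimately show ?thesis
        unfolding upd by (subst lin) (simp add: algebra_simps)
    qed
    then have H: "slice_hyperdet n i j k (r(p := (\<lambda>x. r p x + t * ?s * kernel_vec v p x))) z = cayley (\<lambda>a b c. X a b c + t * ?s * Y a b c)" for t
      by (simp add: slice_hyperdet_def)
    have "slice_hyperdet n i j k (r(p := kernel_vec v p)) z = cayley Y"
      by (simp add: slice_hyperdet_def Y_def[abs_def])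
    moreover have "X a b c + 0 * ?s * Y a b c = X a b c" "1 * ?s * Y a b c = ?s * Y a b c" for a b c
      by simp_all
    ultimately show ?thesis
      using False cayley_fourth_difference[of X ?s Y]
      unfolding fourth_diff_def slice_hyperdet_transvection[OF d p] H fscale_def by simp
  qed
qed

text \<open>With \<open>Q\<close> the complement of a triple, only hyperdeterminants on that triple
  survive, and as \<open>kernel_vec\<close> replaces \<open>r\<close> in all of \<open>Q\<close>
  they become multiples of a single one.\<close>

lemma fourth_diff_iterated:
  assumes U: "submodule (SL2_sym n) (poly_act n) U" and "finite Q" "Q \<subseteq> {..<n}"
  shows "\<exists>T. (\<forall>f\<in>U. T f \<in> U) \<and> (\<forall>f g. T (f + g) = T f + T g) \<and> (\<forall>c f. T (fscale c f) = fscale c (T f)) \<and>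
    (\<forall>i j k r. distinct3 n i j k \<longrightarrow> T (slice_hyperdet n i j k r) =
      fscale (if Q \<inter> {i, j, k} = {} then \<Prod>p\<in>Q. 24 * lin_form v r p ^ 4 else 0)
        (slice_hyperdet n i j k (\<lambda>p. if p \<in> Q then kernel_vec v p else r p)))"
  using assms(2,3)
proof (induction Q rule: finite_induct)
  case empty
  show ?case by (rule exI[of _ id]) (simp add: fscale_def)
next
  case (insert q Q)
  then have "Q \<subseteq> {..<n}" by simp
  from insert.IH[OF this] obtain T where T: "\<forall>f\<in>U. T f \<in> U" "\<forall>f g. T (f + g) = T f + T g" "\<forall>c f. T (fscale c f) = fscale c (T f)"
    "\<forall>i j k r. distinct3 n i j k \<longrightarrow> T (slice_hyperdet n i j k r) =
      fscale (if Q \<inter> {i, j, k} = {} then \<Prod>p\<in>Q. 24 * lin_form v r p ^ 4 else 0)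
        (slice_hyperdet n i j k (\<lambda>p. if p \<in> Q then kernel_vec v p else r p))"
    by (elim exE conjE) (rule that; assumption)
  show ?case
  proof (rule exI[of _ "\<lambda>f. fourth_diff n v q (T f)"], intro conjI ballI allI impI)
    show "fourth_diff n v q (T f) \<in> U" if "f \<in> U" for f using T(1) that fourth_diff_submodule[OF U] by blast
    show "fourth_diff n v q (T (f + g)) = fourth_diff n v q (T f) + fourth_diff n v q (T g)" for f g
      unfolding T(2)[rule_format] by (rule fourth_diff_add)
    show "fourth_diff n v q (T (fscale c f)) = fscale c (fourth_diff n v q (T f))" for c f
      unfolding T(3)[rule_format] by (rule fourth_diff_fscale)
    fix i j k r assume d: "distinct3 n i j k"
    let ?r = "\<lambda>p. if p \<in> Q then kernel_vec v p else r p"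
    have q: "q < n" using insert.prems by auto
    have r: "?r(q := kernel_vec v q) = (\<lambda>p. if p \<in> insert q Q then kernel_vec v p else r p)" by (auto simp: fun_eq_iff)
    have l: "lin_form v ?r q = lin_form v r q" using insert.hyps by (simp add: lin_form_def)
    have ff: "fscale a (fscale b f) = fscale (a * b) f" for a b and f :: "(nat set \<Rightarrow> complex) \<Rightarrow> complex"
      by (simp add: fscale_def mult.assoc)
    show "fourth_diff n v q (T (slice_hyperdet n i j k r)) =
        fscale (if insert q Q \<inter> {i, j, k} = {} then \<Prod>p\<in>insert q Q. 24 * lin_form v r p ^ 4 else 0)
          (slice_hyperdet n i j k (\<lambda>p. if p \<in> insert q Q then kernel_vec v p else r p))"
      unfolding T(4)[rule_format, OF d] fourth_diff_fscale fourth_diff_slice_hyperdet[OF d q] r l ff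
      using insert.hyps by (intro arg_cong2[where f = fscale] refl) auto
  qed
qed

lemma hyp_factor_sum: "K \<in> triples n \<Longrightarrow> (\<Sum>T\<in>Pow {..<4}. \<Prod>k\<in>K. hyp_factor K r k T) = 12"
proof -
  assume K: "K \<in> triples n"
  have "(\<Prod>k\<in>K. hyp_factor K r k T) = u22 T ^ 3" for T
  proof -
    have "(\<Prod>k\<in>K. hyp_factor K r k T) = (\<Prod>k\<in>K. u22 T)" by (rule prod.cong) (simp_all add: hyp_factor_def)
    then show ?thesis using K by (simp add: triples_def)
  qed
  then show ?thesis by (simp add: u22_power_sum)
qed

lemma slice_hyperdet_test_tensor:
  assumes d: "distinct3 n i j k" and K: "K \<in> triples n"
  shows "slice_hyperdet n i j k r (test_tensor K v) = (if {i, j, k} = K then \<Prod>p\<in>{..<n} - K. lin_form v r p ^ 4 else 0)"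
proof -
  have Kn: "K \<subseteq> {..<n}" "K \<noteq> {}" using K by (auto simp: triples_def)
  have "12 * slice_hyperdet n i j k r (test_tensor K v) = quartic n (pure_tensor n (hyp_factor {i, j, k} r)) (test_tensor K v)"
    by (rule quartic_hyp_factor[OF d, symmetric])
  also have "\<dots> = (if {i, j, k} = K then 12 * (\<Prod>p\<in>{..<n} - K. lin_form v r p ^ 4) else 0)"
  proof (cases "{i, j, k} = K")
    case True
    have "(\<Prod>p\<in>{..<n} - K. eval4 (hyp_factor K r p) (v p)) = (\<Prod>p\<in>{..<n} - K. lin_form v r p ^ 4)"
      by (rule prod.cong) (simp_all add: hyp_factor_def eval4_power4 lin_form_def)
    then show ?thesis unfolding True by (simp add: quartic_pure_test_tensor[OF Kn] hyp_factor_sum[OF K])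
  next
    case False
    then have ne: "K \<noteq> {i, j, k}" by auto
    have "quartic n (pure_tensor n (hyp_factor {i, j, k} r)) (test_tensor K v) = 0"
      by (rule quartic_pure_test_tensor_other[OF K distinct3_triples[OF d] ne]) (intro allI impI hyp_factor_in_schur)
    with False show ?thesis by (simp only: if_False)
  qed
  finally show ?thesis by (simp split: if_splits)
qed

text \<open>The symmetry of Cayley's invariant in its three factors, obtained from the tensor
  \<open>hyp_factor\<close>, which knows only the set \<open>{i, j, k}\<close>.\<close>

lemma slice_hyperdet_set_cong:
  assumes "distinct3 n i j k" "distinct3 n i' j' k'" "{i, j, k} = {i', j', k'}"
  shows "slice_hyperdet n i j k r = slice_hyperdet n i' j' k' r"
proof
  fix z
  show "slice_hyperdet n i j k r z = slice_hyperdet n i' j' k' r z"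
    using quartic_hyp_factor[OF assms(1), of r z] quartic_hyp_factor[OF assms(2), of r z] assms(3) by simp
qed

text \<open>\<open>component_of_poly\<close> uses values at test tensors only; if they all vanish,
  then every component does, and \<open>f\<close> with them.\<close>

lemma nonzero_at_test_tensor:
  assumes "n \<ge> 3" "f \<in> HD n" "f \<noteq> 0"
  obtains K v where "K \<in> triples n" "f (test_tensor K v) \<noteq> 0"
proof -
  have "\<exists>K v. K \<in> triples n \<and> f (test_tensor K v) \<noteq> 0"
  proof (rule ccontr)
    assume "\<not> ?thesis"
    then have "f (test_tensor K v) = 0" if "K \<in> triples n" for K v using that by blast
    then have "component_of_poly n K f J = 0" if "K \<in> triples n" for K J using that by (simp add: component_of_poly_def)
    then have "poly_to_sum n f (qs, J) = 0" for qs J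
      by (cases "qs \<in> shape n ` triples n") (auto simp: poly_to_sum_shape, simp add: poly_to_sum_def)
    then have "poly_to_sum n f = 0" by (auto simp: fun_eq_iff)
    moreover have "sum_to_poly n 0 = 0" by (rule ext) (simp add: sum_to_poly_def sum_fun_apply quartic_def)
    ultimately have "f = 0" using HD_poly_to_sum[OF assms(1,2)] by metis
    with assms(3) show False by blast
  qed
  then show ?thesis using that by blast
qed

lemma irreducible_HD:
  assumes n: "n \<ge> 3"
  shows "irreducible_module (SL2_sym n) (poly_act n) (HD n)"
  unfolding irreducible_module_def
proof (intro conjI allI impI)
  show "submodule (SL2_sym n) (poly_act n) (HD n)" by (rule submodule_HD[OF n])
  have "hyperdet \<in> HD n" unfolding HD_eq[OF n] by (rule cfun.span_base[OF hyperdet_in_slice_hyperdets[OF n]])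
  moreover have d: "distinct3 n 0 1 2" using n by (simp add: distinct3_def)
  have "hyperdet (test_tensor {0, 1, 2} (\<lambda>_. 0)) = 1"
    unfolding hyperdet_eq_slice_hyperdet[OF n] slice_hyperdet_test_tensor[OF d distinct3_triples[OF d]] by (simp add: lin_form_def)
  then have "hyperdet \<noteq> 0" by auto
  ultimately show "HD n \<noteq> {0}" by blast
  fix U assume sub: "U \<subseteq> HD n" and U: "submodule (SL2_sym n) (poly_act n) U"
  have s: "cfun.subspace U" using U by (simp add: submodule_def)
  show "U = {0} \<or> U = HD n"
  proof (rule disjCI)
    assume "U \<noteq> HD n"
    show "U = {0}"
    proof (rule ccontr)
      assume "U \<noteq> {0}"
      moreover have "0 \<in> U" by (rule cfun.subspace_0[OF s])
      ultimately obtain f where f: "f \<in> U" "f \<noteq> 0" by blast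
      then obtain K v where K: "K \<in> triples n" and fz: "f (test_tensor K v) \<noteq> 0"
        using nonzero_at_test_tensor[OF n] sub by blast
      obtain i0 j0 k0 where d0: "distinct3 n i0 j0 k0" and K0: "K = {i0, j0, k0}"
        using triples_obtain[OF K] .
      let ?Q = "{..<n} - K"
      let ?H = "slice_hyperdet n i0 j0 k0 (kernel_vec v)"
      have Q: "finite ?Q" "?Q \<subseteq> {..<n}" by auto
      from fourth_diff_iterated[OF U Q, of v] obtain T where T: "\<forall>f\<in>U. T f \<in> U" "\<forall>f g. T (f + g) = T f + T g" "\<forall>c f. T (fscale c f) = fscale c (T f)"
        "\<forall>i j k r. distinct3 n i j k \<longrightarrow> T (slice_hyperdet n i j k r) =
          fscale (if ?Q \<inter> {i, j, k} = {} then \<Prod>p\<in>?Q. 24 * lin_form v r p ^ 4 else 0)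
            (slice_hyperdet n i j k (\<lambda>p. if p \<in> ?Q then kernel_vec v p else r p))"
        by (elim exE conjE) (rule that; assumption)
      \<comment> \<open>Both sides are linear in \<open>g\<close>, so hyperdeterminants suffice: the
        factors \<open>lin_form v r p ^ 4\<close> produced by the differences are exactly those of
        the value at the test tensor, by \<open>slice_hyperdet_test_tensor\<close>.\<close>
      have Tg: "T g = fscale (24 ^ card ?Q * g (test_tensor K v)) ?H" if "g \<in> HD n" for g
        using that[unfolded HD_eq[OF n]]
      proof (induction rule: cfun.span_induct_alt)
        case base
        have z: "fscale 0 h = 0" for h :: "(nat set \<Rightarrow> complex) \<Rightarrow> complex"
          by (rule ext) (simp add: fscale_def)
        have T0: "T 0 = 0" using T(3)[rule_format, of 0 0] unfolding z .
        have "fscale (24 ^ card ?Q * (0 :: (nat set \<Rightarrow> complex) \<Rightarrow> complex) (test_tensor K v)) ?H = 0"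
          by (rule ext) (simp add: fscale_def)
        with T0 show ?case by (rule trans[OF _ sym])
      next
        case (step c x y)
        then obtain i j k r where x: "x = slice_hyperdet n i j k r" and d: "distinct3 n i j k" by (auto simp: slice_hyperdets_def)
        have disj: "?Q \<inter> {i, j, k} = {} \<longleftrightarrow> {i, j, k} = K"
        proof
          assume "?Q \<inter> {i, j, k} = {}"
          then have "{i, j, k} \<subseteq> K" using d by (auto simp: distinct3_def)
          moreover have "card {i, j, k} = card K" "finite K"
            using distinct3_triples[OF d] K finite_subset[of K "{..<n}"] by (auto simp: triples_def)
          ultimately show "{i, j, k} = K" using card_subset_eq by blast
        qed auto
        have "T x = fscale (24 ^ card ?Q * x (test_tensor K v)) ?H"
        proof (cases "{i, j, k} = K")
          case True
          have "slice_hyperdet n i j k (\<lambda>p. if p \<in> ?Q then kernel_vec v p else r p) = slice_hyperdet n i j k (kernel_vec v)"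
            by (rule ext, rule slice_hyperdet_cong) (use True in auto)
          also have "\<dots> = ?H" by (rule slice_hyperdet_set_cong[OF d d0]) (use True K0 in simp)
          finally show ?thesis
            unfolding x T(4)[rule_format, OF d] slice_hyperdet_test_tensor[OF d K] disj using True by (simp add: prod.distrib)
        next
          case False
          then show ?thesis
            unfolding x T(4)[rule_format, OF d] slice_hyperdet_test_tensor[OF d K] disj by (simp add: fscale_def)
        qed
        then show ?case
          unfolding T(2)[rule_format] T(3)[rule_format] step(2)
          by (simp only:) (rule ext, simp add: fscale_def algebra_simps)
      qed
      have "f \<in> HD n" using f sub by blast
      from Tg[OF this] T(1) f(1) have "fscale (24 ^ card ?Q * f (test_tensor K v)) ?H \<in> U" by metis
      then have "fscale (1 / (24 ^ card ?Q * f (test_tensor K v))) (fscale (24 ^ card ?Q * f (test_tensor K v)) ?H) \<in> U"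
        by (rule cfun.subspace_scale[OF s])
      also have "fscale (1 / (24 ^ card ?Q * f (test_tensor K v))) (fscale (24 ^ card ?Q * f (test_tensor K v)) ?H) = ?H"
        using fz by (simp add: fscale_def)
      finally have H: "?H \<in> U" .
      have e: "bvec False \<noteq> 0" by (auto simp: fun_eq_iff)
      have kv: "kernel_vec v p \<noteq> 0" for p
      proof
        assume "kernel_vec v p = 0"
        then have "kernel_vec v p True = 0" by simp
        then show False by (simp add: kernel_vec_def)
      qed
      \<comment> \<open>As \<open>kernel_vec\<close> is nowhere zero, \<open>?H\<close> can be
        carried to \<open>hyperdet\<close>, whose orbit spans \<open>HD n\<close>.\<close>
      obtain h where h: "h \<in> carrier (SL2_sym n)" "\<And>z. ?H (tensor_act n h z) = slice_hyperdet n 0 1 2 (\<lambda>_. bvec False) z"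
        by (rule slice_hyperdet_transitive[of i0 n j0 k0 0 1 2 "kernel_vec v" "\<lambda>_. bvec False"])
          (use n d0 e kv in \<open>auto simp: distinct3_def\<close>)
      have "(\<lambda>z. ?H (tensor_act n h z)) = hyperdet"
        by (rule ext) (simp add: h(2) hyperdet_eq_slice_hyperdet[OF n])
      with submodule_translate[OF U H h(1)] have "hyperdet \<in> U" by simp
      then have "{poly_act n h hyperdet | h. h \<in> carrier (SL2_sym n)} \<subseteq> U"
        using U by (auto simp: submodule_def)
      then have "HD n \<subseteq> U" unfolding HD_def by (rule cfun.span_minimal[OF _ s])
      with sub \<open>U \<noteq> HD n\<close> show False by blast
    qed
  qed
qed

theorem theorem1p3:
  fixes n :: nat
  assumes "n \<ge> 3"
  shows "Z_variety n = zero_locus n (HD n)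
    \<and> HD n \<subseteq> sym_power n 4
    \<and> irreducible_module (SL2_sym n) (poly_act n) (HD n)
    \<and> isomorphic_modules (SL2_pow n)
        (\<lambda>g. poly_act n (g, id)) (HD n)
        schur_act (schur_sum ([[2,2], [2,2], [2,2]] @ replicate (n - 3) [4]))"
  using Z_variety_subset[OF assms] zero_locus_subset_Z_variety[OF assms] HD_subset_sym_power[OF assms]
    irreducible_HD[OF assms] isomorphic_HD[OF assms, unfolded hd_schur_sum_def] by blast

end
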